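(* There is a deterministic algorithm that, given a directed graph $G$ with $n$ vertices and $m$ edges (as adjacency lists) and an integer $k\le n$, such that the number of $k$-paths in $G$ is $0$ or $1$, decides whether $G$ contains a $k$-path, in time $2^k(n+m)\operatorname{poly}(k)$.
   Context: A $k$-path in $G$ is a sequence $w_1,\dots,w_k$ of pairwise distinct vertices with $w_iw_{i+1}\in E(G)$ for all $i\in\{1,\dots,k-1\}$. Running time is in the word-RAM model with words in $\{-n,\dots,n\}$.
   Formalization: Words range over {-(n+m+4),…,n+m+4} (the input size) instead of {-n,…,n}, since with n the number of vertices such words cannot address the adjacency lists of a dense graph; G is a simple directed graph and k ≥ 0. *)

theory Defs
  imports Main
begin

definition valid_digraph :: "nat list list \<Rightarrow> bool" where
  "valid_digraph adj \<longleftrightarrow>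
     (\<forall>u < length adj. distinct (adj ! u) \<and> (\<forall>v \<in> set (adj ! u). v < length adj \<and> v \<noteq> u))"

definition num_edges :: "nat list list \<Rightarrow> nat" where
  "num_edges adj = sum_list (map length adj)"

definition is_edge :: "nat list list \<Rightarrow> nat \<Rightarrow> nat \<Rightarrow> bool" where
  "is_edge adj u v \<longleftrightarrow> u < length adj \<and> v \<in> set (adj ! u)"

definition is_kpath :: "nat list list \<Rightarrow> nat \<Rightarrow> nat list \<Rightarrow> bool" where
  "is_kpath adj k ws \<longleftrightarrow>
     length ws = k \<and> distinct ws \<and> set ws \<subseteq> {0..<length adj} \<and>
     (\<forall>i. Suc i < k \<longrightarrow> is_edge adj (ws ! i) (ws ! Suc i))"

definition num_kpaths :: "nat list list \<Rightarrow> nat \<Rightarrow> nat" where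
  "num_kpaths adj k = card {ws. is_kpath adj k ws}"

text \<open>Registers are indexed by natural numbers (a program only uses finitely
  many), memory cells by integers. Every value written to a register must be a
  word, i.e. lie in {-W..W}; otherwise the machine gets stuck (and never halts).
  Each instruction costs one time unit.\<close>

datatype instr =
    Const nat int
  | Add nat nat nat
  | Sub nat nat nat
  | Mul nat nat nat
  | Div nat nat nat
  | Mod nat nat nat
  | Load nat nat
  | Store nat nat
  | JmpZ nat nat
  | JmpLt nat nat nat
  | Jmp nat
  | Halt

type_synonym conf = "nat \<times> (nat \<Rightarrow> int) \<times> (int \<Rightarrow> int)"

definition halted :: "instr list \<Rightarrow> conf \<Rightarrow> bool" where
  "halted P c \<longleftrightarrow> (fst c \<ge> length P \<or> P ! fst c = Halt)"

definition wr :: "int \<Rightarrow> nat \<Rightarrow> nat \<Rightarrow> (nat \<Rightarrow> int) \<Rightarrow> (int \<Rightarrow> int) \<Rightarrow> int \<Rightarrow> conf option" where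
  "wr W pc r R M x = (if \<bar>x\<bar> \<le> W then Some (Suc pc, R(r := x), M) else None)"

fun step_instr :: "int \<Rightarrow> instr \<Rightarrow> conf \<Rightarrow> conf option" where
  "step_instr W (Const r x) (pc, R, M) = wr W pc r R M x"
| "step_instr W (Add r a b) (pc, R, M) = wr W pc r R M (R a + R b)"
| "step_instr W (Sub r a b) (pc, R, M) = wr W pc r R M (R a - R b)"
| "step_instr W (Mul r a b) (pc, R, M) = wr W pc r R M (R a * R b)"
| "step_instr W (Div r a b) (pc, R, M) =
     (if R b = 0 then None else wr W pc r R M (R a div R b))"
| "step_instr W (Mod r a b) (pc, R, M) =
     (if R b = 0 then None else wr W pc r R M (R a mod R b))"
| "step_instr W (Load r a) (pc, R, M) = wr W pc r R M (M (R a))"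
| "step_instr W (Store a r) (pc, R, M) = Some (Suc pc, R, M(R a := R r))"
| "step_instr W (JmpZ r l) (pc, R, M) = Some (if R r = 0 then l else Suc pc, R, M)"
| "step_instr W (JmpLt a b l) (pc, R, M) = Some (if R a < R b then l else Suc pc, R, M)"
| "step_instr W (Jmp l) (pc, R, M) = Some (l, R, M)"
| "step_instr W Halt (pc, R, M) = Some (pc, R, M)"

fun exec :: "instr list \<Rightarrow> int \<Rightarrow> nat \<Rightarrow> conf \<Rightarrow> conf option" where
  "exec P W 0 c = Some c"
| "exec P W (Suc t) c =
     (if halted P c then Some c
      else (case step_instr W (P ! fst c) c of None \<Rightarrow> None | Some c' \<Rightarrow> exec P W t c'))"

text \<open>Memory layout: M[0] = n, M[1] = m, M[2] = k; M[3+v] for v = 0..n is the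
  address where the adjacency list of v starts (the list of v occupies
  addresses M[3+v] .. M[3+v+1]-1); then the concatenated adjacency lists.\<close>

definition encode :: "nat list list \<Rightarrow> nat \<Rightarrow> int list" where
  "encode adj k =
     [int (length adj), int (num_edges adj), int k]
     @ map (\<lambda>v. int (3 + (length adj + 1) + sum_list (map length (take v adj)))) [0..<length adj + 1]
     @ map int (concat adj)"

definition init_conf :: "int list \<Rightarrow> conf" where
  "init_conf xs = (0, (\<lambda>_. 0), (\<lambda>a. if 0 \<le> a \<and> a < int (length xs) then xs ! nat a else 0))"

definition word_bound :: "nat list list \<Rightarrow> nat \<Rightarrow> int" where
  "word_bound adj k = int (length (encode adj k))"

end

(* For a weighting a of the vertices by elements of a commutative ring of characteristic 2, consider
   the sum over all S <= {0..<k} and all walks w with k vertices of prod_i (sum_{j in S} a(w_i)^j).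
   Exchanging the sums, a walk contributes the permanent, that is the determinant, of the Vandermonde
   matrix of its weights: 0 if a vertex is repeated, and nonzero over a field if the weights are
   pairwise distinct. With at most one k-path, the sum therefore vanishes iff there is none. For fixed S
   the inner sum is a dynamic program over two arrays of n field elements, so the whole evaluation
   takes 2^k sweeps over the graph and, unlike a dynamic program over subsets, only linear space;
   this matters because the machine has only about n + m free addressable cells.

   The field is GF(2)[x]/(F) with F irreducible of degree t, and q = 2^t. If k is small compared to a
   power of the number of labels, q is about the fourth root of that number, field operations are table
   lookups, and vertices are hashed to field elements by evaluating the polynomial of their base-q
   digits at one of O(k^2) seeds, at least one of which is injective on the path. Otherwise the number
   of labels is polynomial in k, and q may exceed it while arithmetic is carried out bit by bit. *)
theory Submission
  imports Defs "HOL-Library.Z2" "HOL-Computational_Algebra.Computational_Algebra"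
    "HOL-Computational_Algebra.Field_as_Ring"
begin

section \<open>Vanishing sums in characteristic two\<close>

text \<open>Registers hold only words of absolute value at most n + m + 4, and addresses come from
  registers. The input occupies the addresses 0 to n + m + 3, so working storage lies at negative
  addresses; 2^k need not be a word, so the current S is kept in the signs of the stored offsets,
  and the table of field operations shares its cells with the values of the dynamic program. Since t
  depends on the input, no field type is formed: all algebra takes place in \<open>bit poly\<close>,
  machine words stand for residues, and nonzero in the field becomes not divisible by F. The
  exponent of the fourth root comes from the search for F: q candidates with q^2 products each, a
  product being charged 85 q steps, and the total must be linear in n. Then N labels satisfy N < 16
  q^4 <= q^8, so 8 base-q digits suffice, two labels collide for at most 7 seeds, and 7 k (k - 1) /
  2 < 4 k^2 - 1 leaves a seed without collision.\<close>

instantiation bit :: "{unique_euclidean_ring, normalization_euclidean_semiring, normalization_semidom_multiplicative}"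
begin
definition [simp]: "normalize_bit = (normalize_field :: bit \<Rightarrow> _)"
definition [simp]: "unit_factor_bit = (unit_factor_field :: bit \<Rightarrow> _)"
definition [simp]: "euclidean_size_bit = (euclidean_size_field :: bit \<Rightarrow> _)"
definition [simp]: "division_segment (x :: bit) = (1 :: bit)"
instance
  by standard
    (simp_all add: dvd_field_iff field_split_simps modulo_bit_unfold split: if_splits)
end

instantiation bit :: euclidean_ring_gcd
begin
definition gcd_bit :: "bit \<Rightarrow> bit \<Rightarrow> bit" where
  "gcd_bit = Euclidean_Algorithm.gcd"
definition lcm_bit :: "bit \<Rightarrow> bit \<Rightarrow> bit" where
  "lcm_bit = Euclidean_Algorithm.lcm"
definition Gcd_bit :: "bit set \<Rightarrow> bit" where
 "Gcd_bit = Euclidean_Algorithm.Gcd"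
definition Lcm_bit :: "bit set \<Rightarrow> bit" where
 "Lcm_bit = Euclidean_Algorithm.Lcm"
instance by standard (simp_all add: gcd_bit_def lcm_bit_def Gcd_bit_def Lcm_bit_def)
end

text \<open>With coefficients in \<open>field_gcd\<close>, \<open>bit poly\<close> has gcds and
  prime divisors, on which the existence of irreducible polynomials of every degree rests.\<close>

instance bit :: field_gcd ..

(* Expanding one factor moves the chosen index j from its sum into the lower bound U. *)
lemma sum_between_prod_char2:
  fixes A :: "'i \<Rightarrow> 'j \<Rightarrow> 'a::comm_ring_1"
  assumes "(1::'a) + 1 = 0" "finite T" "finite I" "U \<subseteq> T" "card I + card U < card T"
  shows "(\<Sum>S | U \<subseteq> S \<and> S \<subseteq> T. \<Prod>i\<in>I. \<Sum>j\<in>S. A i j) = 0"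
  using assms(3,4,5)
proof (induction I arbitrary: U rule: finite_induct)
  case empty
  \<comment> \<open>With no factor left, each S contributes 1. The number of S between U and T is a
    power of two, and an even one, since T has an element outside U.\<close>
  obtain x where x: "x \<in> T" "x \<notin> U"
    using empty by (metis add_0 card.empty less_irrefl subsetI subset_antisym)
  have finU: "finite U"
    using empty.prems assms(2) finite_subset by blast
  have "bij_betw (\<lambda>S. S \<union> U) (Pow (T - U)) {S. U \<subseteq> S \<and> S \<subseteq> T}"
    by (rule bij_betw_byWitness[where f' = "\<lambda>S. S - U"]) (use empty.prems in auto)
  then have "card {S. U \<subseteq> S \<and> S \<subseteq> T} = 2 ^ card (T - U)"
    using assms(2) by (metis bij_betw_same_card card_Pow finite_Diff)
  moreover have "card (T - U) > 0"
    using x assms(2) by (auto simp: card_gt_0_iff)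
  ultimately have "card {S. U \<subseteq> S \<and> S \<subseteq> T} = 2 * 2 ^ (card (T - U) - 1)"
    by (metis power_eq_if less_numeral_extra(3))
  then have "of_nat (card {S. U \<subseteq> S \<and> S \<subseteq> T}) = (1 + 1) * (of_nat (2 ^ (card (T - U) - 1)) :: 'a)"
    by simp
  then show ?case
    using assms(1) by simp
next
  case (insert i I)
  have fin: "finite {S. V \<subseteq> S \<and> S \<subseteq> T}" for V
    using assms(2) by (auto intro: finite_subset[of _ "Pow T"])
  have finU: "finite U"
    using insert.prems assms(2) finite_subset by blast
  let ?P = "\<lambda>S. \<Prod>i\<in>I. \<Sum>j\<in>S. A i j"
  have "(\<Sum>S | U \<subseteq> S \<and> S \<subseteq> T. \<Prod>i\<in>insert i I. \<Sum>j\<in>S. A i j)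
      = (\<Sum>S | U \<subseteq> S \<and> S \<subseteq> T. (\<Sum>j\<in>S. A i j) * ?P S)"
    using insert by simp
  also have "\<dots> = (\<Sum>S | U \<subseteq> S \<and> S \<subseteq> T. \<Sum>j\<in>T. if j \<in> S then A i j * ?P S else 0)"
  proof (rule sum.cong[OF refl])
    fix S assume "S \<in> {S. U \<subseteq> S \<and> S \<subseteq> T}"
    then have "T \<inter> S = S" by auto
    then show "(\<Sum>j\<in>S. A i j) * ?P S = (\<Sum>j\<in>T. if j \<in> S then A i j * ?P S else 0)"
      using assms(2) by (simp add: sum.inter_restrict[symmetric] sum_distrib_right)
  qed
  also have "\<dots> = (\<Sum>j\<in>T. \<Sum>S | U \<subseteq> S \<and> S \<subseteq> T. if j \<in> S then A i j * ?P S else 0)"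
    by (rule sum.swap)
  also have "\<dots> = (\<Sum>j\<in>T. A i j * (\<Sum>S | insert j U \<subseteq> S \<and> S \<subseteq> T. ?P S))"
  proof (rule sum.cong[OF refl])
    fix j assume "j \<in> T"
    have "(\<Sum>S | U \<subseteq> S \<and> S \<subseteq> T. if j \<in> S then A i j * ?P S else 0)
        = sum (\<lambda>S. A i j * ?P S) {S \<in> {S. U \<subseteq> S \<and> S \<subseteq> T}. j \<in> S}"
      using fin by (subst sum.inter_filter) auto
    also have "{S \<in> {S. U \<subseteq> S \<and> S \<subseteq> T}. j \<in> S} = {S. insert j U \<subseteq> S \<and> S \<subseteq> T}"
      by auto
    finally show "(\<Sum>S | U \<subseteq> S \<and> S \<subseteq> T. if j \<in> S then A i j * ?P S else 0)
        = A i j * (\<Sum>S | insert j U \<subseteq> S \<and> S \<subseteq> T. ?P S)"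
      by (simp add: sum_distrib_left)
  qed
  also have "\<dots> = 0"
  proof (rule sum.neutral, rule ballI)
    fix j assume j: "j \<in> T"
    \<comment> \<open>One factor is used up while the lower bound grows by at most one element, so
      the strict inequality of cardinalities survives.\<close>
    have "card (insert j U) \<le> Suc (card U)"
      using finU by (simp add: card_insert_if)
    then have "(\<Sum>S | insert j U \<subseteq> S \<and> S \<subseteq> T. ?P S) = 0"
      using insert.prems j insert.hyps by (intro insert.IH) auto
    then show "A i j * (\<Sum>S | insert j U \<subseteq> S \<and> S \<subseteq> T. ?P S) = 0" by simp
  qed
  finally show ?case .
qed

text \<open>A term of the expanded product involves at most \<open>card I\<close> elements of T,
  hence not all of T, and so an even number of subsets S contain them.\<close>

lemma sum_Pow_prod_char2:
  fixes A :: "'i \<Rightarrow> 'j \<Rightarrow> 'a::comm_ring_1"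
  assumes "(1::'a) + 1 = 0" "finite T" "finite I" "card I < card T"
  shows "(\<Sum>S\<in>Pow T. \<Prod>i\<in>I. \<Sum>j\<in>S. A i j) = 0"
  using sum_between_prod_char2[OF assms(1-3), of "{}" A] assms(4) by (simp add: Pow_def)

text \<open>Ryser's inclusion-exclusion formula for the permanent of the k x k Vandermonde matrix
  with entries \<open>a i ^ j\<close>; its signs disappear in characteristic 2.\<close>

definition ryser :: "nat \<Rightarrow> (nat \<Rightarrow> 'a::comm_ring_1) \<Rightarrow> 'a" where
  "ryser k a = (\<Sum>S\<in>Pow {..<k}. \<Prod>i<k. \<Sum>j\<in>S. a i ^ j)"

lemma add_self_char2:
  assumes "(1::'a::comm_ring_1) + 1 = 0"
  shows "(x::'a) + x = 0"
  using assms by (metis distrib_left mult.right_neutral mult_zero_right)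

lemma square_sum_char2:
  assumes "(1::'a::comm_ring_1) + 1 = 0"
  shows "(\<Sum>j\<in>S. f j :: 'a) ^ 2 = (\<Sum>j\<in>S. f j ^ 2)"
proof (induction S rule: infinite_finite_induct)
  case (insert x S)
  have "(f x + sum f S) ^ 2 = f x ^ 2 + (sum f S) ^ 2 + (f x * sum f S + f x * sum f S)"
    by (simp add: power2_eq_square algebra_simps)
  then show ?case
    using insert add_self_char2[OF assms] by simp
qed auto

(* Squaring is additive, so two equal factors merge into a single linear one, and only k - 1 factors
   are left. *)
lemma ryser_repeated:
  fixes a :: "nat \<Rightarrow> 'a::comm_ring_1"
  assumes "(1::'a) + 1 = 0" and ij: "i < k" "i' < k" "i \<noteq> i'" and eq: "a i = a i'"
  shows "ryser k a = 0"
proof -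
  let ?B = "\<lambda>l j. if l = i then a i ^ (2 * j) else a l ^ j"
  have "(\<Prod>l<k. \<Sum>j\<in>S. a l ^ j) = (\<Prod>l\<in>{..<k} - {i'}. \<Sum>j\<in>S. ?B l j)" for S
  proof -
    have "{..<k} = insert i (insert i' ({..<k} - {i, i'}))"
      using ij by auto
    then have "(\<Prod>l<k. \<Sum>j\<in>S. a l ^ j)
        = (\<Sum>j\<in>S. a i ^ j) * ((\<Sum>j\<in>S. a i' ^ j) * (\<Prod>l\<in>{..<k} - {i, i'}. \<Sum>j\<in>S. a l ^ j))"
      using ij by (metis (no_types, lifting) Diff_iff finite_Diff finite_insert finite_lessThan insert_iff prod.insert)
    also have "\<dots> = (\<Sum>j\<in>S. a i ^ j) ^ 2 * (\<Prod>l\<in>{..<k} - {i, i'}. \<Sum>j\<in>S. a l ^ j)"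
      using eq by (simp add: power2_eq_square mult.assoc)
    also have "\<dots> = (\<Sum>j\<in>S. ?B i j) * (\<Prod>l\<in>{..<k} - {i, i'}. \<Sum>j\<in>S. ?B l j)"
      by (simp add: square_sum_char2[OF assms(1)] power_mult[symmetric] mult.commute cong: prod.cong_simp)
    also have "\<dots> = (\<Prod>l\<in>insert i ({..<k} - {i, i'}). \<Sum>j\<in>S. ?B l j)"
      by (subst prod.insert) auto
    also have "insert i ({..<k} - {i, i'}) = {..<k} - {i'}"
      using ij by auto
    finally show ?thesis .
  qed
  then have "ryser k a = (\<Sum>S\<in>Pow {..<k}. \<Prod>l\<in>{..<k} - {i'}. \<Sum>j\<in>S. ?B l j)"
    by (simp add: ryser_def)
  also have "\<dots> = 0"
    using ij by (intro sum_Pow_prod_char2[OF assms(1)]) auto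
  finally show ?thesis .
qed

text \<open>Synthetic division by a root b, after which the prime p is cancelled against c - b: the
  usual bound on the number of roots, taken modulo p and phrased by divisibility so that no quotient
  type is needed.\<close>

lemma prime_dvd_coeffs_of_roots:
  fixes P :: "'a::idom poly"
  assumes "prime_elem p" "finite B" "\<forall>b\<in>B. p dvd poly P b"
    "\<forall>b\<in>B. \<forall>c\<in>B. b \<noteq> c \<longrightarrow> \<not> p dvd b - c" "degree P < card B"
  shows "p dvd coeff P i"
  using assms(2-5)
proof (induction "degree P" arbitrary: P B i)
  case 0
  then obtain b where "b \<in> B" by fastforce
  obtain c where "P = [:c:]" using 0(1) by (metis degree_eq_zeroE)
  then show ?case using 0 \<open>b \<in> B\<close> by (auto simp: coeff_pCons split: nat.split)
next
  case (Suc n)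
  obtain b where b: "b \<in> B" using Suc.prems by fastforce
  let ?Q = "synthetic_div P b"
  have P: "P = [:-b, 1:] * ?Q + [:poly P b:]"
    by (metis synthetic_div_correct')
  have "p dvd coeff ?Q i" for i
  proof (rule Suc.hyps(1)[of ?Q "B - {b}"])
    show "n = degree ?Q" using Suc.hyps(2) by (simp add: degree_synthetic_div)
    show "\<forall>c\<in>B - {b}. p dvd poly ?Q c"
    proof
      fix c assume c: "c \<in> B - {b}"
      have "p dvd poly P c" "p dvd poly P b" using Suc.prems b c by auto
      moreover have "poly P c = (c - b) * poly ?Q c + poly P b"
        by (subst P) (simp add: algebra_simps)
      ultimately have "p dvd (c - b) * poly ?Q c"
        by (metis dvd_add_left_iff)
      then show "p dvd poly ?Q c"
        using assms(1) Suc.prems(3) b c by (metis DiffE insertI1 prime_elem_dvd_mult_iff)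
    qed
    show "degree ?Q < card (B - {b})"
      using Suc.prems Suc.hyps(2) b by (simp add: degree_synthetic_div)
  qed (use Suc.prems in auto)
  then have "p dvd coeff ([:-b, 1:] * ?Q) i"
    by (simp add: coeff_pCons dvd_mult split: nat.split)
  moreover have "p dvd coeff [:poly P b:] i"
    using Suc.prems b by (auto simp: coeff_pCons split: nat.split)
  ultimately show ?case
    by (subst P) (metis coeff_add dvd_add)
qed

(* As a polynomial in the last argument x this has degree k, the other arguments as roots, and
   leading coefficient ryser k a. *)
lemma ryser_not_dvd:
  fixes a :: "nat \<Rightarrow> 'a::idom"
  assumes c2: "(1::'a) + 1 = 0" and p: "prime_elem p"
    and "\<And>i j. i < j \<Longrightarrow> j < k \<Longrightarrow> \<not> p dvd a i - a j"
  shows "\<not> p dvd ryser k a"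
  using assms(3)
proof (induction k)
  case 0
  show ?case using p by (simp add: ryser_def prime_elem_def)
next
  case (Suc k)
  let ?c = "\<lambda>S. \<Prod>i<k. \<Sum>j\<in>S. a i ^ j"
  define P where "P = (\<Sum>S\<in>Pow {..<Suc k}. smult (?c S) (\<Sum>j\<in>S. monom 1 j))"
  have poly_P: "poly P x = ryser (Suc k) (a(k := x))" for x
  proof -
    have *: "(\<Prod>i<k. \<Sum>j\<in>S. (a(k := x)) i ^ j) = ?c S" for S
      by (rule prod.cong) auto
    show ?thesis
      unfolding ryser_def prod.lessThan_Suc *
      by (simp add: P_def poly_sum poly_monom)
  qed
  have deg: "degree P \<le> k"
    unfolding P_def
  proof (rule degree_sum_le)
    fix S assume "S \<in> Pow {..<Suc k}"
    then have "degree (\<Sum>j\<in>S. monom (1::'a) j) \<le> k"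
      by (intro degree_sum_le) (auto simp: degree_monom_eq finite_subset)
    then show "degree (smult (?c S) (\<Sum>j\<in>S. monom 1 j)) \<le> k"
      using degree_smult_le order_trans by blast
  qed auto
  have coeff: "coeff P k = - ryser k a"
  proof -
    \<comment> \<open>k factors against k + 1 available elements: the sum over all S vanishes, so
      the S that contain k contribute minus the sum over the others, and that is
      \<open>ryser k a\<close>.\<close>
    have all: "(\<Sum>S\<in>Pow {..<Suc k}. ?c S) = 0"
      by (rule sum_Pow_prod_char2[OF c2]) auto
    have "coeff P k = (\<Sum>S\<in>Pow {..<Suc k}. if k \<in> S then ?c S else 0)"
      unfolding P_def coeff_sum coeff_smult
      by (rule sum.cong) (auto simp: coeff_monom finite_subset[of _ "{..<Suc k}"] if_distrib cong: if_cong)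
    also have "\<dots> = (\<Sum>S\<in>Pow {..<Suc k}. ?c S) - (\<Sum>S\<in>Pow {..<Suc k}. if k \<in> S then 0 else ?c S)"
      by (simp add: sum_subtractf[symmetric] if_distrib cong: if_cong)
    also have "(\<Sum>S\<in>Pow {..<Suc k}. if k \<in> S then 0 else ?c S) = (\<Sum>S\<in>Pow {..<k}. ?c S)"
    proof (rule sum.mono_neutral_cong_right)
      show "\<forall>i\<in>Pow {..<Suc k} - Pow {..<k}. (if k \<in> i then 0 else ?c i) = 0"
        using less_Suc_eq by auto
    qed (auto simp: less_Suc_eq)
    finally show ?thesis using all by (simp add: ryser_def)
  qed
  have inj: "inj_on a {..<Suc k}"
    using Suc.prems by (intro linorder_inj_onI) (auto, force)
  show ?case
  proof
    \<comment> \<open>Each earlier argument is a root of P by \<open>ryser_repeated\<close>, and the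
      assumption makes \<open>a k\<close> a root modulo p. These k + 1 incongruent roots exceed the
      degree, so p divides the coefficient of degree k, which the induction hypothesis
      excludes.\<close>
    assume dvd: "p dvd ryser (Suc k) a"
    have "p dvd coeff P k"
    proof (rule prime_dvd_coeffs_of_roots[OF p])
      show "\<forall>b\<in>a ` {..<Suc k}. p dvd poly P b"
      proof (rule ballI, elim imageE, simp only:)
        fix i assume i: "i \<in> {..<Suc k}"
        show "p dvd poly P (a i)"
        proof (cases "i = k")
          case True
          then show ?thesis using dvd by (simp add: poly_P)
        next
          case False
          then have "ryser (Suc k) (a(k := a i)) = 0"
            using i by (intro ryser_repeated[OF c2, of i _ k]) auto
          then show ?thesis by (simp add: poly_P)
        qed
      qed
      show "\<forall>b\<in>a ` {..<Suc k}. \<forall>c\<in>a ` {..<Suc k}. b \<noteq> c \<longrightarrow> \<not> p dvd b - c"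
      proof (intro ballI impI, elim imageE)
        fix b c i j assume *: "b \<noteq> c" "b = a i" "c = a j" "i \<in> {..<Suc k}" "j \<in> {..<Suc k}"
        then have "i < j \<or> j < i" by (metis linorder_neqE_nat)
        moreover have "p dvd a i - a j \<longleftrightarrow> p dvd a j - a i"
          by (metis dvd_minus_iff minus_diff_eq)
        ultimately show "\<not> p dvd b - c"
          using Suc.prems[of i j] Suc.prems[of j i] * by auto
      qed
      show "degree P < card (a ` {..<Suc k})"
        using deg by (simp add: card_image[OF inj])
    qed auto
    then show False
      using Suc.IH Suc.prems coeff by simp
  qed
qed

section \<open>Irreducible polynomials over the field with two elements\<close>

lemma char2_bit_poly: "(1::bit poly) + 1 = 0"
  by (simp add: one_pCons)

lemma two_bit_poly: "(2::bit poly) = 0"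
  using char2_bit_poly by simp

text \<open>The bits of n are the coefficients. Addition of polynomials is then \<open>xor\<close>,
  and for t >= 1 the numbers below 2^t are the polynomials of degree less than t, the standard
  residues modulo a polynomial of degree t.\<close>

definition pl :: "nat \<Rightarrow> bit poly" where
  "pl n = Abs_poly (\<lambda>i. of_bool (bit n i))"

lemma not_bit_large: "a < 2 ^ t \<Longrightarrow> t \<le> i \<Longrightarrow> \<not> bit (a::nat) i"
  by (metis bit_take_bit_iff linorder_not_less take_bit_nat_eq_self)

lemma coeff_pl: "coeff (pl n) i = of_bool (bit n i)"
proof -
  have "\<forall>i\<ge>n. of_bool (bit n i) = (0::bit)"
    using not_bit_large[of n n] by simp
  then have "\<forall>\<^sub>\<infinity>i. of_bool (bit n i) = (0::bit)"
    by (metis (mono_tags, lifting) MOST_nat_le)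
  then show ?thesis
    unfolding pl_def by (simp add: Abs_poly_inverse)
qed

lemma pl_xor: "pl (xor a b) = pl a + pl b"
  by (rule poly_eqI) (simp add: coeff_pl bit_xor_iff)

lemma pl_0 [simp]: "pl 0 = 0"
  by (rule poly_eqI) (simp add: coeff_pl)

lemma pl_1 [simp]: "pl 1 = 1" "pl (Suc 0) = 1"
  by (auto simp: coeff_pl poly_eq_iff one_pCons coeff_pCons bit_1_iff bit_0 split: nat.splits)

lemma inj_pl: "inj pl"
proof (rule injI)
  fix a b assume "pl a = pl b"
  then have "bit a i = bit b i" for i
    by (metis coeff_pl of_bool_eq_iff)
  then show "a = b" by (simp add: bit_eq_iff)
qed

lemma pl_eq_iff [simp]: "pl a = pl b \<longleftrightarrow> a = b"
  using inj_pl by (auto dest: injD)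

lemma pl_eq_0_iff [simp]: "pl a = 0 \<longleftrightarrow> a = 0"
  using pl_eq_iff[of a 0] by simp

lemma pl_surj:
  assumes "\<forall>i\<ge>t. coeff p i = 0"
  shows "\<exists>a<2 ^ t. pl a = p"
proof -
  define a :: nat where "a = horner_sum of_bool 2 (map (\<lambda>i. coeff p i = 1) [0..<t])"
  have b: "bit a i \<longleftrightarrow> i < t \<and> coeff p i = 1" for i
    unfolding a_def by (auto simp: bit_horner_sum_bit_iff)
  have "take_bit t a = a"
    by (rule bit_eqI) (auto simp: bit_take_bit_iff b)
  then have "a < 2 ^ t"
    by (metis take_bit_nat_less_exp)
  moreover have "pl a = p"
    using assms by (intro poly_eqI) (auto simp: coeff_pl b not_less)
  ultimately show ?thesis by blast
qed

lemma coeff_pl_large: "a < 2 ^ t \<Longrightarrow> t \<le> i \<Longrightarrow> coeff (pl a) i = 0"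
  using not_bit_large by (simp add: coeff_pl)

lemma pl_image: "pl ` {..<2 ^ t} = {p. \<forall>i\<ge>t. coeff p i = 0}"
proof
  show "pl ` {..<2 ^ t} \<subseteq> {p. \<forall>i\<ge>t. coeff p i = 0}"
    using coeff_pl_large by auto
  show "{p. \<forall>i\<ge>t. coeff p i = 0} \<subseteq> pl ` {..<2 ^ t}"
    using pl_surj by fastforce
qed

lemma card_low_degree: "card {p :: bit poly. \<forall>i\<ge>t. coeff p i = 0} = 2 ^ t"
  by (metis card_image card_lessThan inj_on_subset inj_pl pl_image subset_UNIV)

lemma low_degree_iff:
  assumes "degree (F :: bit poly) = t" "t \<ge> 1"
  shows "(\<forall>i\<ge>t. coeff p i = 0) \<longleftrightarrow> degree p < t"
  using assms by (metis bot_nat_0.extremum_strict coeff_eq_0 degree_0 leading_coeff_0_iff linorder_not_less order_less_le_trans zero_less_one)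

lemma finite_low_degree: "finite {p :: bit poly. \<forall>i\<ge>t. coeff p i = 0}"
  by (metis finite_imageI finite_lessThan pl_image)

section \<open>The Frobenius map and the polynomial x^(2^t) - x\<close>

definition frob :: "nat \<Rightarrow> bit poly" where
  "frob t = monom 1 (2 ^ t) - monom 1 1"

lemma square_add_bit_poly: "((a::bit poly) + b) ^ 2 = a ^ 2 + b ^ 2"
proof -
  have "(a + b) ^ 2 = a ^ 2 + b ^ 2 + 2 * (a * b)"
    by (simp add: power2_eq_square algebra_simps)
  then show ?thesis by (simp add: two_bit_poly)
qed

lemma frobenius_add: "((a::bit poly) + b) ^ (2 ^ t) = a ^ (2 ^ t) + b ^ (2 ^ t)"
proof (induction t)
  case (Suc t)
  have "(a + b) ^ (2 ^ Suc t) = ((a + b) ^ (2 ^ t)) ^ 2"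
    by (simp add: power_mult[symmetric] mult.commute)
  also have "\<dots> = (a ^ (2 ^ t)) ^ 2 + (b ^ (2 ^ t)) ^ 2"
    by (simp only: Suc square_add_bit_poly)
  also have "\<dots> = a ^ (2 ^ Suc t) + b ^ (2 ^ Suc t)"
    by (simp add: power_mult[symmetric] mult.commute)
  finally show ?case .
qed simp

text \<open>The t-fold Frobenius map is additive and multiplicative and fixes the constants. If it
  fixes the variable modulo p, it fixes every polynomial in it; the induction runs over the
  coefficients.\<close>

lemma dvd_frob_imp_dvd_power:
  assumes "p dvd frob t"
  shows "p dvd (a::bit poly) ^ (2 ^ t) - a"
proof (induction a)
  case (pCons c a)
  have c: "[:c:] ^ (2 ^ t) = [:c:]"
    by (cases c) (simp_all add: one_pCons[symmetric])
  have "(pCons c a) ^ (2 ^ t) = ([:c:] + monom 1 1 * a) ^ (2 ^ t)"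
    by (simp add: monom_altdef)
  also have "\<dots> = [:c:] + monom 1 (2 ^ t) * a ^ (2 ^ t)"
    by (simp add: frobenius_add c power_mult_distrib monom_power)
  finally have "(pCons c a) ^ (2 ^ t) - pCons c a = ([:c:] + monom 1 (2 ^ t) * a ^ (2 ^ t)) - ([:c:] + monom 1 1 * a)"
    by (simp add: monom_altdef)
  also have "\<dots> = monom 1 (2 ^ t) * (a ^ (2 ^ t) - a) + frob t * a"
    by (simp add: frob_def algebra_simps)
  finally show ?case using pCons assms by simp
qed (simp add: power_0_left)

text \<open>All 2^(degree p) residues modulo p are roots of Y^(2^t) - Y, a polynomial over
  \<open>bit poly\<close> with leading coefficient 1. More than 2^t incongruent roots would make p
  divide 1.\<close>

lemma degree_le_of_dvd_frob:
  assumes "prime_elem p" "p dvd frob t" "t \<ge> 1"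
  shows "degree p \<le> t"
proof (rule ccontr)
  assume "\<not> degree p \<le> t"
  then have d: "t < degree p" by simp
  let ?D = "{a :: bit poly. \<forall>i\<ge>degree p. coeff a i = 0}"
  have lt: "(2::nat) ^ t < 2 ^ degree p" using d by simp
  have t1: "1 < (2::nat) ^ t" using assms(3) by (metis one_less_numeral_iff one_less_power semiring_norm(76) zero_less_one order_less_le_trans)
  let ?P = "monom (1::bit poly) (2 ^ t) - monom 1 1"
  have "p dvd coeff ?P (2 ^ t)"
  proof (rule prime_dvd_coeffs_of_roots[OF assms(1)])
    show "finite ?D" by (rule finite_low_degree)
    show "\<forall>b\<in>?D. p dvd poly ?P b"
      using dvd_frob_imp_dvd_power[OF assms(2)] by (simp add: poly_monom)
    show "\<forall>b\<in>?D. \<forall>c\<in>?D. b \<noteq> c \<longrightarrow> \<not> p dvd b - c"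
    proof (intro ballI impI notI)
      fix b c assume *: "b \<in> ?D" "c \<in> ?D" "b \<noteq> c" "p dvd b - c"
      then have "degree p \<le> degree (b - c)" by (intro dvd_imp_degree_le) auto
      moreover have "coeff (b - c) (degree (b - c)) \<noteq> 0"
        using *(3) by (metis leading_coeff_0_iff right_minus_eq)
      ultimately show False using *(1,2) by (metis (mono_tags) coeff_diff diff_self mem_Collect_eq)
    qed
    have "degree ?P \<le> 2 ^ t"
      by (rule degree_diff_le) (use t1 in \<open>auto simp: degree_monom_eq\<close>)
    then show "degree ?P < card ?D"
      unfolding card_low_degree using lt by (rule le_less_trans)
  qed
  then show False using t1 assms(1) by (simp add: coeff_monom prime_elem_def)
qed

text \<open>Fermat's little theorem for the variable x: unless p divides x, multiplication by x
  permutes the nonzero residues modulo p, and comparing the products over all of them gives x^(2^d -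
  1) = 1 modulo p.\<close>

lemma dvd_frob_degree:
  assumes "prime_elem (p :: bit poly)" "degree p = d" "d \<ge> 1"
  shows "p dvd frob d"
proof (cases "p dvd monom 1 1")
  case True
  have "frob d = monom 1 1 * (monom 1 (2 ^ d - 1) - 1)"
    by (simp add: frob_def right_diff_distrib mult_monom)
  then show ?thesis using True by (metis dvd_mult2)
next
  case False
  let ?x = "monom (1::bit) 1"
  define A where "A = {a :: bit poly. \<forall>i\<ge>d. coeff a i = 0} - {0}"
  have A_iff: "a \<in> A \<longleftrightarrow> degree a < d \<and> a \<noteq> 0" for a
    using low_degree_iff[OF assms(2,3), of a] by (auto simp: A_def)
  have finA: "finite A" by (simp add: A_def finite_low_degree)
  have cardA: "card A = 2 ^ d - 1"
    unfolding A_def by (subst card_Diff_singleton) (auto simp: card_low_degree)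
  have p0: "p \<noteq> 0" using assms(1) by auto
  have nd: "\<not> p dvd a" if "a \<in> A" for a
    using that assms(2) by (metis A_iff dvd_imp_degree_le linorder_not_less)
  let ?f = "\<lambda>a. (?x * a) mod p"
  have inj: "inj_on ?f A"
  proof (rule inj_onI)
    fix a b assume *: "a \<in> A" "b \<in> A" "?f a = ?f b"
    then have "p dvd ?x * (a - b)"
      by (simp add: mod_eq_dvd_iff right_diff_distrib)
    then have "p dvd a - b"
      using assms(1) False by (simp add: prime_elem_dvd_mult_iff)
    moreover have "degree (a - b) < d"
      using * by (intro degree_diff_less) (auto simp: A_iff)
    ultimately show "a = b"
      using assms(2) by (metis dvd_imp_degree_le linorder_not_less right_minus_eq)
  qed
  have sub: "?f ` A \<subseteq> A"
  proof
    fix b assume "b \<in> ?f ` A"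
    then obtain a where a: "a \<in> A" "b = ?f a" by auto
    have "\<not> p dvd ?x * a"
      using a nd assms(1) False by (simp add: prime_elem_dvd_mult_iff)
    then have "b \<noteq> 0" using a by (simp add: dvd_eq_mod_eq_0)
    moreover have "degree b < d"
      using a degree_mod_less[OF p0, of "?x * a"] assms(2,3) calculation by auto
    ultimately show "b \<in> A" by (simp add: A_iff)
  qed
  have im: "?f ` A = A"
    using finA inj sub by (simp add: endo_inj_surj)
  have "(\<Prod>a\<in>A. ?x * a) mod p = (\<Prod>a\<in>A. ?f a) mod p"
    by (metis (no_types) mod_prod_eq)
  also have "(\<Prod>a\<in>A. ?f a) = \<Prod>A"
    using prod.reindex[OF inj, of "\<lambda>a. a"] im by simp
  also have "(\<Prod>a\<in>A. ?x * a) = ?x ^ card A * \<Prod>A"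
    by (simp add: prod.distrib)
  finally have "p dvd (?x ^ card A - 1) * \<Prod>A"
    by (simp add: mod_eq_dvd_iff left_diff_distrib)
  moreover have "\<not> p dvd \<Prod>A"
    using finA nd
  proof (induction A rule: finite_induct)
    case empty
    then show ?case using assms(1) by (simp add: prime_elem_def)
  next
    case (insert a B)
    then show ?case using assms(1) by (simp add: prime_elem_dvd_mult_iff)
  qed
  ultimately have "p dvd ?x ^ card A - 1"
    using assms(1) by (simp add: prime_elem_dvd_mult_iff)
  moreover have "frob d = ?x * (?x ^ card A - 1)"
  proof -
    have "(2::nat) ^ d = Suc (2 ^ d - 1)" by simp
    then have "monom (1::bit) (2 ^ d) = ?x * ?x ^ (2 ^ d - 1)"
      by (metis monom_power mult_monom mult_1 plus_1_eq_Suc power_one)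
    then show ?thesis by (simp add: frob_def cardA right_diff_distrib)
  qed
  ultimately show ?thesis by simp
qed

(* x^(2^t) - x is squarefree, and each of its irreducible factors has some degree d <= t and divides
   x^(2^d) - x. If d < t for all of them, it divides the product of those, whose degree is too small. *)
lemma exists_irreducible_degree:
  assumes "t \<ge> 1"
  shows "\<exists>p :: bit poly. prime_elem p \<and> degree p = t"
proof (rule ccontr)
  assume no: "\<not> ?thesis"
  define Q where "Q = (\<Prod>d\<in>{1..<t}. frob d)"
  have deg: "degree (frob d) = 2 ^ d" if "d \<ge> 1" for d
  proof -
    have "1 < (2::nat) ^ d"
      using that by (metis one_less_numeral_iff one_less_power semiring_norm(76) zero_less_one order_less_le_trans)
    then show ?thesis
      unfolding frob_def diff_conv_add_uminus by (subst degree_add_eq_left) (auto simp: degree_monom_eq)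
  qed
  have nz: "frob d \<noteq> 0" if "d \<ge> 1" for d
    using deg[OF that] by auto
  have Q0: "Q \<noteq> 0" using nz by (simp add: Q_def)
  \<comment> \<open>The degrees 2 + 4 + ... + 2^(t-1) add up to 2^t - 2.\<close>
  have "degree Q = (\<Sum>d\<in>{1..<t}. 2 ^ d)"
    unfolding Q_def using nz deg by (subst degree_prod_eq_sum_degree) auto
  also have "\<dots> < 2 ^ t"
  proof -
    have "(\<Sum>d\<in>{1..<s}. 2 ^ d) < (2::nat) ^ s" for s
    proof (induction s)
      case (Suc s)
      then show ?case by (cases "s = 0") (auto simp: sum.atLeastLessThan_Suc)
    qed simp
    then show ?thesis .
  qed
  finally have degQ: "degree Q < 2 ^ t" .
  have p_dvd_Q: "p dvd Q" if "prime_elem p" "p dvd frob t" for p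
  proof -
    have "degree p \<le> t" using that assms degree_le_of_dvd_frob by blast
    moreover have "degree p \<noteq> t" using no that by blast
    moreover have "degree p \<noteq> 0"
      using that(1) by (metis is_unit_iff_degree prime_elem_def)
    ultimately have "degree p \<in> {1..<t}" by auto
    moreover have "p dvd frob (degree p)"
      using that dvd_frob_degree calculation by auto
    ultimately show ?thesis
      unfolding Q_def by (meson dvd_prodI dvd_trans finite_atLeastLessThan)
  qed
  \<comment> \<open>A prime factor of the cofactor r also divides Q, hence g, so its square divides
    \<open>frob t\<close>; the derivative -1 forbids this. Thus r is a unit, and
    \<open>frob t\<close> would have the degree of a divisor of Q.\<close>
  define g where "g = gcd (frob t) Q"
  obtain r where r: "frob t = g * r"
    by (metis dvdE g_def gcd_dvd1)
  have r0: "r \<noteq> 0" using r nz assms by auto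
  have "is_unit r"
  proof (rule ccontr)
    assume "\<not> is_unit r"
    then obtain p where p: "prime_elem p" "p dvd r"
      using r0 prime_divisor_exists[of r] prime_def by blast
    then have "p dvd frob t" by (simp add: r)
    then have "p dvd g" using p_dvd_Q p g_def by simp
    then obtain u v where "g = p * u" "r = p * v" using p by (metis dvdE)
    then have "frob t = p ^ 2 * (u * v)" by (simp add: r power2_eq_square algebra_simps)
    then have "p dvd pderiv (frob t)"
      by (simp add: pderiv_mult power2_eq_square)
    moreover have "pderiv (frob t) = -1"
    proof -
      have "of_nat (2 ^ t) = (0::bit)" using assms by simp
      then show ?thesis
        by (simp add: frob_def pderiv_diff pderiv_monom monom_0 one_pCons)
    qed
    ultimately show False using p by (simp add: prime_elem_def)
  qed
  then have "degree (frob t) = degree g"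
    using r r0 nz assms by (metis degree_mult_eq is_unit_iff_degree add.right_neutral mult_eq_0_iff)
  also have "\<dots> \<le> degree Q"
    using Q0 by (intro dvd_imp_degree_le) (auto simp: g_def)
  finally show False using deg[OF assms] degQ by simp
qed

section \<open>Residues, hashing and walks\<close>

text \<open>The word by which the machine stores the residue class of p. Being defined for unreduced
  p, it lets invariants name machine values by polynomials for which ring identities hold
  exactly.\<close>

definition rep :: "bit poly \<Rightarrow> bit poly \<Rightarrow> nat" where
  "rep F p = inv pl (p mod F)"

lemma bit_pow_add:
  assumes "(f::nat) < 2 ^ t"
  shows "bit (2 ^ t + f) i \<longleftrightarrow> i = t \<or> bit f i"
proof -
  have "2 ^ t + f = or (2 ^ t) f"
    using assms not_bit_large[OF assms]
    by (subst disjunctive_add) (auto simp: bit_exp_iff)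
  then show ?thesis by (auto simp: bit_or_iff bit_exp_iff)
qed

lemma pl_pow_add:
  assumes "f < 2 ^ t"
  shows "pl (2 ^ t + f) = monom 1 t + pl f"
  using not_bit_large[OF assms]
  by (intro poly_eqI) (auto simp: coeff_pl bit_pow_add[OF assms])

lemma degree_pl_pow_add:
  assumes "f < 2 ^ t"
  shows "degree (pl (2 ^ t + f)) = t"
proof (rule antisym)
  show "degree (pl (2 ^ t + f)) \<le> t"
    using not_bit_large[OF assms] by (intro degree_le) (auto simp: coeff_pl bit_pow_add[OF assms])
  show "t \<le> degree (pl (2 ^ t + f))"
    by (intro le_degree) (simp add: coeff_pl bit_pow_add[OF assms])
qed

text \<open>Over the field with two elements the leading coefficient is 1, so a modulus of degree t
  is given by the t-bit number f of its lower terms; only f is kept in a register.\<close>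

lemma pl_of_degree:
  assumes "degree p = t" "t \<ge> 1"
  shows "\<exists>f<2 ^ t. p = pl (2 ^ t + f)"
proof -
  have "\<forall>i\<ge>t. coeff (p - monom 1 t) i = 0"
  proof (intro allI impI)
    fix i assume "t \<le> i"
    moreover have "coeff p t = 1" using assms by (metis bit_not_zero_iff degree_0 leading_coeff_0_iff not_one_le_zero)
    ultimately show "coeff (p - monom 1 t) i = 0"
      using assms coeff_eq_0[of p i] by (cases "i = t") auto
  qed
  then obtain f where f: "f < 2 ^ t" "pl f = p - monom 1 t"
    using pl_surj by blast
  then show ?thesis by (intro exI[of _ f]) (simp add: pl_pow_add)
qed

text \<open>Irreducibility is not assumed because the machine already computes modulo the candidates
  among which it looks for an irreducible F.\<close>

locale modulus =
  fixes F :: "bit poly" and t :: nat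
  assumes deg: "degree F = t" and t1: "t \<ge> 1"
begin

lemma F0: "F \<noteq> 0" using deg t1 by auto

lemma q1: "(1::nat) < 2 ^ t"
  using t1 by (metis one_less_numeral_iff one_less_power semiring_norm(76) zero_less_one order_less_le_trans)

lemma pl_rep: "pl (rep F p) = p mod F" and rep_less: "rep F p < 2 ^ t"
proof -
  have "degree (p mod F) < t"
    using degree_mod_less[OF F0, of p] deg t1 by auto
  then have "\<forall>i\<ge>t. coeff (p mod F) i = 0"
    using low_degree_iff[OF deg t1] by blast
  then obtain a where a: "a < 2 ^ t" "pl a = p mod F"
    using pl_surj by blast
  then have "rep F p = a" unfolding rep_def by (metis inv_f_f inj_pl)
  then show "pl (rep F p) = p mod F" "rep F p < 2 ^ t" using a by auto
qed

lemma pl_mod: "a < 2 ^ t \<Longrightarrow> pl a mod F = pl a"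
  using coeff_pl_large[of a t] low_degree_iff[OF deg t1, of "pl a"] deg
  by (simp add: mod_poly_less)

lemma rep_cong: "p mod F = r mod F \<Longrightarrow> rep F p = rep F r"
  by (simp add: rep_def)

lemma rep_pl: "a < 2 ^ t \<Longrightarrow> rep F (pl a) = a"
  by (metis pl_mod pl_rep pl_eq_iff)

lemma rep_xor: "xor (rep F p) (rep F r) = rep F (p + r)"
proof -
  have "pl (xor (rep F p) (rep F r)) = pl (rep F (p + r))"
    by (simp add: pl_xor pl_rep poly_mod_add_left)
  then show ?thesis by simp
qed

lemma rep_mult: "rep F (pl (rep F p) * pl (rep F r)) = rep F (p * r)"
  by (intro rep_cong) (simp add: pl_rep mod_mult_eq)

lemma rep_eq_0_iff: "rep F p = 0 \<longleftrightarrow> F dvd p"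
  by (metis dvd_eq_mod_eq_0 pl_eq_0_iff pl_rep)

lemma rep_0 [simp]: "rep F 0 = 0" by (simp add: rep_eq_0_iff)

lemma rep_1 [simp]: "rep F 1 = 1"
  using rep_pl[OF q1] by simp

lemma not_dvd_pl: "a < 2 ^ t \<Longrightarrow> a \<noteq> 0 \<Longrightarrow> \<not> F dvd pl a"
  by (metis rep_eq_0_iff rep_pl)

text \<open>F is prime exactly if the residue ring has no zero divisors, and the nonzero residues
  are coded by 1 to 2^t - 1. This finite criterion is the test that \<open>check_modulus\<close>
  performs.\<close>

lemma prime_iff:
  "prime_elem F \<longleftrightarrow> (\<forall>a\<in>{1..<2 ^ t}. \<forall>b\<in>{1..<2 ^ t}. rep F (pl a * pl b) \<noteq> 0)"
proof
  assume "prime_elem F"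
  then show "\<forall>a\<in>{1..<2 ^ t}. \<forall>b\<in>{1..<2 ^ t}. rep F (pl a * pl b) \<noteq> 0"
    using not_dvd_pl by (auto simp: rep_eq_0_iff prime_elem_dvd_mult_iff)
next
  assume *: "\<forall>a\<in>{1..<2 ^ t}. \<forall>b\<in>{1..<2 ^ t}. rep F (pl a * pl b) \<noteq> 0"
  show "prime_elem F"
  proof (rule prime_elemI)
    show "\<not> is_unit F" using deg t1 F0 by (simp add: is_unit_iff_degree)
    fix p r assume "F dvd p * r"
    then have "rep F (pl (rep F p) * pl (rep F r)) = 0"
      by (simp add: rep_mult rep_eq_0_iff)
    then have "rep F p = 0 \<or> rep F r = 0"
      using * rep_less[of p] rep_less[of r] by (metis atLeastLessThan_iff less_one linorder_not_less)
    then show "F dvd p \<or> F dvd r" by (simp add: rep_eq_0_iff)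
  qed (rule F0)
qed

end

lemma exists_prime_modulus:
  assumes "t \<ge> 1"
  shows "\<exists>f<2 ^ t. prime_elem (pl (2 ^ t + f))"
proof -
  obtain p :: "bit poly" where p: "prime_elem p" "degree p = t"
    using exists_irreducible_degree[OF assms] by blast
  from pl_of_degree[OF p(2) assms] obtain f where "f < 2 ^ t" "p = pl (2 ^ t + f)"
    by blast
  then show ?thesis using p(1) by blast
qed

section \<open>Hashing by evaluation of digit polynomials\<close>

function digit_poly :: "nat \<Rightarrow> nat \<Rightarrow> bit poly poly" where
  "digit_poly q x = (if x = 0 \<or> q \<le> 1 then 0 else pCons (pl (x mod q)) (digit_poly q (x div q)))"
  by pat_completeness auto
termination by (relation "measure snd") auto

declare digit_poly.simps [simp del]

lemma digit_poly_0 [simp]: "digit_poly q 0 = 0"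
  by (subst digit_poly.simps) simp

lemma digit_poly_pos:
  "x \<noteq> 0 \<Longrightarrow> q > 1 \<Longrightarrow> digit_poly q x = pCons (pl (x mod q)) (digit_poly q (x div q))"
  by (subst digit_poly.simps) simp

lemma coeff_digit_poly:
  assumes "q > 1"
  shows "coeff (digit_poly q x) i = pl (x div q ^ i mod q)"
proof (induction x arbitrary: i rule: less_induct)
  case (less x)
  show ?case
  proof (cases "x = 0")
    case True
    then show ?thesis by simp
  next
    case False
    then have "x div q < x" using assms by simp
    then show ?thesis
      using less[of "x div q"] False assms
      by (simp add: digit_poly_pos coeff_pCons div_mult2_eq split: nat.split)
  qed
qed

lemma degree_digit_poly:
  assumes "q > 1" "x < q ^ Suc d"
  shows "degree (digit_poly q x) \<le> d"
proof (rule degree_le, intro allI impI)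
  fix i assume "d < i"
  then have "q ^ Suc d \<le> q ^ i" using assms by (intro power_increasing) auto
  then have "x < q ^ i" using assms(2) by linarith
  then show "coeff (digit_poly q x) i = 0" by (simp add: coeff_digit_poly[OF assms(1)])
qed

lemma digits_eqI:
  assumes "q > (1::nat)" "\<And>i. x div q ^ i mod q = y div q ^ i mod q"
  shows "x = y"
  using assms(2)
proof (induction "x + y" arbitrary: x y rule: less_induct)
  case less
  show ?case
  proof (cases "x + y = 0")
    case False
    have "x div q \<le> x" "y div q \<le> y" by simp_all
    moreover have "x \<noteq> 0 \<Longrightarrow> x div q < x" "y \<noteq> 0 \<Longrightarrow> y div q < y" using assms(1) by simp_all
    ultimately have "x div q + y div q < x + y" using False by linarith
    moreover have "x div q div q ^ i mod q = y div q div q ^ i mod q" for i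
      using less.prems[of "Suc i"] by (simp add: div_mult2_eq)
    ultimately have "x div q = y div q" by (rule less.hyps)
    moreover have "x mod q = y mod q" using less.prems[of 0] by simp
    ultimately show ?thesis by (metis div_mult_mod_eq)
  qed simp
qed

text \<open>The value at b of the Reed-Solomon codeword of x, kept in \<open>bit poly\<close> and
  reduced modulo F only where the machine stores it.\<close>

definition hash :: "nat \<Rightarrow> nat \<Rightarrow> nat \<Rightarrow> bit poly" where
  "hash q b x = poly (digit_poly q x) (pl b)"

context modulus
begin

text \<open>Below q^8 there are eight digits, so the difference of the digit polynomials has degree
  at most 7. With eight roots incongruent modulo F all its coefficients would be divisible by F, and
  as digits are already reduced, x and y would agree.\<close>

lemma card_bad_seeds:
  assumes "prime_elem F" "x < (2 ^ t) ^ 8" "y < (2 ^ t) ^ 8" "x \<noteq> y"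
  shows "card {b. b < 2 ^ t \<and> F dvd hash (2 ^ t) b x - hash (2 ^ t) b y} \<le> 7"
proof (rule ccontr)
  define q where "q = (2::nat) ^ t"
  have q: "q > 1" using q1 by (simp only: q_def)
  assume "\<not> ?thesis"
  then have c: "7 < card {b. b < q \<and> F dvd hash q b x - hash q b y}" by (simp add: q_def)
  let ?B = "{b. b < q \<and> F dvd hash q b x - hash q b y}"
  let ?P = "digit_poly q x - digit_poly q y"
  have "F dvd coeff ?P i" for i
  proof (rule prime_dvd_coeffs_of_roots[OF assms(1)])
    show "\<forall>b\<in>pl ` ?B. F dvd poly ?P b"
      by (auto simp: hash_def)
    show "\<forall>b\<in>pl ` ?B. \<forall>c\<in>pl ` ?B. b \<noteq> c \<longrightarrow> \<not> F dvd b - c"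
    proof (intro ballI impI, elim imageE)
      fix b c b' c' assume *: "b \<noteq> c" "b = pl b'" "c = pl c'" "b' \<in> ?B" "c' \<in> ?B"
      show "\<not> F dvd b - c"
      proof
        assume "F dvd b - c"
        then have "b mod F = c mod F" by (simp add: mod_eq_dvd_iff)
        moreover have "b' < 2 ^ t" "c' < 2 ^ t" using *(4,5) by (simp_all add: q_def)
        ultimately show False using *(1-3) by (metis pl_mod)
      qed
    qed
    have "degree ?P \<le> 7"
      using assms(2,3) degree_digit_poly[OF q, of _ 7]
      by (intro degree_diff_le) (auto simp: q_def)
    then show "degree ?P < card (pl ` ?B)"
      using c card_image[OF inj_on_subset[OF inj_pl subset_UNIV], of ?B] by linarith
  qed auto
  then have "pl (x div q ^ i mod q) mod F = pl (y div q ^ i mod q) mod F" for i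
    by (simp add: coeff_digit_poly[OF q] mod_eq_dvd_iff)
  then have "x div q ^ i mod q = y div q ^ i mod q" for i
    using q by (simp add: pl_mod q_def)
  then show False using digits_eqI[OF q] assms(4) by blast
qed

text \<open>Union bound: each of the k (k - 1) / 2 pairs of labels spoils at most 7 seeds, in total
  fewer than the 4 k^2 - 1 seeds on offer. The condition 4 k^2 <= 2^t makes these seeds distinct
  residues.\<close>

lemma good_seed_exists:
  assumes "prime_elem F" "L \<subseteq> {..<(2 ^ t) ^ 8}" "finite L" "card L = k" "k \<ge> 1" "4 * k * k \<le> 2 ^ t"
  shows "\<exists>b\<in>{1..<4 * k * k}. \<forall>x\<in>L. \<forall>y\<in>L. x \<noteq> y \<longrightarrow> \<not> F dvd hash (2 ^ t) b x - hash (2 ^ t) b y"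
proof (rule ccontr)
  assume no: "\<not> ?thesis"
  let ?q = "(2::nat) ^ t"
  let ?bad = "\<lambda>x y. {b. b < ?q \<and> F dvd hash ?q b x - hash ?q b y}"
  let ?S = "{P. P \<subseteq> L \<and> card P = 2}"
  let ?B = "\<lambda>P. {b. b < ?q \<and> (\<exists>x\<in>P. \<exists>y\<in>P. x \<noteq> y \<and> F dvd hash ?q b x - hash ?q b y)}"
  have finS: "finite ?S" using assms(3) by simp
  have "{1..<4 * k * k} \<subseteq> (\<Union>P\<in>?S. ?B P)"
  proof
    fix b assume b: "b \<in> {1..<4 * k * k}"
    then obtain x y where "x \<in> L" "y \<in> L" "x \<noteq> y" "F dvd hash ?q b x - hash ?q b y"
      using no by blast
    then show "b \<in> (\<Union>P\<in>?S. ?B P)"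
      using b assms(6) by (intro UN_I[of "{x, y}"]) auto
  qed
  then have "4 * k * k - 1 \<le> card (\<Union>P\<in>?S. ?B P)"
    using card_mono[of "\<Union>P\<in>?S. ?B P" "{1..<4 * k * k}"] finS by simp
  also have "\<dots> \<le> (\<Sum>P\<in>?S. card (?B P))"
    by (rule card_UN_le[OF finS])
  also have "\<dots> \<le> (\<Sum>P\<in>?S. 7)"
  proof (rule sum_mono)
    fix P assume P: "P \<in> ?S"
    then obtain x y where xy: "P = {x, y}" "x \<noteq> y" by (auto simp: card_2_iff)
    have "?B P = ?bad x y"
    proof -
      have "F dvd hash ?q b y - hash ?q b x \<longleftrightarrow> F dvd hash ?q b x - hash ?q b y" for b
        by (metis dvd_minus_iff minus_diff_eq)
      then show ?thesis using xy by blast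
    qed
    then show "card (?B P) \<le> 7"
      using card_bad_seeds[OF assms(1), of x y] assms(2) xy P by auto
  qed
  also have "\<dots> = 7 * (k choose 2)"
    using n_subsets[OF assms(3), of 2] assms(4) by simp
  finally have "4 * k * k - 1 \<le> 7 * (k * (k - 1) div 2)"
    by (simp add: choose_two)
  then have "2 * (4 * k * k - 1) \<le> 7 * (k * (k - 1))" by linarith
  moreover have "7 * (k * (k - 1)) < 2 * (4 * k * k - 1)"
  proof -
    obtain j where "k = Suc j" using assms(5) by (metis Suc_le_D One_nat_def)
    then show ?thesis by (simp add: algebra_simps)
  qed
  ultimately show False by simp
qed

text \<open>A label below q is a single digit and its digit polynomial is constant. In the
  bit-by-bit regime all labels are of this kind, so one seed is enough.\<close>

lemma hash_small:
  assumes "x < 2 ^ t"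
  shows "hash (2 ^ t) b x = pl x"
proof -
  note q = q1
  show ?thesis
  proof (cases "x = 0")
    case True
    then show ?thesis by (simp add: hash_def)
  next
    case False
    then show ?thesis
      using assms q by (simp add: hash_def digit_poly_pos)
  qed
qed

end

section \<open>Weighted sums over walks and the recursion that computes them\<close>

definition walks :: "nat list list \<Rightarrow> nat \<Rightarrow> nat list set" where
  "walks adj i = {ws. length ws = i \<and> set ws \<subseteq> {0..<length adj} \<and>
     (\<forall>j. Suc j < i \<longrightarrow> is_edge adj (ws ! j) (ws ! Suc j))}"

lemma is_kpath_iff: "is_kpath adj k ws \<longleftrightarrow> ws \<in> walks adj k \<and> distinct ws"
  by (auto simp: is_kpath_def walks_def)

lemma finite_walks: "finite (walks adj i)"
  by (rule finite_subset[OF _ finite_lists_length_eq[of "{0..<length adj}" i]]) (auto simp: walks_def)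

text \<open>The sum runs over walks with i vertices whose last vertex has an edge to v; the weight
  of v itself is not included. The base value 1 belongs to the empty walk, and the step multiplies
  at the tail u before the value travels along the edge, as \<open>push\<close> and
  \<open>scatter\<close> do.\<close>

fun walk_sum :: "nat list list \<Rightarrow> (nat \<Rightarrow> 'a::comm_ring_1) \<Rightarrow> nat \<Rightarrow> nat \<Rightarrow> 'a" where
  "walk_sum adj X 0 v = 1"
| "walk_sum adj X (Suc i) v = (\<Sum>u | u < length adj \<and> is_edge adj u v. X u * walk_sum adj X i u)"

definition walks_to :: "nat list list \<Rightarrow> nat \<Rightarrow> nat \<Rightarrow> nat list set" where
  "walks_to adj i v = {ws \<in> walks adj i. ws = [] \<or> is_edge adj (last ws) v}"

lemma snoc_in_walks:
  "ws @ [v] \<in> walks adj (Suc i) \<longleftrightarrow> ws \<in> walks_to adj i v \<and> v < length adj"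
proof
  assume a: "ws @ [v] \<in> walks adj (Suc i)"
  then have l: "length ws = i" "set ws \<subseteq> {0..<length adj}" "v < length adj"
    by (auto simp: walks_def)
  have e: "is_edge adj ((ws @ [v]) ! j) ((ws @ [v]) ! Suc j)" if "j < i" for j
    using a that by (auto simp: walks_def)
  have "is_edge adj (ws ! j) (ws ! Suc j)" if "Suc j < i" for j
    using e[of j] that l by (simp add: nth_append)
  moreover have "ws = [] \<or> is_edge adj (last ws) v"
    using e[of "i - 1"] l by (cases "ws = []") (auto simp: nth_append last_conv_nth)
  ultimately show "ws \<in> walks_to adj i v \<and> v < length adj"
    using l by (auto simp: walks_def walks_to_def)
next
  assume a: "ws \<in> walks_to adj i v \<and> v < length adj"
  have "is_edge adj ((ws @ [v]) ! j) ((ws @ [v]) ! Suc j)" if "j < i" for j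
  proof (cases "Suc j < i")
    case True
    then show ?thesis using a by (auto simp: walks_def walks_to_def nth_append)
  next
    case False
    then have "j = i - 1" "ws \<noteq> []" using that a by (auto simp: walks_def walks_to_def)
    then show ?thesis using a by (auto simp: walks_def walks_to_def nth_append last_conv_nth)
  qed
  then show "ws @ [v] \<in> walks adj (Suc i)"
    using a by (auto simp: walks_def walks_to_def)
qed

text \<open>Walks are grouped by their last vertex. In the recursion B is the set of predecessors of
  a vertex, in the final sum the set of all vertices.\<close>

lemma sum_walks_Suc:
  assumes "B \<subseteq> {..<length adj}"
  shows "(\<Sum>ws | ws \<in> walks adj (Suc i) \<and> last ws \<in> B. prod_list (map X ws))
    = (\<Sum>u\<in>B. (X u :: 'a::comm_ring_1) * (\<Sum>ws\<in>walks_to adj i u. prod_list (map X ws)))"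
proof -
  have fin: "finite B" using assms finite_subset by blast
  have finw: "finite (walks_to adj i u)" for u
    using finite_walks[of adj i] by (simp add: walks_to_def)
  have "{ws. ws \<in> walks adj (Suc i) \<and> last ws \<in> B} = (\<Union>u\<in>B. (\<lambda>ws. ws @ [u]) ` walks_to adj i u)"
    (is "?A = ?C")
  proof
    show "?C \<subseteq> ?A"
      using assms by (auto simp: snoc_in_walks)
    show "?A \<subseteq> ?C"
    proof
      fix ws assume ws: "ws \<in> ?A"
      then have "ws \<noteq> []" by (auto simp: walks_def)
      then obtain vs u where vs: "ws = vs @ [u]" by (metis rev_exhaust)
      then show "ws \<in> ?C" using ws by (auto simp: snoc_in_walks)
    qed
  qed
  then have "(\<Sum>ws\<in>?A. prod_list (map X ws))
      = (\<Sum>u\<in>B. \<Sum>ws\<in>(\<lambda>ws. ws @ [u]) ` walks_to adj i u. prod_list (map X ws))"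
    using fin finw by (simp only:) (subst sum.UNION_disjoint, auto)
  also have "\<dots> = (\<Sum>u\<in>B. X u * (\<Sum>ws\<in>walks_to adj i u. prod_list (map X ws)))"
    by (rule sum.cong[OF refl], subst sum.reindex)
      (auto simp: inj_on_def sum_distrib_left mult.commute)
  finally show ?thesis by simp
qed

lemma walk_sum_eq:
  "walk_sum adj X i v = (\<Sum>ws\<in>walks_to adj i v. prod_list (map X ws))"
proof (induction i arbitrary: v)
  case 0
  have "walks_to adj 0 v = {[]}" by (auto simp: walks_to_def walks_def)
  then show ?case by simp
next
  case (Suc i)
  have "walks_to adj (Suc i) v = {ws. ws \<in> walks adj (Suc i) \<and> last ws \<in> {u. u < length adj \<and> is_edge adj u v}}"
    by (auto simp: walks_to_def walks_def is_edge_def)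
  then show ?case
    unfolding walk_sum.simps Suc
    using sum_walks_Suc[where B = "{u. u < length adj \<and> is_edge adj u v}" and adj = adj and i = i and X = X]
    by (simp add: subset_iff)
qed

lemma sum_walks:
  assumes "k \<ge> 1"
  shows "(\<Sum>v<length adj. X v * walk_sum adj X (k - 1) v) = (\<Sum>ws\<in>walks adj k. prod_list (map X ws))"
proof -
  have "walks adj k = {ws. ws \<in> walks adj (Suc (k - 1)) \<and> last ws \<in> {..<length adj}}"
  proof -
    have "last ws < length adj" if "ws \<in> walks adj k" for ws
    proof -
      have "ws \<noteq> []" using that assms by (auto simp: walks_def)
      then show ?thesis using that last_in_set[of ws] unfolding walks_def by fastforce
    qed
    then show ?thesis using assms by auto
  qed
  then show ?thesis
    using sum_walks_Suc[where B = "{..<length adj}" and adj = adj and i = "k - 1" and X = X] by (simp add: walk_sum_eq)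
qed

definition vweight :: "nat set \<Rightarrow> 'a::comm_ring_1 \<Rightarrow> 'a" where
  "vweight S a = (\<Sum>j\<in>S. a ^ j)"

definition walk_total :: "nat list list \<Rightarrow> nat \<Rightarrow> nat set \<Rightarrow> (nat \<Rightarrow> 'a::comm_ring_1) \<Rightarrow> 'a" where
  "walk_total adj k S a = (\<Sum>v<length adj. vweight S (a v) * walk_sum adj (\<lambda>u. vweight S (a u)) (k - 1) v)"

lemma sum_walk_total:
  assumes "k \<ge> 1"
  shows "(\<Sum>S\<in>Pow {..<k}. walk_total adj k S a) = (\<Sum>ws\<in>walks adj k. ryser k (\<lambda>i. a (ws ! i)))"
proof -
  have "(\<Sum>S\<in>Pow {..<k}. walk_total adj k S a)
      = (\<Sum>S\<in>Pow {..<k}. \<Sum>ws\<in>walks adj k. prod_list (map (\<lambda>u. vweight S (a u)) ws))"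
    unfolding walk_total_def by (simp only: sum_walks[OF assms])
  also have "\<dots> = (\<Sum>ws\<in>walks adj k. \<Sum>S\<in>Pow {..<k}. prod_list (map (\<lambda>u. vweight S (a u)) ws))"
    by (rule sum.swap)
  also have "\<dots> = (\<Sum>ws\<in>walks adj k. ryser k (\<lambda>i. a (ws ! i)))"
    by (rule sum.cong) (auto simp: walks_def ryser_def vweight_def prod.list_conv_set_nth lessThan_atLeast0)
  finally show ?thesis .
qed

text \<open>Numbering the subsets by binary numbers matches the machine, which passes to the next
  subset by adding one.\<close>

lemma sum_Pow_bits:
  "(\<Sum>S\<in>Pow {..<k}. f S) = (\<Sum>c<2 ^ k. f {j. j < k \<and> bit (c::nat) j} :: 'a::comm_monoid_add)"
proof -
  have "bij_betw (\<lambda>c::nat. {j. j < k \<and> bit c j}) {..<2 ^ k} (Pow {..<k})"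
  proof (rule bij_betw_imageI)
    show "inj_on (\<lambda>c::nat. {j. j < k \<and> bit c j}) {..<2 ^ k}"
    proof (rule inj_onI)
      fix c d :: nat
      assume *: "c \<in> {..<2 ^ k}" "d \<in> {..<2 ^ k}" "{j. j < k \<and> bit c j} = {j. j < k \<and> bit d j}"
      have "bit c j = bit d j" for j
      proof (cases "j < k")
        case True
        then show ?thesis using eqset_imp_iff[OF *(3), of j] by simp
      next
        case False
        then show ?thesis using not_bit_large[of c k j] not_bit_large[of d k j] *(1,2) by simp
      qed
      then show "c = d" by (simp add: bit_eq_iff)
    qed
    show "(\<lambda>c::nat. {j. j < k \<and> bit c j}) ` {..<2 ^ k} = Pow {..<k}"
    proof
      show "Pow {..<k} \<subseteq> (\<lambda>c::nat. {j. j < k \<and> bit c j}) ` {..<2 ^ k}"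
      proof
        fix S :: "nat set" assume S: "S \<in> Pow {..<k}"
        define c :: nat where "c = take_bit k (horner_sum of_bool 2 (map (\<lambda>i. i \<in> S) [0..<k]))"
        have "c < 2 ^ k" by (simp add: c_def)
        moreover have "S = {j. j < k \<and> bit c j}"
          using S by (auto simp: c_def bit_take_bit_iff bit_horner_sum_bit_iff)
        ultimately show "S \<in> (\<lambda>c::nat. {j. j < k \<and> bit c j}) ` {..<2 ^ k}" by blast
      qed
    qed (rule image_subsetI, rule PowI, rule subsetI, simp)
  qed
  then show ?thesis by (rule sum.reindex_bij_betw[symmetric])
qed

lemma sum_walk_total_no_path:
  fixes a :: "nat \<Rightarrow> 'a::comm_ring_1"
  assumes "(1::'a) + 1 = 0" "k \<ge> 1" "\<nexists>ws. is_kpath adj k ws"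
  shows "(\<Sum>S\<in>Pow {..<k}. walk_total adj k S a) = 0"
  unfolding sum_walk_total[OF assms(2)]
proof (rule sum.neutral, rule ballI)
  fix ws assume ws: "ws \<in> walks adj k"
  then have "\<not> distinct ws" "length ws = k" using assms(3) by (auto simp: is_kpath_iff walks_def)
  then obtain i j where "i < k" "j < k" "i \<noteq> j" "ws ! i = ws ! j"
    by (auto simp: distinct_conv_nth)
  then show "ryser k (\<lambda>i. a (ws ! i)) = 0"
    by (intro ryser_repeated[OF assms(1), of i k j]) auto
qed

text \<open>This is where the promise of at most one k-path enters: the contributions of several
  paths could cancel each other.\<close>

lemma sum_walk_total_unique_path:
  fixes a :: "nat \<Rightarrow> 'a::comm_ring_1"
  assumes "(1::'a) + 1 = 0" "k \<ge> 1" "is_kpath adj k ws" "num_kpaths adj k \<le> 1"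
  shows "(\<Sum>S\<in>Pow {..<k}. walk_total adj k S a) = ryser k (\<lambda>i. a (ws ! i))"
proof -
  have "finite {ws. is_kpath adj k ws}"
    using finite_walks[of adj k] by (simp add: is_kpath_iff)
  then have one: "is_kpath adj k ws' \<Longrightarrow> ws' = ws" for ws'
    using assms(3,4) unfolding num_kpaths_def by (metis One_nat_def card_le_Suc0_iff_eq mem_Collect_eq)
  have "(\<Sum>ws'\<in>walks adj k. ryser k (\<lambda>i. a (ws' ! i))) = (\<Sum>ws'\<in>{ws}. ryser k (\<lambda>i. a (ws' ! i)))"
  proof (rule sum.mono_neutral_right[OF finite_walks])
    show "{ws} \<subseteq> walks adj k" using assms(3) by (simp add: is_kpath_iff)
    show "\<forall>ws'\<in>walks adj k - {ws}. ryser k (\<lambda>i. a (ws' ! i)) = 0"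
    proof
      fix ws' assume ws: "ws' \<in> walks adj k - {ws}"
      then have "\<not> distinct ws'" "length ws' = k" using one by (auto simp: is_kpath_iff walks_def)
      then obtain i j where "i < k" "j < k" "i \<noteq> j" "ws' ! i = ws' ! j"
        by (auto simp: distinct_conv_nth)
      then show "ryser k (\<lambda>i. a (ws' ! i)) = 0"
        by (intro ryser_repeated[OF assms(1), of i k j]) auto
    qed
  qed
  then show ?thesis by (simp add: sum_walk_total[OF assms(2)])
qed

section \<open>Labels that are distinct along every path\<close>

definition out_offset :: "nat list list \<Rightarrow> nat \<Rightarrow> nat" where
  "out_offset adj u = sum_list (map length (take u adj))"

(* Labels only have to be distinct along a walk, where all vertices but the last have out-edges. This
   keeps them below both n and m + 1, so that a power of two above all labels is still a machine word. *)
definition label :: "nat list list \<Rightarrow> nat \<Rightarrow> nat" where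
  "label adj u = (if num_edges adj < length adj
     then if adj ! u = [] then num_edges adj else out_offset adj u else u)"

lemma out_offset_Suc: "u < length adj \<Longrightarrow> out_offset adj (Suc u) = out_offset adj u + length (adj ! u)"
  by (simp add: out_offset_def take_Suc_conv_app_nth)

lemma out_offset_mono: "u \<le> v \<Longrightarrow> out_offset adj u \<le> out_offset adj v"
proof (induction rule: dec_induct)
  case (step v)
  then show ?case
    by (cases "v < length adj") (auto simp: out_offset_Suc, simp add: out_offset_def)
qed simp

lemma out_offset_length: "out_offset adj (length adj) = num_edges adj"
  by (simp add: out_offset_def num_edges_def)

lemma out_offset_le: "u \<le> length adj \<Longrightarrow> out_offset adj u \<le> num_edges adj"
  using out_offset_mono out_offset_length by metis

lemma out_offset_less: "u < v \<Longrightarrow> v \<le> length adj \<Longrightarrow> adj ! u \<noteq> [] \<Longrightarrow> out_offset adj u < out_offset adj v"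
  using out_offset_mono[of "Suc u" v adj] out_offset_Suc[of u adj] length_greater_0_conv[of "adj ! u"]
  by linarith

lemma label_less:
  assumes "u < length adj"
  shows "label adj u < (if num_edges adj < length adj then num_edges adj + 1 else length adj)"
  using assms out_offset_le[of u adj] by (auto simp: label_def)

text \<open>The vertex at the earlier position i has an out-edge, so its offset is below m and
  differs from the label m shared by all vertices without out-edges; and offsets strictly increase
  after a vertex with out-edges.\<close>

lemma label_walk_inj:
  assumes ws: "ws \<in> walks adj k" and ij: "i < j" "j < k" and eq: "label adj (ws ! i) = label adj (ws ! j)"
  shows "ws ! i = ws ! j"
proof (cases "num_edges adj < length adj")
  case False
  then show ?thesis using eq by (simp add: label_def)
next
  case True
  have len: "ws ! i < length adj" "ws ! j < length adj"
    using ws ij nth_mem[of i ws] nth_mem[of j ws] by (auto simp: walks_def subset_iff)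
  have "is_edge adj (ws ! i) (ws ! Suc i)" using ws ij by (auto simp: walks_def)
  then have ne: "adj ! (ws ! i) \<noteq> []" by (auto simp: is_edge_def)
  then have "out_offset adj (ws ! i) < num_edges adj"
    using out_offset_less[of "ws ! i" "length adj" adj] len by (simp add: out_offset_length)
  then have ne': "adj ! (ws ! j) \<noteq> []" and "out_offset adj (ws ! i) = out_offset adj (ws ! j)"
    using eq True ne by (auto simp: label_def split: if_splits)
  then show ?thesis
    using out_offset_less[of "ws ! i" "ws ! j" adj] out_offset_less[of "ws ! j" "ws ! i" adj] ne len
    by (metis linorder_neqE_nat less_irrefl less_imp_le)
qed

section \<open>A structured language for the machine\<close>

datatype com =
    Ins instr
  | Seq com com (infixr ";;" 60)
  | IfLt nat nat com com
  | WhileLt nat nat com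

type_synonym regs = "nat \<Rightarrow> int"
type_synonym mem = "int \<Rightarrow> int"

fun plain :: "instr \<Rightarrow> bool" where
  "plain (JmpZ _ _) = False"
| "plain (JmpLt _ _ _) = False"
| "plain (Jmp _) = False"
| "plain Halt = False"
| "plain _ = True"

text \<open>Program counter 0 stands for any other: plain instructions act on registers and memory
  independently of it.\<close>

definition eff :: "int \<Rightarrow> instr \<Rightarrow> regs \<Rightarrow> mem \<Rightarrow> (regs \<times> mem) option" where
  "eff W i R M = (if plain i then map_option snd (step_instr W i (0, R, M)) else None)"

text \<open>The added constants are the jumps of the compiled code: a false conditional passes
  \<open>JmpLt\<close> and later jumps over the other branch, each turn of a loop pays
  \<open>JmpLt\<close> and the closing \<open>Jmp\<close>, and leaving a loop costs
  \<open>JmpLt\<close> and the exit \<open>Jmp\<close>.\<close>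

inductive big :: "int \<Rightarrow> com \<Rightarrow> regs \<Rightarrow> mem \<Rightarrow> nat \<Rightarrow> regs \<Rightarrow> mem \<Rightarrow> bool" for W where
  big_Ins: "eff W i R M = Some (R', M') \<Longrightarrow> big W (Ins i) R M 1 R' M'"
| big_Seq: "big W c1 R M t1 R1 M1 \<Longrightarrow> big W c2 R1 M1 t2 R2 M2 \<Longrightarrow> big W (c1 ;; c2) R M (t1 + t2) R2 M2"
| big_IfT: "R a < R b \<Longrightarrow> big W c1 R M t R' M' \<Longrightarrow> big W (IfLt a b c1 c2) R M (t + 1) R' M'"
| big_IfF: "\<not> R a < R b \<Longrightarrow> big W c2 R M t R' M' \<Longrightarrow> big W (IfLt a b c1 c2) R M (t + 2) R' M'"
| big_WhileF: "\<not> R a < R b \<Longrightarrow> big W (WhileLt a b c) R M 2 R M"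
| big_WhileT: "R a < R b \<Longrightarrow> big W c R M t1 R1 M1 \<Longrightarrow> big W (WhileLt a b c) R1 M1 t2 R2 M2
    \<Longrightarrow> big W (WhileLt a b c) R M (t1 + t2 + 2) R2 M2"

inductive_cases big_InsE: "big W (Ins i) R M t R' M'"
inductive_cases big_SeqE: "big W (c1 ;; c2) R M t R' M'"
inductive_cases big_IfE: "big W (IfLt a b c1 c2) R M t R' M'"

section \<open>Weakest preconditions for total correctness with running time\<close>

definition wp :: "int \<Rightarrow> com \<Rightarrow> regs \<Rightarrow> mem \<Rightarrow> (nat \<Rightarrow> regs \<Rightarrow> mem \<Rightarrow> bool) \<Rightarrow> bool" where
  "wp W c R M Q \<longleftrightarrow> (\<exists>t R' M'. big W c R M t R' M' \<and> Q t R' M')"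

lemma wp_Ins_eff: "wp W (Ins i) R M Q \<longleftrightarrow> (\<exists>R' M'. eff W i R M = Some (R', M') \<and> Q 1 R' M')"
  unfolding wp_def by (auto elim!: big_InsE) (metis big_Ins One_nat_def)

text \<open>As rewrite rules these execute straight-line code symbolically and leave one range
  condition for each write to a register.\<close>

lemma wp_Ins [simp]:
  "wp W (Ins (Const r x)) R M Q \<longleftrightarrow> \<bar>x\<bar> \<le> W \<and> Q 1 (R(r := x)) M"
  "wp W (Ins (Add r a b)) R M Q \<longleftrightarrow> \<bar>R a + R b\<bar> \<le> W \<and> Q 1 (R(r := R a + R b)) M"
  "wp W (Ins (Sub r a b)) R M Q \<longleftrightarrow> \<bar>R a - R b\<bar> \<le> W \<and> Q 1 (R(r := R a - R b)) M"
  "wp W (Ins (Mul r a b)) R M Q \<longleftrightarrow> \<bar>R a * R b\<bar> \<le> W \<and> Q 1 (R(r := R a * R b)) M"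
  "wp W (Ins (Div r a b)) R M Q \<longleftrightarrow> R b \<noteq> 0 \<and> \<bar>R a div R b\<bar> \<le> W \<and> Q 1 (R(r := R a div R b)) M"
  "wp W (Ins (Mod r a b)) R M Q \<longleftrightarrow> R b \<noteq> 0 \<and> \<bar>R a mod R b\<bar> \<le> W \<and> Q 1 (R(r := R a mod R b)) M"
  "wp W (Ins (Load r a)) R M Q \<longleftrightarrow> \<bar>M (R a)\<bar> \<le> W \<and> Q 1 (R(r := M (R a))) M"
  "wp W (Ins (Store a r)) R M Q \<longleftrightarrow> Q 1 R (M(R a := R r))"
  by (auto simp: wp_Ins_eff eff_def wr_def split: if_splits)

lemma wp_Seq [simp]:
  "wp W (c1 ;; c2) R M Q \<longleftrightarrow> wp W c1 R M (\<lambda>t1 R1 M1. wp W c2 R1 M1 (\<lambda>t2. Q (t1 + t2)))"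
  unfolding wp_def by (auto intro: big_Seq elim!: big_SeqE) (metis big_Seq)

lemma wp_IfLt [simp]:
  "wp W (IfLt a b c1 c2) R M Q \<longleftrightarrow>
     (if R a < R b then wp W c1 R M (\<lambda>t. Q (t + 1)) else wp W c2 R M (\<lambda>t. Q (t + 2)))"
  unfolding wp_def by (auto intro: big_IfT big_IfF elim!: big_IfE) (metis big_IfT Suc_eq_plus1, metis big_IfF add_2_eq_Suc')

lemma wp_mono:
  "wp W c R M Q \<Longrightarrow> (\<And>t R' M'. Q t R' M' \<Longrightarrow> Q' t R' M') \<Longrightarrow> wp W c R M Q'"
  unfolding wp_def by blast

lemma wp_While_unfold:
  assumes "if R a < R b then wp W c R M (\<lambda>t1 R1 M1. wp W (WhileLt a b c) R1 M1 (\<lambda>t2. Q (t1 + t2 + 2))) else Q 2 R M"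
  shows "wp W (WhileLt a b c) R M Q"
  using assms unfolding wp_def
  by (auto split: if_splits) (metis big_WhileT Suc_eq_plus1 add_2_eq_Suc', use big_WhileF in blast)

text \<open>For loops whose number of turns is only bounded by a variant; the two jumps per turn are
  added to the cost B of the body.\<close>

lemma wp_While_variant:
  assumes step: "\<And>R M. J R M \<Longrightarrow> R a < R b \<Longrightarrow>
      wp W c R M (\<lambda>t R' M'. t \<le> B \<and> J R' M' \<and> (v R' M' :: nat) < v R M)"
    and "J R M" "v R M \<le> n"
  shows "wp W (WhileLt a b c) R M (\<lambda>t R' M'. t \<le> n * (B + 2) + 2 \<and> J R' M' \<and> \<not> R' a < R' b)"
  using assms(2,3)
proof (induction n arbitrary: R M)
  case 0
  have "\<not> R a < R b"
  proof
    assume "R a < R b"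
    from step[OF 0(1) this] show False using 0 by (auto simp: wp_def)
  qed
  then show ?case using 0 by (intro wp_While_unfold) auto
next
  case (Suc n)
  show ?case
  proof (cases "R a < R b")
    case True
    show ?thesis
      apply (intro wp_While_unfold)
      apply (simp only: True if_True)
      apply (rule wp_mono[OF step[OF Suc.prems(1) True]])
      apply (rule wp_mono[OF Suc.IH])
      using Suc.prems by auto
  next
    case False
    then show ?thesis using Suc.prems by (intro wp_While_unfold) auto
  qed
qed

text \<open>Separate bounds \<open>B i\<close> allow a scan of all adjacency lists to be charged n +
  m in total instead of n times the largest degree.\<close>

lemma wp_While_sum:
  assumes step: "\<And>i R M. I i R M \<Longrightarrow> i < n \<Longrightarrow>
      R a < R b \<and> wp W c R M (\<lambda>t R' M'. t \<le> B i \<and> I (Suc i) R' M')"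
    and stop: "\<And>R M. I n R M \<Longrightarrow> \<not> R a < R b"
    and "I 0 R M"
  shows "wp W (WhileLt a b c) R M (\<lambda>t R' M'. t \<le> (\<Sum>i<n. B i + 2) + 2 \<and> I n R' M')"
proof -
  have "wp W (WhileLt a b c) R M (\<lambda>t R' M'. t \<le> (\<Sum>i=i..<n. B i + 2) + 2 \<and> I n R' M')"
    if "I i R M" "i \<le> n" for i R M
    using that
  proof (induction "n - i" arbitrary: i R M)
    case 0
    then show ?case using stop by (intro wp_While_unfold) auto
  next
    case (Suc d)
    then have i: "i < n" by simp
    have d: "d = n - Suc i" using Suc.hyps(2) by simp
    have ni: "(\<Sum>i=i..<n. B i + 2) = (\<Sum>i=Suc i..<n. B i + 2) + (B i + 2)"
      using i by (simp add: sum.atLeast_Suc_lessThan)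
    show ?case
      apply (intro wp_While_unfold)
      using step[OF Suc.prems(1) i] apply simp
      apply (erule conjE)
      apply (erule wp_mono)
      apply (rule wp_mono[OF Suc.hyps(1)[OF d]])
      using ni i by auto
  qed
  from this[of 0 R M] assms(3) show ?thesis by (simp add: lessThan_atLeast0)
qed

lemma wp_While_count:
  assumes step: "\<And>i R M. I i R M \<Longrightarrow> i < n \<Longrightarrow>
      R a < R b \<and> wp W c R M (\<lambda>t R' M'. t \<le> B \<and> I (Suc i) R' M')"
    and stop: "\<And>R M. I n R M \<Longrightarrow> \<not> R a < R b"
    and "I 0 R M"
  shows "wp W (WhileLt a b c) R M (\<lambda>t R' M'. t \<le> n * (B + 2) + 2 \<and> I n R' M')"
  using wp_While_sum[of I n a b W c "\<lambda>_. B", OF assms] by simp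

section \<open>Compilation to jumps and its correctness\<close>

fun csize :: "com \<Rightarrow> nat" where
  "csize (Ins i) = 1"
| "csize (c1 ;; c2) = csize c1 + csize c2"
| "csize (IfLt a b c1 c2) = csize c1 + csize c2 + 2"
| "csize (WhileLt a b c) = csize c + 3"

fun compile :: "nat \<Rightarrow> com \<Rightarrow> instr list" where
  "compile p (Ins i) = [i]"
| "compile p (c1 ;; c2) = compile p c1 @ compile (p + csize c1) c2"
| "compile p (IfLt a b c1 c2) = JmpLt a b (p + csize c2 + 2) # compile (p + 1) c2
     @ Jmp (p + csize c2 + 2 + csize c1) # compile (p + csize c2 + 2) c1"
| "compile p (WhileLt a b c) = JmpLt a b (p + 2) # Jmp (p + 3 + csize c) # compile (p + 2) c @ [Jmp p]"

lemma length_compile [simp]: "length (compile p c) = csize c"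
  by (induction c arbitrary: p) auto

lemma exec_halted: "halted P c \<Longrightarrow> exec P W t c = Some c"
  by (cases t) auto

lemma exec_add: "exec P W (t1 + t2) c = Option.bind (exec P W t1 c) (exec P W t2)"
proof (induction t1 arbitrary: c)
  case (Suc t1)
  then show ?case by (auto simp: exec_halted split: option.split)
qed simp

lemma exec_step:
  assumes "P ! pc = i" "pc < length P" "i \<noteq> Halt"
  shows "exec P W (Suc 0) (pc, R, M) = step_instr W i (pc, R, M)"
  using assms by (auto simp: halted_def split: option.split)

lemma step_plain:
  assumes "eff W i R M = Some (R', M')"
  shows "step_instr W i (pc, R, M) = Some (Suc pc, R', M')" "i \<noteq> Halt"
  using assms by (cases i; auto simp: eff_def wr_def split: if_splits)+

text \<open>Jump targets are absolute, so the claim is about code placed at address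
  \<open>length xs\<close> in arbitrary surroundings, which vary in the induction.\<close>

lemma exec_compile:
  assumes "big W c R M t R' M'"
  shows "P = xs @ compile (length xs) c @ ys \<Longrightarrow>
    exec P W t (length xs, R, M) = Some (length xs + csize c, R', M')"
  using assms
proof (induction arbitrary: xs ys rule: big.induct)
  case (big_Ins i R M R' M')
  have "exec P W (Suc 0) (length xs, R, M) = step_instr W i (length xs, R, M)"
    using big_Ins step_plain(2) by (intro exec_step) auto
  then show ?case using step_plain(1)[OF big_Ins(1)] by simp
next
  case (big_Seq c1 R M t1 R1 M1 c2 t2 R2 M2)
  have "exec P W t1 (length xs, R, M) = Some (length xs + csize c1, R1, M1)"
    using big_Seq.prems by (intro big_Seq.IH(1)) simp
  moreover have "exec P W t2 (length (xs @ compile (length xs) c1), R1, M1)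
      = Some (length (xs @ compile (length xs) c1) + csize c2, R2, M2)"
    using big_Seq.prems by (intro big_Seq.IH(2)) simp
  ultimately show ?case by (simp add: exec_add add.assoc)
next
  case (big_IfT R a b c1 M t R' M' c2)
  let ?ys = "xs @ JmpLt a b (length xs + csize c2 + 2) # compile (length xs + 1) c2
     @ [Jmp (length xs + csize c2 + 2 + csize c1)]"
  have "exec P W (Suc 0) (length xs, R, M) = step_instr W (JmpLt a b (length xs + csize c2 + 2)) (length xs, R, M)"
    using big_IfT.prems by (intro exec_step) auto
  also have "\<dots> = Some (length ?ys, R, M)"
    using big_IfT.hyps by simp
  finally have 1: "exec P W (Suc 0) (length xs, R, M) = Some (length ?ys, R, M)" .
  have "exec P W t (length ?ys, R, M) = Some (length ?ys + csize c1, R', M')"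
    using big_IfT.prems by (intro big_IfT.IH) simp
  then have "exec P W (Suc 0 + t) (length xs, R, M) = Some (length ?ys + csize c1, R', M')"
    unfolding exec_add 1 by simp
  then show ?case by (simp add: algebra_simps)
next
  case (big_IfF R a b c2 M t R' M' c1)
  let ?ys = "xs @ [JmpLt a b (length xs + csize c2 + 2)]"
  have "exec P W (Suc 0) (length xs, R, M) = step_instr W (JmpLt a b (length xs + csize c2 + 2)) (length xs, R, M)"
    using big_IfF.prems by (intro exec_step) auto
  also have "\<dots> = Some (length ?ys, R, M)"
    using big_IfF.hyps by simp
  finally have 1: "exec P W (Suc 0) (length xs, R, M) = Some (length ?ys, R, M)" .
  have 2: "exec P W t (length ?ys, R, M) = Some (length ?ys + csize c2, R', M')"
    using big_IfF.prems by (intro big_IfF.IH) simp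
  have "exec P W (Suc 0) (length ?ys + csize c2, R', M')
      = step_instr W (Jmp (length xs + csize c2 + 2 + csize c1)) (length ?ys + csize c2, R', M')"
    using big_IfF.prems by (intro exec_step) (auto simp: nth_append)
  then have 3: "exec P W (Suc 0) (length ?ys + csize c2, R', M')
      = Some (length xs + csize c2 + 2 + csize c1, R', M')" by simp
  have "exec P W (Suc 0 + (t + Suc 0)) (length xs, R, M) = Some (length xs + csize c2 + 2 + csize c1, R', M')"
    unfolding exec_add 1 bind.bind_lunit 2 3 ..
  then show ?case by (simp add: algebra_simps del: exec.simps)
next
  case (big_WhileF R a b c M)
  have "exec P W (Suc 0) (length xs, R, M) = step_instr W (JmpLt a b (length xs + 2)) (length xs, R, M)"
    using big_WhileF.prems by (intro exec_step) auto
  then have 1: "exec P W (Suc 0) (length xs, R, M) = Some (Suc (length xs), R, M)"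
    using big_WhileF.hyps by simp
  have "exec P W (Suc 0) (Suc (length xs), R, M) = step_instr W (Jmp (length xs + 3 + csize c)) (Suc (length xs), R, M)"
    using big_WhileF.prems by (intro exec_step) (auto simp: nth_append)
  then have 2: "exec P W (Suc 0) (Suc (length xs), R, M) = Some (length xs + 3 + csize c, R, M)" by simp
  have "exec P W (Suc 0 + Suc 0) (length xs, R, M) = Some (length xs + 3 + csize c, R, M)"
    unfolding exec_add 1 bind.bind_lunit 2 ..
  moreover have "Suc 0 + Suc 0 = (2::nat)" by simp
  ultimately have "exec P W 2 (length xs, R, M) = Some (length xs + 3 + csize c, R, M)"
    by (simp only:)
  then show ?case by (simp add: algebra_simps del: exec.simps)
next
  case (big_WhileT R a b c M t1 R1 M1 t2 R2 M2)
  let ?ys = "xs @ [JmpLt a b (length xs + 2), Jmp (length xs + 3 + csize c)]"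
  have "exec P W (Suc 0) (length xs, R, M) = step_instr W (JmpLt a b (length xs + 2)) (length xs, R, M)"
    using big_WhileT.prems by (intro exec_step) auto
  also have "\<dots> = Some (length ?ys, R, M)"
    using big_WhileT.hyps by simp
  finally have 1: "exec P W (Suc 0) (length xs, R, M) = Some (length ?ys, R, M)" .
  have 2: "exec P W t1 (length ?ys, R, M) = Some (length ?ys + csize c, R1, M1)"
    using big_WhileT.prems by (intro big_WhileT.IH(1)) simp
  have "exec P W (Suc 0) (length ?ys + csize c, R1, M1)
      = step_instr W (Jmp (length xs)) (length ?ys + csize c, R1, M1)"
    using big_WhileT.prems by (intro exec_step) (auto simp: nth_append)
  then have 3: "exec P W (Suc 0) (length ?ys + csize c, R1, M1) = Some (length xs, R1, M1)" by simp
  have 4: "exec P W t2 (length xs, R1, M1) = Some (length xs + csize (WhileLt a b c), R2, M2)"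
    using big_WhileT.prems by (rule big_WhileT.IH(2))
  have "exec P W (Suc 0 + (t1 + (Suc 0 + t2))) (length xs, R, M) = Some (length xs + csize (WhileLt a b c), R2, M2)"
    unfolding exec_add 1 bind.bind_lunit 2 3 4 ..
  moreover have "Suc 0 + (t1 + (Suc 0 + t2)) = t1 + t2 + 2" by simp
  ultimately show ?case by (simp only:)
qed

text \<open>The compiled code halts by running past its end, and a halted machine stays as it is, so
  every budget above the actual running time gives the same result.\<close>

lemma wp_exec:
  assumes "wp W c R M (\<lambda>t R' M'. t \<le> T \<and> Q R')"
  shows "\<exists>c'. exec (compile 0 c) W T (0, R, M) = Some c' \<and> halted (compile 0 c) c' \<and> Q (fst (snd c'))"
proof -
  obtain t R' M' where b: "big W c R M t R' M'" "t \<le> T" "Q R'"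
    using assms by (auto simp: wp_def)
  have e: "exec (compile 0 c) W t (0, R, M) = Some (csize c, R', M')"
    using exec_compile[OF b(1), of "compile 0 c" "[]" "[]"] by simp
  have h: "halted (compile 0 c) (csize c, R', M')" by (simp add: halted_def)
  have "exec (compile 0 c) W (t + (T - t)) (0, R, M) = Some (csize c, R', M')"
    unfolding exec_add e using exec_halted[OF h] by simp
  then show ?thesis using b h by simp
qed

section \<open>Field arithmetic on the machine\<close>

(* Registers: 0 and 2 hold the constants 0 and 1; 3, 4, 5 hold n, m, k; 6, 7, 8 hold q, q/2 and the
   modulus F without its leading term; 9 tells whether the table is filled; 10 and 11 hold the seed
   and its limit; 12 to 14 hold the answer, the current sum and the loop flag. A subroutine only
   changes registers above those of its callers. *)
definition xor_slow :: com where
  "xor_slow =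
    Ins (Const 82 0) ;; Ins (Const 83 1) ;; Ins (Const 86 2) ;;
    WhileLt 83 6 (
      Ins (Mod 84 80 86) ;; Ins (Mod 85 81 86) ;; Ins (Add 84 84 85) ;; Ins (Mod 84 84 86) ;;
      Ins (Mul 84 84 83) ;; Ins (Add 82 82 84) ;;
      Ins (Div 80 80 86) ;; Ins (Div 81 81 86) ;; Ins (Add 83 83 83))"

lemma int_le_of_less_pow:
  assumes "x < 2 ^ t" "2 ^ t \<le> (W::int)"
  shows "int x \<le> W"
proof -
  have "int x < int (2 ^ t)" using assms(1) by (simp only: of_nat_less_iff)
  moreover have "int (2 ^ t) = 2 ^ t" by simp
  ultimately show ?thesis using assms(2) by linarith
qed

lemma pow_facts:
  assumes "i < t" "2 ^ t \<le> (W::int)"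
  shows "(2::int) ^ i < 2 ^ t" "2 * 2 ^ i \<le> W"
  using assms power_increasing[of "Suc i" t "2::int"] by simp_all

lemma mod2_le: "(x::int) mod 2 \<le> 1"
  using pos_mod_bound[of 2 x] by linarith

lemma half_div: "int (a div 2 ^ i) div 2 = int (a div (2 * 2 ^ i))"
  by (simp add: zdiv_int div_mult2_eq mult.commute[of 2])

text \<open>The machine has no bit operations: bit i of the \<open>xor\<close> is the sum of the two
  bits modulo 2, put in place by multiplication with 2^i.\<close>

lemma take_bit_step:
  "int (take_bit i c) + (int (a div 2 ^ i) mod 2 + int (b div 2 ^ i) mod 2) mod 2 * 2 ^ i = int (take_bit (Suc i) c)"
  if "c = xor a b" for a b c :: nat
proof -
  have "(int (a div 2 ^ i) mod 2 + int (b div 2 ^ i) mod 2) mod 2 = of_bool (bit c i)"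
  proof -
    have "bit c i \<longleftrightarrow> odd (a div 2 ^ i) \<noteq> odd (b div 2 ^ i)"
      by (simp add: that bit_xor_iff bit_iff_odd[of a] bit_iff_odd[of b])
    then show ?thesis
      by (auto simp: zmod_int[symmetric] mod_2_eq_odd simp del: of_nat_div)
  qed
  then show ?thesis by (simp add: take_bit_Suc_from_most)
qed

lemma wp_xor_slow:
  assumes "R 6 = 2 ^ t" "R 80 = int a" "R 81 = int b" "a < 2 ^ t" "b < 2 ^ t" "t \<ge> 1" "2 ^ t \<le> W"
  shows "wp W xor_slow R M (\<lambda>s R' M'. s \<le> 11 * t + 5 \<and> M' = M \<and> (\<forall>r<80. R' r = R r) \<and> R' 82 = int (xor a b))"
proof -
  define c where "c = xor a b"
  have cb: "int (take_bit i c) \<le> W" if "i \<le> t" for i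
  proof -
    have "take_bit i c < 2 ^ i" by simp
    also have "\<dots> \<le> 2 ^ t" using that by simp
    finally show ?thesis using assms(7) by (rule int_le_of_less_pow)
  qed
  have W2: "0 \<le> W" "1 \<le> W" "2 \<le> W" using assms(6,7) power_increasing[of 1 t "2::int"] by simp_all
  let ?I = "\<lambda>i R' M'. M' = M \<and> (\<forall>r<80. R' r = R r) \<and> R' 86 = 2 \<and> R' 83 = 2 ^ i \<and> R' 80 = int (a div 2 ^ i)
    \<and> R' 81 = int (b div 2 ^ i) \<and> R' 82 = int (take_bit i c)"
  have "c < 2 ^ t" using assms(4,5) unfolding c_def
    by (metis take_bit_nat_eq_self take_bit_nat_less_exp take_bit_xor)
  then have ct: "take_bit t c = c" by (simp add: take_bit_nat_eq_self)
  have bnd: "int (a div 2 ^ i) \<le> W" "int (b div 2 ^ i) \<le> W" for i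
  proof -
    have "a div 2 ^ i \<le> a" "b div 2 ^ i \<le> b" by simp_all
    then show "int (a div 2 ^ i) \<le> W" "int (b div 2 ^ i) \<le> W"
      using int_le_of_less_pow[OF assms(4,7)] int_le_of_less_pow[OF assms(5,7)] by linarith+
  qed
  show ?thesis
    unfolding xor_slow_def
    apply (simp add: assms(1-3) W2)
    apply (rule wp_mono)
     apply (rule wp_While_count[where n = t and B = 9 and I = ?I])
    subgoal for i R' M'
      using bnd[of i] bnd[of "Suc i"] cb[of "Suc i"] take_bit_step[OF c_def, of i] pow_facts[OF _ assms(7), of i]
        mod2_le[of "int (a div 2 ^ i)"] mod2_le[of "int (b div 2 ^ i)"] W2
        mod2_le[of "int (a div 2 ^ i) mod 2 + int (b div 2 ^ i) mod 2"]
      by (simp add: half_div assms(1))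
    using assms ct W2 by (auto simp: c_def)
qed

section \<open>Shift-and-add multiplication modulo F\<close>

definition mul_add :: com where
  "mul_add = IfLt 0 65
     (Ins (Add 80 62 0) ;; Ins (Add 81 60 0) ;; xor_slow ;; Ins (Add 62 82 0))
     (Ins (Const 65 0))"

text \<open>Multiplication by the variable. The top bit is removed before doubling, so no number of
  2^t or more arises, which might not be a word.\<close>

definition mul_shift :: com where
  "mul_shift = IfLt 60 7
     (Ins (Add 60 60 60))
     (Ins (Sub 60 60 7) ;; Ins (Add 80 60 60) ;; Ins (Add 81 8 0) ;; xor_slow ;; Ins (Add 60 82 0))"

text \<open>Before turn i, register 60 holds the first factor times the i-th power of the variable,
  61 the remaining bits of the second factor, and 62 the product with the bits already
  processed.\<close>

definition mul_slow :: com where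
  "mul_slow =
    Ins (Const 62 0) ;; Ins (Const 63 1) ;; Ins (Const 64 2) ;;
    WhileLt 63 6 (
      Ins (Mod 65 61 64) ;;
      mul_add ;;
      Ins (Div 61 61 64) ;;
      mul_shift ;;
      Ins (Add 63 63 63))"

lemma pl_double: "pl (2 * x) = monom 1 1 * pl x"
  by (rule poly_eqI) (auto simp: coeff_pl coeff_monom_mult bit_double_iff)

lemma pl_take_bit_Suc: "pl (take_bit (Suc i) b) = pl (take_bit i b) + (if bit b i then monom 1 i else 0)"
  by (rule poly_eqI) (auto simp: coeff_pl bit_take_bit_iff less_Suc_eq)

context
  fixes t f h :: nat and F :: "bit poly"
  assumes t: "t \<ge> 1" and h: "2 ^ t = 2 * h" and f: "f < 2 ^ t" and F_def: "F = pl (2 ^ t + f)"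
begin

interpretation modulus F t
  using degree_pl_pow_add[OF f] t by unfold_locales (simp_all add: F_def)

lemma rep_shift:
  assumes "x < 2 ^ t" "rep F p = x"
  shows "rep F (p * monom 1 1) = (if x < h then 2 * x else xor (2 * (x - h)) f)"
proof -
  note tt = h
  have "rep F (p * monom 1 1) = rep F (pl (rep F p) * pl (rep F (monom 1 1)))"
    by (simp add: rep_mult)
  also have "\<dots> = rep F (pl x * monom 1 1)"
    by (intro rep_cong) (simp add: assms(2) pl_rep mod_mult_right_eq)
  also have "\<dots> = rep F (pl (2 * x))" by (simp add: pl_double mult.commute[of "pl x"])
  finally have *: "rep F (p * monom 1 1) = rep F (pl (2 * x))" .
  show ?thesis
  proof (cases "x < h")
    case True
    then show ?thesis using * tt by (simp add: rep_pl)
  next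
    case False
    define y where "y = x - h"
    have y: "2 * y < 2 ^ t" "2 * x = 2 ^ t + 2 * y" using False assms(1) tt by (auto simp: y_def)
    \<comment> \<open>The bit shifted to position t is replaced by lower terms: in characteristic 2
      the monomial of degree t equals F plus \<open>pl f\<close>.\<close>
    have "pl (2 * x) = F + (pl f + pl (2 * y))"
      using add_self_char2[OF char2_bit_poly, of "pl f"] f
      by (simp add: y(2) F_def pl_pow_add[OF y(1)] pl_pow_add[OF f] add.assoc[symmetric])
    then have "rep F (pl (2 * x)) = rep F (pl f + pl (2 * y))"
      by (intro rep_cong) simp
    also have "\<dots> = xor (rep F (pl f)) (rep F (pl (2 * y)))" by (simp add: rep_xor)
    also have "\<dots> = xor (2 * y) f" using y(1) f by (simp add: rep_pl xor.commute)
    finally show ?thesis using * False by (simp add: y_def)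
  qed
qed

lemma rep_add_term:
  "rep F (pl a * pl (take_bit (Suc i) b))
    = (if bit b i then xor (rep F (pl a * pl (take_bit i b))) (rep F (pl a * monom 1 i))
       else rep F (pl a * pl (take_bit i b)))"
  by (simp add: pl_take_bit_Suc rep_xor distrib_left)

lemma wp_mul_slow:
  assumes "R 0 = 0" "R 6 = 2 ^ t" "R 7 = int h" "R 8 = int f" "R 60 = int a" "R 61 = int b"
    "a < 2 ^ t" "b < 2 ^ t" "2 ^ t \<le> W"
  shows "wp W mul_slow R M (\<lambda>s R' M'. s \<le> t * (22 * t + 36) + 5 \<and> M' = M \<and> (\<forall>r<60. R' r = R r)
    \<and> R' 62 = int (rep F (pl a * pl b)))"
proof -
  have W2: "0 \<le> W" "1 \<le> W" "2 \<le> W" using t assms(9) power_increasing[of 1 t "2::int"] by simp_all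
  let ?I = "\<lambda>i R' M'. M' = M \<and> (\<forall>r<60. R' r = R r) \<and> R' 64 = 2 \<and> R' 63 = 2 ^ i
    \<and> R' 60 = int (rep F (pl a * monom 1 i))
    \<and> R' 61 = int (b div 2 ^ i) \<and> R' 62 = int (rep F (pl a * pl (take_bit i b)))"
  have repW: "int (rep F p) \<le> W" for p
    using int_le_of_less_pow[OF rep_less assms(9)] .
  note ttn = h
  have tt: "(2::int) ^ t = 2 * int h"
    using arg_cong[OF h, of int] by simp
  have bW: "int (b div 2 ^ i) \<le> W" for i
  proof -
    have "b div 2 ^ i \<le> b" by simp
    then show ?thesis using int_le_of_less_pow[OF assms(8,9)] by linarith
  qed
  have fW: "int f \<le> W" using int_le_of_less_pow[OF f assms(9)] .
  have step: "R' 63 < R' 6 \<and> wp W (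
      Ins (Mod 65 61 64) ;;
      mul_add ;;
      Ins (Div 61 61 64) ;;
      mul_shift ;;
      Ins (Add 63 63 63)) R' M' (\<lambda>s R'' M''. s \<le> 22 * t + 34 \<and> ?I (Suc i) R'' M'')"
    if I: "?I i R' M'" and i: "i < t" for i R' M'
  proof -
    define x where "x = rep F (pl a * monom 1 i)"
    define c where "c = rep F (pl a * pl (take_bit i b))"
    have x: "x < 2 ^ t" and c: "c < 2 ^ t" by (simp_all add: x_def c_def rep_less)
    have x': "rep F (pl a * monom 1 (Suc i)) = (if x < h then 2 * x else xor (2 * (x - h)) f)"
      using rep_shift[OF x x_def[symmetric]] by (simp add: mult.assoc mult_monom)
    have c': "rep F (pl a * pl (take_bit (Suc i) b)) = (if bit b i then xor c x else c)"
      by (simp add: rep_add_term x_def c_def)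
    define e :: int where "e = of_bool (bit b i)"
    have e: "0 \<le> e" "e \<le> W" using W2 by (simp_all add: e_def)
    have odd: "int (b div 2 ^ i) mod 2 = e"
      by (auto simp: e_def bit_iff_odd zmod_int[symmetric] mod_2_eq_odd simp del: of_nat_div)
    have Rv: "R' 0 = 0" "R' 6 = 2 ^ t" "R' 7 = int h" "R' 8 = int f" "R' 64 = 2" "R' 63 = 2 ^ i"
      "R' 60 = int x" "R' 61 = int (b div 2 ^ i)" "R' 62 = int c" "M' = M"
      using I assms by (simp_all add: x_def c_def)
    have xW: "int x \<le> W" "int c \<le> W" "int x < 2 * int h"
      using repW x int_le_of_less_pow[OF x order_refl] tt of_nat_less_iff[of x "2 ^ t", where 'a = int]
      by (simp_all add: x_def c_def)
    have first: "wp W mul_add (R'(65 := e)) M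
        (\<lambda>s R'' M''. s \<le> 11 * t + 12 \<and> M'' = M \<and> (\<forall>r<62. R'' r = R' r) \<and> R'' 63 = R' 63 \<and> R'' 64 = R' 64
          \<and> R'' 62 = int (if bit b i then xor c x else c))"
    proof (cases "bit b i")
      case True
      have xc: "int (xor c x) \<le> W" using repW[of "pl a * pl (take_bit (Suc i) b)"] True by (simp only: c' if_True)
      show ?thesis
        apply (simp add: mul_add_def e_def Rv True xW)
        apply (rule wp_mono[OF wp_xor_slow[where t = t and a = c and b = x]])
               apply (simp_all add: Rv x c t assms(9))
        using xc t by auto
    next
      case False
      then show ?thesis by (simp add: mul_add_def e_def Rv W2)
    qed
    have second: "wp W mul_shift Q M
        (\<lambda>s R'' M''. s \<le> 11 * t + 12 \<and> M'' = M \<and> (\<forall>r<60. R'' r = Q r) \<and> (\<forall>r\<in>{61,62,63,64}. R'' r = Q r)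
          \<and> R'' 60 = int (rep F (pl a * monom 1 (Suc i))))"
      if Q: "Q 0 = 0" "Q 6 = 2 ^ t" "Q 7 = int h" "Q 8 = int f" "Q 60 = int x" for Q
    proof (cases "x < h")
      case True
      then have "int x < int h" by simp
      moreover have "2 * int x \<le> W" using calculation tt assms(9) by linarith
      ultimately show ?thesis by (simp add: mul_shift_def Q True x')
    next
      case False
      define y where "y = x - h"
      have y: "int x - int h = int y" "2 * y < 2 ^ t" "int x \<ge> int h"
        using False x ttn by (auto simp: y_def of_nat_diff)
      have yW: "2 * int y \<le> W" "int y \<le> W" using int_le_of_less_pow[OF y(2) assms(9)] by simp_all
      have xr: "rep F (pl a * monom 1 (Suc i)) = xor (2 * y) f" by (simp only: x' False y_def if_False)
      have xc: "int (xor (2 * y) f) \<le> W" using repW[of "pl a * monom 1 (Suc i)"] by (simp only: xr)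
      show ?thesis
        apply (simp add: mul_shift_def Q False y(1) yW fW xr y(3) leD)
        apply (rule wp_mono[OF wp_xor_slow[where t = t and a = "2 * y" and b = f]])
               apply (simp_all add: Q y f t assms(9))
        using xc t by auto
    qed
    show ?thesis
      using pow_facts[OF i assms(9)] W2 bW[of i] bW[of "Suc i"]
      apply (simp only: wp_Seq wp_Ins Rv odd)
      apply (simp add: e)
      apply (rule wp_mono[OF first])
      apply (simp add: Rv half_div)
      apply (rule wp_mono[OF second])
           apply (simp_all add: Rv)
      using I by (simp add: c')
  qed
  show ?thesis
    unfolding mul_slow_def
    apply (simp add: assms W2)
    apply (rule wp_mono)
     apply (rule wp_While_count[where n = t and B = "22 * t + 34" and I = ?I])
       apply (rule step, assumption+)
      apply (simp add: assms)
     apply (simp add: assms rep_pl monom_0 one_pCons[symmetric])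
    apply (simp add: take_bit_nat_eq_self[OF assms(8)] algebra_simps)
    done
qed

end

text \<open>With a table, the cell at -1 - (a q + b) holds v + q (s + q p), where s is the sum and p
  the product of a and b, and v is the value that the dynamic program currently keeps there.
  Division by q strips v; \<open>mod\<close> then selects s, and a second division selects
  p.\<close>

definition xor_op :: com where
  "xor_op = IfLt 0 9
     (Ins (Mul 83 80 6) ;; Ins (Add 83 83 81) ;; Ins (Const 84 (-1)) ;; Ins (Sub 84 84 83) ;;
      Ins (Load 84 84) ;; Ins (Div 84 84 6) ;; Ins (Mod 82 84 6))
     xor_slow"

definition mul_op :: com where
  "mul_op = IfLt 0 9
     (Ins (Mul 63 60 6) ;; Ins (Add 63 63 61) ;; Ins (Const 64 (-1)) ;; Ins (Sub 64 64 63) ;;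
      Ins (Load 64 64) ;; Ins (Div 64 64 6) ;; Ins (Div 62 64 6))
     mul_slow"

lemma abs_div_le:
  assumes "\<bar>v::int\<bar> \<le> W" "0 < q"
  shows "\<bar>v div q\<bar> \<le> W"
proof (cases "0 \<le> v")
  case True
  then have "v div q \<le> v div 1" "0 \<le> v div q"
    using assms by (intro zdiv_mono2, auto simp: pos_imp_zdiv_nonneg_iff)
  then show ?thesis using True assms by simp
next
  case False
  then have "v div 1 \<le> v div q" "v div q < 0"
    using assms by (intro zdiv_mono2_neg, auto simp: pos_imp_zdiv_neg_iff)
  then show ?thesis using False assms by simp
qed

text \<open>The flag \<open>tbl\<close> distinguishes the two regimes, so that they share all later
  proofs. With a table, its indices up to q^2 must be words.\<close>

locale field_machine =
  fixes W :: int and t f h :: nat and tbl :: bool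
  assumes t: "t \<ge> 1" and h: "2 ^ t = 2 * h" and f: "f < 2 ^ t" and tW: "2 ^ t \<le> W"
    and tblW: "tbl \<Longrightarrow> 2 ^ t * 2 ^ t \<le> W"
begin

definition q :: nat where "q = 2 ^ t"

definition F :: "bit poly" where "F = pl (2 ^ t + f)"

sublocale modulus F t
  using degree_pl_pow_add[OF f] t by unfold_locales (simp_all add: F_def)

abbreviation "E \<equiv> rep F"

definition fregs :: "regs \<Rightarrow> bool" where
  "fregs R \<longleftrightarrow> R 0 = 0 \<and> R 2 = 1 \<and> R 6 = int q \<and> R 7 = int h \<and> R 8 = int f \<and> R 9 = of_bool tbl"

text \<open>Only the quotient by q is specified, because the remainder of a cell changes while the
  table is in use.\<close>

definition table_ok :: "mem \<Rightarrow> bool" where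
  "table_ok M \<longleftrightarrow> (tbl \<longrightarrow> (\<forall>a<q. \<forall>b<q.
     M (-1 - (int a * int q + int b)) div int q = int (xor a b + q * E (pl a * pl b)) \<and>
     \<bar>M (-1 - (int a * int q + int b))\<bar> \<le> W))"

definition opT :: nat where
  "opT = (if tbl then 10 else t * (22 * t + 36) + 12)"

lemma E_less [simp]: "E p < q"
  using rep_less by (simp add: q_def)

lemma qW: "int q \<le> W" using tW by (simp add: q_def)

lemma less_q_W: "x < q \<Longrightarrow> int x \<le> W"
  using qW by linarith

lemma E_W [simp]: "int (E p) \<le> W"
  by (simp add: less_q_W)

lemma q_gt1: "1 < q" using q1 by (simp only: q_def)

lemma W2: "0 \<le> W" "1 \<le> W" "2 \<le> W" "\<bar>W\<bar> = W"
  using q_gt1 qW by simp_all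

lemma q_pos [simp]: "0 < q" "q \<noteq> 0"
  using q_gt1 by simp_all

lemma table_index:
  assumes "a < q" "b < q"
  shows "a * q + b < q * q"
proof -
  have "a * q + b < a * q + q" using assms by simp
  also have "\<dots> = Suc a * q" by simp
  also have "\<dots> \<le> q * q" using assms by (intro mult_right_mono) auto
  finally show ?thesis .
qed

lemma qqW: "tbl \<Longrightarrow> int (q * q) \<le> W"
  using tblW by (simp add: q_def)

lemma index_W:
  assumes "tbl" "a < q" "b < q"
  shows "int a * int q \<le> W" "int a * int q + int b \<le> W" "\<bar>- 1 - (int a * int q + int b)\<bar> \<le> W"
proof -
  have "int (a * q + b) < int (q * q)"
    using table_index[OF assms(2,3)] by (simp only: of_nat_less_iff)
  then have "int a * int q + int b < W"
    using qqW[OF assms(1)] by simp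
  moreover have "0 \<le> int a * int q" "0 \<le> int b" by simp_all
  ultimately show "int a * int q \<le> W" "int a * int q + int b \<le> W" "\<bar>- 1 - (int a * int q + int b)\<bar> \<le> W"
    by linarith+
qed

lemma unpack:
  assumes "X < q"
  shows "int (X + q * T) mod int q = int X" "int (X + q * T) div int q = int T"
proof -
  have "(X + q * T) mod q = X" "(X + q * T) div q = T" using assms by simp_all
  then show "int (X + q * T) mod int q = int X" "int (X + q * T) div int q = int T"
    by (metis zmod_int, metis zdiv_int)
qed

lemma opT8: "8 \<le> opT"
  by (simp add: opT_def)

lemma opT_slow: "\<not> tbl \<Longrightarrow> 11 * t + 8 \<le> opT" "\<not> tbl \<Longrightarrow> t * (22 * t + 36) + 8 \<le> opT"
  unfolding opT_def by (simp_all add: distrib_left)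

lemma pack_bound:
  assumes "table_ok M" "tbl"
  shows "int (xor (E p) (E r) + q * E (pl (E p) * pl (E r))) \<le> W"
proof -
  note tab = assms(1)[unfolded table_ok_def, rule_format, of "E p" "E r", OF assms(2) E_less E_less]
  have "\<bar>M (-1 - (int (E p) * int q + int (E r))) div int q\<bar> \<le> W"
    using tab by (intro abs_div_le) auto
  then show ?thesis using tab by simp
qed

lemma wp_xor_op:
  assumes R: "fregs R" and M: "table_ok M" and ab: "R 80 = int (E p)" "R 81 = int (E r)"
  shows "wp W xor_op R M (\<lambda>s R' M'. s \<le> opT \<and> M' = M \<and> (\<forall>r<80. R' r = R r) \<and> R' 82 = int (E (p + r)))"
proof -
  have Rv: "R 0 = 0" "R 6 = int q" "R 9 = of_bool tbl" using R by (simp_all add: fregs_def)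
  define T where "T = opT"
  have T: "8 \<le> T" "\<not> tbl \<Longrightarrow> 11 * t + 8 \<le> T" "\<not> tbl \<Longrightarrow> t * (22 * t + 36) + 8 \<le> T"
    unfolding T_def using opT8 opT_slow by blast+
  have "wp W xor_op R M (\<lambda>s R' M'. s \<le> T \<and> M' = M \<and> (\<forall>r<80. R' r = R r) \<and> R' 82 = int (E (p + r)))"
  proof (cases tbl)
    case True
    have X: "xor (E p) (E r) < q" by (simp add: rep_xor)
    note tab = M[unfolded table_ok_def, rule_format, of "E p" "E r", OF True E_less E_less]
    show ?thesis
      using tab index_W[of "E p" "E r", OF True E_less E_less] W2 pack_bound[OF M True, of p r] T(1)
      by (simp add: xor_op_def Rv ab True unpack[OF X] rep_xor unpack[OF X, unfolded rep_xor] del: of_nat_add of_nat_mult)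
  next
    case False
    show ?thesis
      unfolding xor_op_def
      apply (simp add: Rv False)
      apply (rule wp_mono[OF wp_xor_slow[where t = t and a = "E p" and b = "E r"]])
      using t tW T(2)[OF False] rep_less by (auto simp: Rv q_def ab rep_xor)
  qed
  then show ?thesis by (simp only: T_def)
qed

lemma wp_mul_op:
  assumes R: "fregs R" and M: "table_ok M" and ab: "R 60 = int (E p)" "R 61 = int (E r)"
  shows "wp W mul_op R M (\<lambda>s R' M'. s \<le> opT \<and> M' = M \<and> (\<forall>r<60. R' r = R r) \<and> R' 62 = int (E (p * r)))"
proof -
  have Rv: "R 0 = 0" "R 6 = int q" "R 7 = int h" "R 8 = int f" "R 9 = of_bool tbl"
    using R by (simp_all add: fregs_def)
  define T where "T = opT"
  have T: "8 \<le> T" "\<not> tbl \<Longrightarrow> 11 * t + 8 \<le> T" "\<not> tbl \<Longrightarrow> t * (22 * t + 36) + 8 \<le> T"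
    unfolding T_def using opT8 opT_slow by blast+
  have "wp W mul_op R M (\<lambda>s R' M'. s \<le> T \<and> M' = M \<and> (\<forall>r<60. R' r = R r) \<and> R' 62 = int (E (p * r)))"
  proof (cases tbl)
    case True
    have X: "xor (E p) (E r) < q" by (simp add: rep_xor)
    note tab = M[unfolded table_ok_def, rule_format, of "E p" "E r", OF True E_less E_less]
    show ?thesis
      using tab index_W[of "E p" "E r", OF True E_less E_less] W2 pack_bound[OF M True, of p r] T(1)
      by (simp add: mul_op_def Rv ab True unpack[OF X] rep_mult del: of_nat_add of_nat_mult)
  next
    case False
    show ?thesis
      unfolding mul_op_def
      apply (simp add: Rv False)
      apply (rule wp_mono[OF wp_mul_slow[OF t h f F_def, where a = "E p" and b = "E r"]])
      using t tW T(3)[OF False] rep_less by (auto simp: Rv q_def ab rep_mult)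
  qed
  then show ?thesis by (simp only: T_def)
qed

end

section \<open>Vertex weights\<close>

text \<open>The sign of an offset encodes membership in S, so addresses need the absolute value. The
  idle additions make both branches cost the same, which gives an exact rule with four
  steps.\<close>

definition load_abs :: "nat \<Rightarrow> nat \<Rightarrow> com" where
  "load_abs r a = Ins (Load r a) ;;
     IfLt r 0 (Ins (Sub r 0 r) ;; Ins (Add r r 0)) (Ins (Add r r 0))"

lemma wp_load_abs:
  assumes "R 0 = 0" "r \<noteq> 0"
  shows "wp W (load_abs r a) R M Q \<longleftrightarrow> \<bar>M (R a)\<bar> \<le> W \<and> Q (Suc (Suc (Suc (Suc 0)))) (R(r := \<bar>M (R a)\<bar>)) M"
  using assms by (auto simp: load_abs_def)

text \<open>Equal consecutive offsets reveal a vertex without out-edges; subtracting 4 and n turns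
  the address of a list into its out-offset.\<close>

definition label_prog :: com where
  "label_prog =
    IfLt 4 3
      (Ins (Const 53 3) ;; Ins (Add 53 53 50) ;; load_abs 54 53 ;; Ins (Add 53 53 2) ;; load_abs 55 53 ;;
       IfLt 54 55
         (Ins (Const 53 4) ;; Ins (Sub 54 54 53) ;; Ins (Sub 52 54 3))
         (Ins (Add 52 4 0)))
      (Ins (Add 52 50 0))"

definition hash_step :: com where
  "hash_step =
    Ins (Mod 60 52 6) ;; Ins (Add 61 54 0) ;; mul_op ;;
    Ins (Add 80 53 0) ;; Ins (Add 81 62 0) ;; xor_op ;; Ins (Add 53 82 0) ;;
    Ins (Add 60 54 0) ;; Ins (Add 61 10 0) ;; mul_op ;; Ins (Add 54 62 0) ;;
    Ins (Div 52 52 6)"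

definition hash_prog :: com where
  "hash_prog =
    Ins (Const 53 0) ;; Ins (Const 54 1) ;;
    WhileLt 0 52 hash_step"

definition add_power :: com where
  "add_power = IfLt 57 0
      (Ins (Add 80 51 0) ;; Ins (Add 81 54 0) ;; xor_op ;; Ins (Add 51 82 0))
      (Ins (Const 57 0))"

definition weight_step :: com where
  "weight_step =
    Ins (Const 56 3) ;; Ins (Add 56 56 55) ;; Ins (Load 57 56) ;; add_power ;;
    Ins (Add 60 54 0) ;; Ins (Add 61 53 0) ;; mul_op ;; Ins (Add 54 62 0) ;;
    Ins (Add 55 55 2)"

definition weight_prog :: com where
  "weight_prog =
    Ins (Const 51 0) ;; Ins (Const 54 1) ;; Ins (Const 55 0) ;;
    WhileLt 55 5 weight_step"

text \<open>Weights are recomputed at every use: next to the two arrays of the dynamic program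
  hardly any addressable cell is left to store them.\<close>

definition vertex_weight_prog :: com where
  "vertex_weight_prog = label_prog ;; hash_prog ;; weight_prog"

text \<open>The number of turns of the hashing loop, which serves as its variant.\<close>

function ndigits :: "nat \<Rightarrow> nat \<Rightarrow> nat" where
  "ndigits q x = (if x = 0 \<or> q \<le> 1 then 0 else Suc (ndigits q (x div q)))"
  by pat_completeness auto
termination by (relation "measure snd") auto

declare ndigits.simps [simp del]

lemma ndigits_le: "1 < q \<Longrightarrow> x < q ^ d \<Longrightarrow> ndigits q x \<le> d"
proof (induction d arbitrary: x)
  case 0
  then show ?case by (subst ndigits.simps) simp
next
  case (Suc d)
  then have "x div q < q ^ d" by (simp add: less_mult_imp_div_less mult.commute)
  then show ?case using Suc by (subst ndigits.simps) simp
qed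

lemma hash_0: "hash q b 0 = 0"
  by (simp add: hash_def)

lemma hash_rec: "x > 0 \<Longrightarrow> 1 < q \<Longrightarrow> hash q b x = pl (x mod q) + pl b * hash q b (x div q)"
  by (simp add: hash_def digit_poly_pos)

(* Memory during the evaluation: the subset S is the set of j < k for which the offset of vertex j is
   negated; cell -1 - v packs the value at v (its residue mod q) with entry v of the table; cell
   3 - off u, which lies below these, holds the value that u sends along its out-edges. *)
locale run_machine = field_machine +
  fixes adj :: "nat list list" and k beta :: nat and tab :: "nat \<Rightarrow> nat"
  assumes valid: "valid_digraph adj" and kn: "k \<le> length adj" and k1: "k \<ge> 1"
    and W: "W = int (length adj + num_edges adj + 4)"
    and beta: "beta < 2 ^ t"
    and label_q8: "u < length adj \<Longrightarrow> label adj u < (2 ^ t) ^ 8"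
    and tab_W: "v < length adj \<Longrightarrow> x < 2 ^ t \<Longrightarrow> int (x + 2 ^ t * tab v) \<le> W"
    and tab_eq: "tbl \<Longrightarrow> a < 2 ^ t \<Longrightarrow> b < 2 ^ t \<Longrightarrow> a * 2 ^ t + b < length adj \<and>
       tab (a * 2 ^ t + b) = xor a b + 2 ^ t * rep (pl (2 ^ t + f)) (pl a * pl b)"
begin

definition n :: nat where "n = length adj"
definition m :: nat where "m = num_edges adj"
definition off :: "nat \<Rightarrow> nat" where "off v = n + 4 + out_offset adj v"

lemma W_nm: "W = int n + int m + 4"
  by (simp add: W n_def m_def)

definition gregs :: "regs \<Rightarrow> bool" where
  "gregs R \<longleftrightarrow> fregs R \<and> R 3 = int n \<and> R 4 = int m \<and> R 5 = int k \<and> R 10 = int beta"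

definition graph_ok :: "nat \<Rightarrow> mem \<Rightarrow> bool" where
  "graph_ok c M \<longleftrightarrow>
    (\<forall>v\<le>n. M (3 + int v) = (if v < k \<and> bit c v then - int (off v) else int (off v))) \<and>
    (\<forall>e<m. M (int n + 4 + int e) = int (concat adj ! e))"

definition cells_ok :: "(nat \<Rightarrow> bit poly) \<Rightarrow> mem \<Rightarrow> bool" where
  "cells_ok p M \<longleftrightarrow> (\<forall>v<n. M (-1 - int v) = int (E (p v) + q * tab v))"

lemma gregs_frame: "\<forall>r<b. R' r = R r \<Longrightarrow> b \<ge> 11 \<Longrightarrow> gregs R \<Longrightarrow> gregs R'"
  by (simp add: gregs_def fregs_def)

lemma gregsD:
  assumes "gregs R"
  shows "R 0 = 0" "R 2 = 1" "R 3 = int n" "R 4 = int m" "R 5 = int k" "R 6 = int q" "R 10 = int beta"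
  using assms by (simp_all add: gregs_def fregs_def)

lemma cell_W: "v < n \<Longrightarrow> x < q \<Longrightarrow> int (x + q * tab v) \<le> W"
  using tab_W by (simp only: n_def q_def)

lemma table_ok_cells:
  assumes "cells_ok p M"
  shows "table_ok M"
  unfolding table_ok_def
proof (intro impI allI)
  fix a b assume tbl and ab: "a < q" "b < q"
  note eq = tab_eq[OF \<open>tbl\<close> ab[unfolded q_def], folded q_def F_def n_def]
  then have "M (-1 - int (a * q + b)) = int (E (p (a * q + b)) + q * tab (a * q + b))"
    using assms by (simp only: cells_ok_def)
  then have c: "M (-1 - (int a * int q + int b)) = int (E (p (a * q + b)) + q * tab (a * q + b))"
    by simp
  have "M (-1 - (int a * int q + int b)) div int q = int (xor a b + q * E (pl a * pl b))"
    unfolding c unpack(2)[OF E_less] using eq by (simp only:)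
  moreover have "\<bar>M (-1 - (int a * int q + int b))\<bar> \<le> W"
    unfolding c using cell_W[of "a * q + b" "E (p (a * q + b))"] eq by simp
  ultimately show "M (-1 - (int a * int q + int b)) div int q = int (xor a b + q * E (pl a * pl b)) \<and>
      \<bar>M (-1 - (int a * int q + int b))\<bar> \<le> W" ..
qed

lemma off_le: "v \<le> n \<Longrightarrow> off v \<le> n + m + 4"
  using out_offset_le[of v adj] by (simp add: off_def n_def m_def)

lemma graph_abs:
  assumes "graph_ok c M" "v \<le> n"
  shows "\<bar>M (3 + int v)\<bar> = int (off v)" "int (off v) \<le> W" "M (3 + int v) < 0 \<longleftrightarrow> v < k \<and> bit c v"
proof -
  show "\<bar>M (3 + int v)\<bar> = int (off v)" "M (3 + int v) < 0 \<longleftrightarrow> v < k \<and> bit c v"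
    using assms by (auto simp: graph_ok_def off_def)
  show "int (off v) \<le> W" using off_le[OF assms(2)] by (simp add: W_nm)
qed

lemma graph_abs_Suc:
  assumes "graph_ok c M" "v < n"
  shows "\<bar>M (4 + int v)\<bar> = int (off (Suc v))"
  using graph_abs(1)[OF assms(1), of "Suc v"] assms(2) by simp

lemma wp_label_prog:
  assumes R: "gregs R" and G: "graph_ok c M" and u: "R 50 = int u" "u < n"
  shows "wp W label_prog R M (\<lambda>s R' M'. s \<le> 20 \<and> M' = M \<and> (\<forall>r<52. R' r = R r) \<and> R' 52 = int (label adj u))"
proof -
  note Rv = gregsD[OF R]
  have un: "u < length adj" using u by (simp add: n_def)
  have o: "off (Suc u) = off u + length (adj ! u)"
    using un by (simp add: off_def out_offset_Suc)
  have b: "4 \<le> W" "int n \<le> W" "int m \<le> W" "3 + int u \<le> W" "4 + int u \<le> W" "int u \<le> W"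
    using u by (simp_all add: W_nm)
  have ou: "out_offset adj u \<le> m" using out_offset_le[of u adj] un by (simp add: m_def)
  have oW: "int (off u) - 4 \<le> W" "4 \<le> int (off u)" "int n + 4 + int (out_offset adj u) = int (off u)"
    using graph_abs(2)[OF G, of u] u(2) by (simp_all add: off_def)
  show ?thesis
  proof (cases "m < n")
    case False
    then show ?thesis using b by (simp add: label_prog_def Rv u label_def n_def m_def)
  next
    case True
    then show ?thesis
      using b oW graph_abs(1,2)[OF G, of u] graph_abs_Suc[OF G u(2)] graph_abs(2)[OF G, of "Suc u"] u(2) ou
      by (auto simp: label_prog_def wp_load_abs Rv u(1) label_def n_def[symmetric] m_def[symmetric] o W_nm)
  qed
qed

lemma E_pl: "a < q \<Longrightarrow> E (pl a) = a"
  using rep_pl by (simp add: q_def)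

lemma beta_q: "beta < q" using beta by (simp add: q_def)

lemma wp_hash_prog:
  assumes R: "gregs R" and T: "table_ok M" and x: "R 52 = int x" "int x \<le> W" "x < q ^ 8"
  shows "wp W hash_prog R M (\<lambda>s R' M'. s \<le> 8 * (3 * opT + 20) + 4 \<and> M' = M \<and> (\<forall>r<52. R' r = R r)
    \<and> R' 53 = int (E (hash q beta x)))"
proof -
  \<comment> \<open>Digits are consumed from the lowest one: A collects the terms of those already
    read, B is the current power of the seed, and y is the part of x still unread.\<close>
  let ?J = "\<lambda>R' M'. M' = M \<and> (\<forall>r<52. R' r = R r) \<and> (\<exists>y A B. y \<le> x \<and> R' 52 = int y \<and> R' 53 = int (E A) \<and>
    R' 54 = int (E B) \<and> A + B * hash q beta y = hash q beta x)"
  let ?v = "\<lambda>R' M'. ndigits q (nat (R' 52))"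
  have step: "wp W hash_step R' M' (\<lambda>s R'' M''. s \<le> 3 * opT + 18 \<and> ?J R'' M'' \<and> ?v R'' M'' < ?v R' M')"
    if J: "?J R' M'" and lt: "R' 0 < R' 52" for R' M'
  proof -
    obtain y A B where yAB: "y \<le> x" "R' 52 = int y" "R' 53 = int (E A)" "R' 54 = int (E B)"
      "A + B * hash q beta y = hash q beta x" using J by blast
    have fr: "\<forall>r<52. R' r = R r" and M': "M' = M" using J by blast+
    have R': "gregs R'" using gregs_frame[OF fr _ R] by simp
    note Rv = gregsD[OF R']
    have y0: "0 < y" using lt Rv yAB(2) by simp
    define d where "d = pl (y mod q)"
    have d: "int y mod int q = int (E d)"
      by (simp add: d_def E_pl zmod_int)
    have dv: "int y div int q = int (y div q)" by (simp add: zdiv_int)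
    have yW: "int y \<le> W" "int (y div q) \<le> W"
      using yAB(1) x(2) div_le_dividend[of y q] by linarith+
    have bet: "int beta = int (E (pl beta))" by (simp add: E_pl beta_q)
    have eq: "(A + B * d) + (B * pl beta) * hash q beta (y div q) = hash q beta x"
      using yAB(5) hash_rec[OF y0 q_gt1, of beta] by (simp add: d_def algebra_simps)
    have dec: "ndigits q (y div q) < ndigits q y"
      using y0 q_gt1 by (subst (2) ndigits.simps) simp
    show ?thesis
      unfolding hash_step_def
      apply (simp add: Rv yAB d)
      apply (rule wp_mono[OF wp_mul_op[where p = d and r = B]])
      using R' T apply (simp_all add: M' gregs_def fregs_def)[4]
      apply (simp add: Rv yAB d)
      apply (rule wp_mono[OF wp_xor_op[where p = A and r = "d * B"]])
      using R' T apply (simp_all add: M' gregs_def fregs_def)[4]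
      apply (simp add: Rv yAB d less_q_W[OF beta_q])
      apply (rule wp_mono[OF wp_mul_op[where p = B and r = "pl beta"]])
      using R' T apply (simp_all add: M' gregs_def fregs_def bet)[4]
      apply (clarsimp simp: Rv yAB dv yW fr dec M')
      apply (rule conjI)
       apply (rule order_trans[OF div_le_dividend yAB(1)])
      apply (rule exI[of _ "A + d * B"], simp, rule exI[of _ "B * pl beta"])
      using eq apply (simp add: mult.commute)
      done
  qed
  have nd: "ndigits q x \<le> 8" using ndigits_le[OF q_gt1 x(3)] .
  note Rv = gregsD[OF R]
  show ?thesis
    unfolding hash_prog_def
    apply (simp add: Rv W2)
    apply (rule wp_mono)
     apply (rule wp_While_variant[where J = ?J and v = ?v and B = "3 * opT + 18" and n = 8])
       apply (rule step, assumption+)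
      apply (simp add: x(1))
      apply (rule exI[of _ 0], simp, rule exI[of _ 1], simp)
     apply (simp add: x nd)
    apply (auto simp: hash_0 gregsD[OF R])
    done
qed

definition subset_of :: "nat \<Rightarrow> nat set" where
  "subset_of c = {j. j < k \<and> bit c j}"

lemma wp_weight_prog:
  assumes R: "gregs R" and T: "table_ok M" and G: "graph_ok c M" and a: "R 53 = int (E a)"
  shows "wp W weight_prog R M (\<lambda>s R' M'. s \<le> k * (2 * opT + 22) + 5 \<and> M' = M \<and> (\<forall>r<51. R' r = R r)
    \<and> R' 51 = int (E (vweight (subset_of c) a)))"
proof -
  let ?v = "\<lambda>i. \<Sum>j | j < i \<and> bit c j. a ^ j"
  let ?I = "\<lambda>i R' M'. M' = M \<and> (\<forall>r<51. R' r = R r) \<and> R' 53 = int (E a) \<and> R' 55 = int i \<and>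
     R' 54 = int (E (a ^ i)) \<and> R' 51 = int (E (?v i))"
  have step: "R' 55 < R' 5 \<and> wp W weight_step R' M' (\<lambda>s R'' M''. s \<le> 2 * opT + 20 \<and> ?I (Suc i) R'' M'')"
    if I: "?I i R' M'" and i: "i < k" for i R' M'
  proof -
    have fr: "\<forall>r<51. R' r = R r" and M': "M' = M" using I by blast+
    have R': "gregs R'" using gregs_frame[OF fr _ R] by simp
    note Rv = gregsD[OF R']
    have iv: "R' 53 = int (E a)" "R' 55 = int i" "R' 54 = int (E (a ^ i))" "R' 51 = int (E (?v i))"
      using I by blast+
    have i_n: "i \<le> n" using i kn by (simp add: n_def)
    have b: "3 \<le> W" "3 + int i \<le> W" "int i + 1 \<le> W" "1 + int i \<le> W" using i_n by (simp_all add: W_nm)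
    have Mi: "\<bar>M (3 + int i)\<bar> \<le> W" "M (3 + int i) < 0 \<longleftrightarrow> bit c i"
      using graph_abs[OF G i_n] i by simp_all
    have v: "?v (Suc i) = (if bit c i then ?v i + a ^ i else ?v i)"
    proof -
      have "{j. j < Suc i \<and> bit c j} = (if bit c i then insert i {j. j < i \<and> bit c j} else {j. j < i \<and> bit c j})"
        by (auto simp: less_Suc_eq)
      then show ?thesis by (simp add: add.commute)
    qed
    have add: "wp W add_power Q M (\<lambda>s R'' M''. s \<le> opT + 6 \<and> M'' = M \<and> (\<forall>r<51. R'' r = Q r) \<and>
        (\<forall>r\<in>{53, 54, 55}. R'' r = Q r) \<and> R'' 51 = int (E (?v (Suc i))))"
      if Q: "gregs Q" "Q 51 = int (E (?v i))" "Q 54 = int (E (a ^ i))" "Q 57 < 0 \<longleftrightarrow> bit c i" for Q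
    proof (cases "bit c i")
      case True
      then have v': "?v (Suc i) = ?v i + a ^ i" using v by simp
      have q57: "Q 57 < 0" using Q(4) True by simp
      show ?thesis
        apply (simp add: add_power_def gregsD[OF Q(1)] Q(2,3) q57)
        apply (rule wp_mono[OF wp_xor_op[where p = "?v i" and r = "a ^ i"]])
        using Q T by (simp_all add: gregs_def fregs_def v')
    next
      case False
      then show ?thesis using v Q W2 by (simp add: add_power_def gregsD[OF Q(1)])
    qed
    show ?thesis
      unfolding weight_step_def
      apply (simp only: wp_Seq wp_Ins)
      apply (simp add: Rv iv b Mi M' i)
      apply (rule wp_mono[OF add])
      using R' iv Mi apply (simp_all add: gregs_def fregs_def)[4]
      apply (simp add: Rv iv)
      apply (rule wp_mono[OF wp_mul_op[where p = "a ^ i" and r = a]])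
      using R' T apply (simp_all add: gregs_def fregs_def)[4]
      using fr by (simp add: gregsD[OF R] b mult.commute)
  qed
  have e: "{j. j < (0::nat) \<and> P j} = {}" for P by auto
  note Rv = gregsD[OF R]
  show ?thesis
    unfolding weight_prog_def
    apply (simp add: Rv W2)
    apply (rule wp_mono)
     apply (rule wp_While_count[where n = k and B = "2 * opT + 20" and I = ?I])
       apply (rule step, assumption+)
      apply (simp add: Rv)
     apply (simp add: a)
    apply (simp add: vweight_def subset_of_def algebra_simps)
    done
qed

definition vertex_weight :: "nat \<Rightarrow> nat \<Rightarrow> bit poly" where
  "vertex_weight c u = vweight (subset_of c) (hash q beta (label adj u))"

definition weightT :: nat where
  "weightT = 8 * (3 * opT + 20) + k * (2 * opT + 22) + 40"

lemma wp_vertex_weight: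
  assumes R: "gregs R" and T: "table_ok M" and G: "graph_ok c M" and u: "R 50 = int u" "u < n"
  shows "wp W vertex_weight_prog R M (\<lambda>s R' M'. s \<le> weightT \<and> M' = M \<and> (\<forall>r<51. R' r = R r)
    \<and> R' 51 = int (E (vertex_weight c u)))"
proof -
  have lab: "label adj u < q ^ 8" "int (label adj u) \<le> W"
    using label_q8[of u] label_less[of u adj] u(2) by (auto simp: n_def q_def W split: if_splits)
  show ?thesis
    unfolding vertex_weight_prog_def
    apply (simp only: wp_Seq)
    apply (rule wp_mono[OF wp_label_prog[OF R G u]])
    apply clarify
    apply (rule wp_mono[OF wp_hash_prog[OF _ T _ lab(2,1)]])
      apply (erule gregs_frame, simp, rule R)
     apply assumption
    apply clarify
    apply (rule wp_mono[OF wp_weight_prog[OF _ T G]])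
      apply (rule gregs_frame[OF _ _ R, where b = 52])
       apply simp
      apply simp
     apply assumption
    apply (simp add: vertex_weight_def weightT_def)
    done
qed

end

section \<open>Summing over walks\<close>

text \<open>Only the remainder modulo q is overwritten; the table entry packed above it
  survives.\<close>

definition set_cells :: com where
  "set_cells =
    Ins (Const 32 0) ;;
    WhileLt 32 3 (
      Ins (Const 33 (-1)) ;; Ins (Sub 33 33 32) ;; Ins (Load 34 33) ;; Ins (Mod 35 34 6) ;;
      Ins (Sub 34 34 35) ;; Ins (Add 34 34 31) ;; Ins (Store 33 34) ;; Ins (Add 32 32 2))"

text \<open>The product for u is saved at address 3 - off u, which is -n - 1 -
  \<open>out_offset adj u\<close>. Indexing by offset rather than by vertex keeps this address a
  word even if m is much smaller than n.\<close>

definition push_step :: com where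
  "push_step =
    Ins (Add 50 32 0) ;; vertex_weight_prog ;;
    Ins (Const 33 (-1)) ;; Ins (Sub 33 33 32) ;; Ins (Load 34 33) ;; Ins (Mod 61 34 6) ;;
    Ins (Add 60 51 0) ;; mul_op ;;
    Ins (Const 33 3) ;; Ins (Add 35 33 32) ;; load_abs 34 35 ;; Ins (Sub 33 33 34) ;;
    Ins (Store 33 62) ;; Ins (Add 32 32 2)"

definition push :: com where
  "push =
    Ins (Const 32 0) ;;
    WhileLt 32 3 push_step"

definition scatter_step :: com where
  "scatter_step =
    Ins (Load 38 35) ;; Ins (Const 39 (-1)) ;; Ins (Sub 39 39 38) ;; Ins (Load 40 39) ;;
    Ins (Mod 80 40 6) ;; Ins (Load 81 37) ;; Ins (Sub 40 40 80) ;; xor_op ;;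
    Ins (Add 40 40 82) ;; Ins (Store 39 40) ;; Ins (Add 35 35 2)"

definition scatter_vertex :: com where
  "scatter_vertex =
    WhileLt 35 36 scatter_step"

definition scatter_row :: com where
  "scatter_row =
    Ins (Const 33 3) ;; Ins (Add 34 33 32) ;; load_abs 35 34 ;; Ins (Add 34 34 2) ;; load_abs 36 34 ;;
    Ins (Sub 37 33 35) ;; scatter_vertex ;; Ins (Add 32 32 2)"

definition scatter :: com where
  "scatter =
    Ins (Const 32 0) ;;
    WhileLt 32 3 scatter_row"

definition sum_step :: com where
  "sum_step =
    Ins (Add 50 32 0) ;; vertex_weight_prog ;;
    Ins (Const 33 (-1)) ;; Ins (Sub 33 33 32) ;; Ins (Load 34 33) ;; Ins (Mod 61 34 6) ;;
    Ins (Add 60 51 0) ;; mul_op ;;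
    Ins (Add 80 41 0) ;; Ins (Add 81 62 0) ;; xor_op ;; Ins (Add 41 82 0) ;; Ins (Add 32 32 2)"

definition sum_cells :: com where
  "sum_cells =
    Ins (Const 41 0) ;; Ins (Const 32 0) ;;
    WhileLt 32 3 sum_step"

definition round_prog :: com where
  "round_prog =
    push ;; Ins (Const 31 0) ;; set_cells ;; scatter ;; Ins (Add 30 30 2)"

definition eval_prog :: com where
  "eval_prog =
    Ins (Add 31 2 0) ;; set_cells ;; Ins (Const 30 1) ;;
    WhileLt 30 5 round_prog ;;
    sum_cells"

text \<open>Increment of a binary counter whose bits are the signs of the first k offsets: negative
  entries are made positive while the carry travels, and the first positive one absorbs it. Register
  14 remains 0 exactly on overflow.\<close>

definition next_subset :: com where
  "next_subset =
    Ins (Const 14 0) ;; Ins (Const 30 0) ;;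
    WhileLt 30 5 (
      Ins (Const 31 3) ;; Ins (Add 31 31 30) ;; Ins (Load 32 31) ;; Ins (Sub 33 0 32) ;; Ins (Store 31 33) ;;
      IfLt 32 0 (Ins (Add 30 30 2)) (Ins (Const 14 1) ;; Ins (Add 30 5 0)))"

section \<open>Correctness of the sweeps over the graph\<close>

context run_machine
begin

definition curs_ok :: "(nat \<Rightarrow> bit poly) \<Rightarrow> nat \<Rightarrow> mem \<Rightarrow> bool" where
  "curs_ok cu i M \<longleftrightarrow> (\<forall>v<i. v < n \<longrightarrow> adj ! v \<noteq> [] \<longrightarrow> M (3 - int (off v)) = int (E (cu v)))"

lemma off_ge: "n + 4 \<le> off v"
  by (simp add: off_def)

lemma graph_ok_cong: "graph_ok c M \<Longrightarrow> (\<And>a. a \<ge> 0 \<Longrightarrow> M' a = M a) \<Longrightarrow> graph_ok c M'"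
  by (auto simp: graph_ok_def)

lemma cells_ok_cong: "cells_ok p M \<Longrightarrow> (\<And>a. a < 0 \<Longrightarrow> - int n \<le> a \<Longrightarrow> M' a = M a) \<Longrightarrow> cells_ok p M'"
  by (auto simp: cells_ok_def)

lemma curs_ok_cong: "curs_ok cu i M \<Longrightarrow> (\<And>a. a < - int n \<Longrightarrow> M' a = M a) \<Longrightarrow> curs_ok cu i M'"
  unfolding curs_ok_def using off_ge by (auto simp: off_def)

lemma graph_ok_upd [simp]: "a < 0 \<Longrightarrow> graph_ok c (M(a := x)) \<longleftrightarrow> graph_ok c M"
  by (auto simp: graph_ok_def)

lemma cells_ok_upd: "cells_ok p M \<Longrightarrow> x = int (E r) + int q * int (tab v) \<Longrightarrow> cells_ok (p(v := r)) (M(-1 - int v := x))"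
  by (auto simp: cells_ok_def)

lemma E_mod [simp]: "int (E p) mod int q = int (E p)"
  by (metis E_less mod_less zmod_int)

lemma cellD:
  assumes "cells_ok p M" "v < n"
  shows "M (-1 - int v) = int (E (p v)) + int q * int (tab v)" "int (E r) + int q * int (tab v) \<le> W"
    "int q * int (tab v) \<le> W" "0 \<le> int q * int (tab v)" "1 + int v \<le> W" "int v + 1 \<le> W"
proof -
  show "M (-1 - int v) = int (E (p v)) + int q * int (tab v)"
    using assms by (simp add: cells_ok_def)
  show 1: "int (E r) + int q * int (tab v) \<le> W" for r
    using cell_W[OF assms(2) E_less, of r] by simp
  show "int q * int (tab v) \<le> W" using 1[of r] by linarith
  show "0 \<le> int q * int (tab v)" by simp
  show "1 + int v \<le> W" "int v + 1 \<le> W" using assms(2) by (simp_all add: W_nm)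
qed

lemma wp_set_cells:
  assumes R: "gregs R" and C: "cells_ok p M" and r: "R 31 = int (E r)"
  shows "wp W set_cells R M (\<lambda>s R' M'. s \<le> n * 10 + 3 \<and> (\<forall>r<32. R' r = R r) \<and> cells_ok (\<lambda>_. r) M' \<and>
    (\<forall>a. 0 \<le> a \<or> a < - int n \<longrightarrow> M' a = M a))"
proof -
  let ?I = "\<lambda>i R' M'. (\<forall>r<32. R' r = R r) \<and> R' 32 = int i \<and> cells_ok (\<lambda>v. if v < i then r else p v) M' \<and>
    (\<forall>a. 0 \<le> a \<or> a < - int n \<longrightarrow> M' a = M a)"
  note Rv = gregsD[OF R]
  have 0: "cells_ok (\<lambda>v. if v < n then r else p v) M' \<Longrightarrow> cells_ok (\<lambda>_. r) M'" for M'
    by (simp add: cells_ok_def)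
  have step: "R' 32 < R' 3 \<and> wp W (Ins (Const 33 (-1)) ;; Ins (Sub 33 33 32) ;; Ins (Load 34 33) ;; Ins (Mod 35 34 6) ;;
      Ins (Sub 34 34 35) ;; Ins (Add 34 34 31) ;; Ins (Store 33 34) ;; Ins (Add 32 32 2)) R' M'
      (\<lambda>s R'' M''. s \<le> 8 \<and> ?I (Suc i) R'' M'')" if I: "?I i R' M'" and i: "i < n" for i R' M'
  proof -
    have C': "cells_ok (\<lambda>v. if v < i then r else p v) M'" using I by blast
    have "cells_ok ((\<lambda>v. if v < i then r else p v)(i := r)) (M'(-1 - int i := int (E r) + int q * int (tab i)))"
      using C' by (rule cells_ok_upd) simp
    moreover have "(\<lambda>v. if v < i then r else p v)(i := r) = (\<lambda>v. if v < Suc i then r else p v)"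
      by (auto simp: less_Suc_eq)
    ultimately have C'': "cells_ok (\<lambda>v. if v < Suc i then r else p v) (M'(-1 - int i := int (E r) + int q * int (tab i)))"
      by simp
    show ?thesis
      using I i C'' cellD[OF C' i] W2
      by (simp add: Rv r cellD(2)[OF C' i] add.commute[of "int q * _"])
  qed
  show ?thesis
    unfolding set_cells_def
    apply (simp add: W2)
    apply (rule wp_mono)
     apply (rule wp_While_count[where n = n and B = 8 and I = ?I])
       apply (rule step, assumption+)
      apply (simp add: Rv)
     apply (simp add: C)
    using 0 apply simp
    done
qed

(* A vertex without out-edges shares its cell 3 - off u with the next vertex, which overwrites it. *)
lemma curs_ok_upd:
  assumes "curs_ok cu i M" "i < n"
  shows "curs_ok cu (Suc i) (M(3 - int (off i) := int (E (cu i))))"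
proof -
  have "off v \<noteq> off i" if "v < i" "adj ! v \<noteq> []" for v
    using out_offset_less[of v i adj] that assms(2) by (fastforce simp: off_def n_def)
  then show ?thesis using assms by (auto simp: curs_ok_def less_Suc_eq)
qed

lemma cells_ok_upd_low: "a < - int n \<Longrightarrow> cells_ok p (M(a := x)) \<longleftrightarrow> cells_ok p M"
  by (auto simp: cells_ok_def)

lemma wp_push:
  assumes R: "gregs R" and C: "cells_ok p M" and G: "graph_ok c M"
  shows "wp W push R M (\<lambda>s R' M'. s \<le> n * (weightT + opT + 25) + 3 \<and> (\<forall>r<32. R' r = R r) \<and>
    cells_ok p M' \<and> graph_ok c M' \<and> curs_ok (\<lambda>u. vertex_weight c u * p u) n M')"
proof -
  let ?I = "\<lambda>i R' M'. (\<forall>r<32. R' r = R r) \<and> R' 32 = int i \<and>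
    cells_ok p M' \<and> graph_ok c M' \<and> curs_ok (\<lambda>u. vertex_weight c u * p u) i M'"
  note Rv = gregsD[OF R]
  have step: "R' 32 < R' 3 \<and> wp W push_step R' M'
      (\<lambda>s R'' M''. s \<le> weightT + opT + 20 \<and> ?I (Suc i) R'' M'')" if I: "?I i R' M'" and i: "i < n" for i R' M'
  proof -
    have C': "cells_ok p M'" and G': "graph_ok c M'" and cu: "curs_ok (\<lambda>u. vertex_weight c u * p u) i M'"
      and fr: "\<forall>r<32. R' r = R r" and R32: "R' 32 = int i" using I by blast+
    have R': "gregs R'" using gregs_frame[OF fr _ R] by simp
    note cd = cellD[OF C' i]
    note ga = graph_abs[OF G' less_imp_le[OF i]]
    have low: "3 - int (off i) < - int n" "3 < int (off i)" "3 < off i" using off_ge[of i] by simp_all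
    have b: "3 \<le> W" "3 + int i \<le> W" "int i \<le> W" "\<bar>3 - int (off i)\<bar> \<le> W"
      using i ga(2) off_ge[of i] by (simp_all add: W_nm)
    show ?thesis
      unfolding push_step_def
      apply (simp add: Rv R32 i fr b)
      apply (rule wp_mono[OF wp_vertex_weight[OF _ table_ok_cells[OF C'] G', where u = i]])
         apply (simp add: gregs_def fregs_def, insert R', simp add: gregs_def fregs_def)
        apply (simp add: i)
       apply (simp add: i)
      apply (simp add: fr Rv R32 cd W2 b)
      apply (rule wp_mono[OF wp_mul_op[OF _ table_ok_cells[OF C'], where p = "vertex_weight c i" and r = "p i"]])
        apply (simp_all add: gregs_def fregs_def)[3]
      apply (simp add: fr Rv R32 b wp_load_abs ga)
      apply (simp add: low cells_ok_upd_low C' G' curs_ok_upd[OF cu i, simplified] cd)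
      done
  qed
  show ?thesis
    unfolding push_def
    apply (simp add: W2)
    apply (rule wp_mono)
     apply (rule wp_While_count[where n = n and B = "weightT + opT + 20" and I = ?I])
       apply (rule step, assumption+)
      apply (simp add: Rv)
     apply (simp add: C G curs_ok_def)
    apply (simp add: algebra_simps)
    done
qed

lemma concat_nth_offset:
  assumes "u < length adj" "j < length (adj ! u)"
  shows "concat adj ! (out_offset adj u + j) = adj ! u ! j" "out_offset adj u + j < num_edges adj"
proof -
  have "concat adj = concat (take u adj) @ adj ! u @ concat (drop (Suc u) adj)"
    by (subst id_take_nth_drop[OF assms(1)]) simp
  moreover have "length (concat (take u adj)) = out_offset adj u"
    by (simp add: length_concat out_offset_def)
  ultimately show "concat adj ! (out_offset adj u + j) = adj ! u ! j"
    using assms(2) by (simp add: nth_append)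
  show "out_offset adj u + j < num_edges adj"
    using out_offset_Suc[OF assms(1)] out_offset_le[of "Suc u" adj] assms by simp
qed

lemma wp_scatter_vertex:
  assumes R: "gregs R" and C: "cells_ok p M" and G: "graph_ok c M" and u: "u < n"
    and cu: "adj ! u \<noteq> [] \<Longrightarrow> M (3 - int (off u)) = int (E y)"
    and regs: "R 35 = int (off u)" "R 36 = int (off (Suc u))" "R 37 = 3 - int (off u)"
  shows "wp W scatter_vertex R M (\<lambda>s R' M'. s \<le> length (adj ! u) * (opT + 14) + 2 \<and> (\<forall>r<35. R' r = R r) \<and>
    cells_ok (\<lambda>v. if is_edge adj u v then p v + y else p v) M' \<and> (\<forall>a. 0 \<le> a \<or> a < - int n \<longrightarrow> M' a = M a))"
proof -
  have un: "u < length adj" using u by (simp add: n_def)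
  let ?p = "\<lambda>j v. if v \<in> set (take j (adj ! u)) then p v + y else p v"
  let ?I = "\<lambda>j R' M'. (\<forall>r<35. R' r = R r) \<and> R' 35 = int (off u + j) \<and> R' 36 = R 36 \<and> R' 37 = R 37 \<and>
    cells_ok (?p j) M' \<and> (\<forall>a. 0 \<le> a \<or> a < - int n \<longrightarrow> M' a = M a)"
  have o: "off (Suc u) = off u + length (adj ! u)"
    using un by (simp add: off_def out_offset_Suc)
  have step: "R' 35 < R' 36 \<and> wp W scatter_step R' M' (\<lambda>s R'' M''. s \<le> opT + 12 \<and> ?I (Suc j) R'' M'')"
    if I: "?I j R' M'" and j: "j < length (adj ! u)" for j R' M'
  proof -
    define v where "v = adj ! u ! j"
    have C': "cells_ok (?p j) M'" and fr: "\<forall>r<35. R' r = R r" and M': "\<forall>a. 0 \<le> a \<or> a < - int n \<longrightarrow> M' a = M a"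
      and r': "R' 35 = int (off u) + int j" "R' 36 = int (off (Suc u))" "R' 37 = 3 - int (off u)"
      using I regs by simp_all
    have R': "gregs R'" using gregs_frame[OF fr _ R] by simp
    note Rv = gregsD[OF R']
    have vset: "v \<in> set (adj ! u)" using j by (simp add: v_def)
    have vn: "v < n" using valid un vset by (auto simp: valid_digraph_def n_def)
    \<comment> \<open>Adjacency lists have no repetitions, so each edge adds its value once, as in
      the sum over all u with \<open>is_edge adj u v\<close>.\<close>
    have vnew: "v \<notin> set (take j (adj ! u))"
    proof -
      have "distinct (adj ! u)" using valid un by (simp add: valid_digraph_def)
      then show ?thesis using j by (auto simp: v_def in_set_conv_nth nth_eq_iff_index_eq)
    qed
    have Mv: "M' (int (off u) + int j) = int v"
    proof -
      have "M (int n + 4 + int (out_offset adj u + j)) = int (concat adj ! (out_offset adj u + j))"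
        using G concat_nth_offset(2)[OF un j] by (simp only: graph_ok_def m_def)
      then have "M (int (off u) + int j) = int v"
        using concat_nth_offset(1)[OF un j] by (simp add: off_def v_def add.assoc)
      then show ?thesis using M' by simp
    qed
    have Mc: "M' (3 - int (off u)) = int (E y)"
    proof -
      have "3 - int (off u) < - int n" using off_ge[of u] by simp
      moreover have "adj ! u \<noteq> []" using j by auto
      ultimately show ?thesis using cu M' by simp
    qed
    note cd = cellD[OF C' vn]
    have pv: "?p j v = p v" using vnew by simp
    have cd1: "M' (-1 - int v) = int (E (p v)) + int q * int (tab v)" using cd(1) pv by simp
    have C'': "cells_ok (?p (Suc j)) (M'(-1 - int v := int (E (p v + y)) + int q * int (tab v)))"
    proof -
      have "(?p j)(v := p v + y) = ?p (Suc j)"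
        using j by (auto simp: take_Suc_conv_app_nth v_def[symmetric])
      then show ?thesis using cells_ok_upd[OF C' refl, of v "p v + y"] by simp
    qed
    have b: "int v \<le> W" "int (off u) + int j + 1 \<le> W" "int (off u) + (1 + int j) \<le> W" "int (off u) + int j < int (off (Suc u))"
      using vn graph_abs(2)[OF G, of "Suc u"] u j by (simp_all add: W_nm o)
    show ?thesis
      unfolding scatter_step_def
      apply (simp add: Rv r' b Mv W2 cd(2-) cd1 Mc)
      apply (rule wp_mono[OF wp_xor_op[OF _ table_ok_cells[OF C'], where p = "p v" and r = y]])
        using R' apply (simp_all add: gregs_def fregs_def)[3]
      apply (simp add: Rv r' b fr cd(2) add.commute[of "int q * _"])
      using C'' M' vn regs b apply (simp add: gregsD[OF R] o)
      done
  qed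
  have fin: "cells_ok (?p (length (adj ! u))) M' \<Longrightarrow> cells_ok (\<lambda>v. if is_edge adj u v then p v + y else p v) M'" for M'
    using un by (simp add: is_edge_def)
  show ?thesis
    unfolding scatter_vertex_def
    apply (rule wp_mono)
     apply (rule wp_While_count[where n = "length (adj ! u)" and B = "opT + 12" and I = ?I])
       apply (rule step, assumption+)
      apply (simp add: regs o)
     apply (simp add: C regs)
    using fin apply (simp add: algebra_simps)
    done
qed

lemma wp_scatter:
  assumes R: "gregs R" and C: "cells_ok (\<lambda>_. 0) M" and G: "graph_ok c M" and cu: "curs_ok cu n M"
  shows "wp W scatter R M (\<lambda>s R' M'. s \<le> m * (opT + 14) + n * 22 + 3 \<and> (\<forall>r<32. R' r = R r) \<and>
    cells_ok (\<lambda>v. \<Sum>u | u < n \<and> is_edge adj u v. cu u) M' \<and> graph_ok c M')"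
proof -
  let ?p = "\<lambda>i v. \<Sum>u | u < i \<and> is_edge adj u v. cu u"
  let ?I = "\<lambda>i R' M'. (\<forall>r<32. R' r = R r) \<and> R' 32 = int i \<and> cells_ok (?p i) M' \<and> graph_ok c M' \<and> curs_ok cu n M'"
  note Rv = gregsD[OF R]
  have step: "R' 32 < R' 3 \<and> wp W scatter_row R' M'
      (\<lambda>s R'' M''. s \<le> length (adj ! i) * (opT + 14) + 20 \<and> ?I (Suc i) R'' M'')"
    if I: "?I i R' M'" and i: "i < n" for i R' M'
  proof -
    have C': "cells_ok (?p i) M'" and G': "graph_ok c M'" and cu': "curs_ok cu n M'"
      and fr: "\<forall>r<32. R' r = R r" and R32: "R' 32 = int i" using I by blast+
    have R': "gregs R'" using gregs_frame[OF fr _ R] by simp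
    have p: "(if is_edge adj i v then ?p i v + cu i else ?p i v) = ?p (Suc i) v" for v
    proof -
      have "{u. u < Suc i \<and> is_edge adj u v} =
          (if is_edge adj i v then insert i {u. u < i \<and> is_edge adj u v} else {u. u < i \<and> is_edge adj u v})"
        by (auto simp: less_Suc_eq)
      then show ?thesis by (simp add: add.commute)
    qed
    note ga = graph_abs[OF G' less_imp_le[OF i]] graph_abs_Suc[OF G' i] graph_abs(2)[OF G', of "Suc i"]
    have b: "3 \<le> W" "3 + int i \<le> W" "4 + int i \<le> W" "int i + 1 \<le> W" "\<bar>3 - int (off i)\<bar> \<le> W"
      using i ga(2) off_ge[of i] by (simp_all add: W_nm)
    show ?thesis
      unfolding scatter_row_def
      apply (simp add: Rv R32 i fr b wp_load_abs ga Suc_leI)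
      apply (rule wp_mono[OF wp_scatter_vertex[OF _ C' G' i, where y = "cu i"]])
           using R' apply (simp add: gregs_def fregs_def)
          using cu' i apply (simp add: curs_ok_def)
         apply simp
        apply simp
       apply simp
      apply (simp add: p fr R32 Rv b)
      using G' cu' graph_ok_cong[OF G'] curs_ok_cong[OF cu'] apply simp
      done
  qed
  have len: "(\<Sum>i<n. length (adj ! i)) = m"
  proof -
    have "(\<Sum>i<n. length (adj ! i)) = sum_list (map length adj)"
      by (simp add: sum_list_sum_nth n_def lessThan_atLeast0)
    then show ?thesis by (simp add: m_def num_edges_def)
  qed
  have time: "(\<Sum>i<n. length (adj ! i) * (opT + 14) + 20 + 2) = m * (opT + 14) + n * 22"
    by (simp add: sum.distrib sum_distrib_right[symmetric] len)
  show ?thesis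
    unfolding scatter_def
    apply (simp add: W2)
    apply (rule wp_mono)
     apply (rule wp_While_sum[where n = n and B = "\<lambda>i. length (adj ! i) * (opT + 14) + 20" and I = ?I])
       apply (rule step, assumption+)
      apply (simp add: Rv)
     apply (simp add: C G cu)
    unfolding time apply simp
    done
qed

lemma wp_sum_cells:
  assumes R: "gregs R" and C: "cells_ok p M" and G: "graph_ok c M"
  shows "wp W sum_cells R M (\<lambda>s R' M'. s \<le> n * (weightT + 2 * opT + 25) + 4 \<and> (\<forall>r<32. R' r = R r) \<and>
    R' 41 = int (E (\<Sum>v<n. vertex_weight c v * p v)) \<and> M' = M)"
proof -
  let ?I = "\<lambda>i R' M'. (\<forall>r<32. R' r = R r) \<and> R' 32 = int i \<and> R' 41 = int (E (\<Sum>v<i. vertex_weight c v * p v)) \<and> M' = M"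
  note Rv = gregsD[OF R]
  have step: "R' 32 < R' 3 \<and> wp W sum_step R' M'
      (\<lambda>s R'' M''. s \<le> weightT + 2 * opT + 20 \<and> ?I (Suc i) R'' M'')" if I: "?I i R' M'" and i: "i < n" for i R' M'
  proof -
    have M': "M' = M" and fr: "\<forall>r<32. R' r = R r" and R32: "R' 32 = int i"
      and R41: "R' 41 = int (E (\<Sum>v<i. vertex_weight c v * p v))" using I by blast+
    have R': "gregs R'" using gregs_frame[OF fr _ R] by simp
    note cd = cellD[OF C i]
    have b: "int i \<le> W" using i by (simp add: W_nm)
    show ?thesis
      unfolding sum_step_def
      apply (simp add: Rv R32 i fr b M')
      apply (rule wp_mono[OF wp_vertex_weight[OF _ table_ok_cells[OF C] G, where u = i]])
         apply (simp add: gregs_def fregs_def, insert R', simp add: gregs_def fregs_def)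
        apply (simp add: i)
       apply (simp add: i)
      apply (simp add: fr Rv R32 cd W2 b)
      apply (rule wp_mono[OF wp_mul_op[OF _ table_ok_cells[OF C], where p = "vertex_weight c i" and r = "p i"]])
        apply (simp_all add: gregs_def fregs_def)[3]
      apply (simp add: fr Rv R32 R41)
      apply (rule wp_mono[OF wp_xor_op[OF _ table_ok_cells[OF C], where p = "\<Sum>v<i. vertex_weight c v * p v" and r = "vertex_weight c i * p i"]])
        apply (simp_all add: gregs_def fregs_def)[3]
      apply (simp add: fr Rv R32 cd)
      done
  qed
  show ?thesis
    unfolding sum_cells_def
    apply (simp add: W2)
    apply (rule wp_mono)
     apply (rule wp_While_count[where n = n and B = "weightT + 2 * opT + 20" and I = ?I])
       apply (rule step, assumption+)
      apply (simp add: Rv)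
     apply simp
    apply (simp add: algebra_simps)
    done
qed

definition roundT :: nat where
  "roundT = (n + m + 1) * (weightT + 2 * opT + 100)"

lemma wp_eval_prog:
  assumes R: "gregs R" and C: "cells_ok p M" and G: "graph_ok c M"
  shows "wp W eval_prog R M (\<lambda>s R' M'. s \<le> k * roundT \<and> (\<forall>r<30. R' r = R r) \<and>
    R' 41 = int (E (walk_total adj k (subset_of c) (\<lambda>u. hash q beta (label adj u)))) \<and>
    graph_ok c M' \<and> (\<exists>p. cells_ok p M'))"
proof -
  let ?w = "walk_sum adj (vertex_weight c)"
  \<comment> \<open>After i rounds the cells hold the sums over walks with i vertices that stop just
    before the current one. Register 30 starts at 1, so there are k - 1 rounds, and
    \<open>sum_cells\<close> supplies the k-th vertex.\<close>
  let ?I = "\<lambda>i R' M'. (\<forall>r<30. R' r = R r) \<and> R' 30 = int i + 1 \<and> cells_ok (?w i) M' \<and> graph_ok c M'"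
  note Rv = gregsD[OF R]
  let ?B = "n * (weightT + opT + 25) + 3 + (n * 10 + 3) + (m * (opT + 14) + n * 22 + 3) + 2"
  have step: "R' 30 < R' 5 \<and> wp W round_prog R' M' (\<lambda>s R'' M''. s \<le> ?B \<and> ?I (Suc i) R'' M'')"
    if I: "?I i R' M'" and i: "i < k - 1" for i R' M'
  proof -
    have C': "cells_ok (?w i) M'" and G': "graph_ok c M'" and fr: "\<forall>r<30. R' r = R r" and R30: "R' 30 = int i + 1"
      using I by blast+
    have R': "gregs R'" using gregs_frame[OF fr _ R] by simp
    have b: "int i + 2 \<le> W" "int i + 1 < int k" using i kn by (simp_all add: W_nm n_def)
    have w: "(\<lambda>v. \<Sum>u | u < n \<and> is_edge adj u v. vertex_weight c u * ?w i u) = ?w (Suc i)"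
      by (simp add: n_def fun_eq_iff)
    show ?thesis
      unfolding round_prog_def
      apply (rule conjI)
       apply (simp add: fr Rv R30 b)
      apply (simp only: wp_Seq wp_Ins)
      apply (rule wp_mono[OF wp_push[OF R' C' G']])
      apply (elim conjE)
      apply (rule conjI)
       apply (simp add: W2)
      apply (rule wp_mono[OF wp_set_cells[where r = 0]])
         apply (rule gregs_frame[OF _ _ R', where b = 31]; simp)
        apply assumption
       apply simp
      apply (elim conjE)
      apply (rule wp_mono[OF wp_scatter[where cu = "\<lambda>u. vertex_weight c u * ?w i u" and c = c]])
          apply (rule gregs_frame[OF _ _ R', where b = 31]; simp)
         apply assumption
        apply (erule graph_ok_cong, simp)
       apply (erule curs_ok_cong, simp)
      apply (simp only: w)
      using b apply (simp add: R30 fr Rv)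
      done
  qed
  have w0: "?w 0 = (\<lambda>_. 1)" by (simp add: fun_eq_iff)
  have tot: "(\<Sum>v<n. vertex_weight c v * ?w (k - 1) v) = walk_total adj k (subset_of c) (\<lambda>u. hash q beta (label adj u))"
  proof -
    have "vertex_weight c = (\<lambda>u. vweight (subset_of c) (hash q beta (label adj u)))"
      by (simp add: vertex_weight_def fun_eq_iff)
    then show ?thesis by (simp only: walk_total_def n_def)
  qed
  have time: "t1 + (t2 + t3) + 4 \<le> k * roundT"
    if "t1 \<le> n * 10 + 3" "t2 \<le> (k - 1) * (?B + 2) + 2" "t3 \<le> n * (weightT + 2 * opT + 25) + 4" for t1 t2 t3
  proof -
    define w' where "w' = weightT"
    have w: "40 \<le> w'" by (simp add: weightT_def w'_def)
    have r: "roundT = n * (w' + 2 * opT + 100) + m * (w' + 2 * opT + 100) + (w' + 2 * opT + 100)"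
      by (simp add: roundT_def algebra_simps w'_def)
    have "?B + 2 \<le> roundT"
      unfolding r using mult_le_mono2[of "opT + 14" "w' + 2 * opT + 100" m] w
      by (simp add: algebra_simps w'_def)
    then have "(k - 1) * (?B + 2) \<le> (k - 1) * roundT" by (rule mult_le_mono2)
    \<comment> \<open>The time bound has k rounds instead of k - 1; the spare \<open>roundT\<close>
      pays for the initial \<open>set_cells\<close> and the final \<open>sum_cells\<close>.\<close>
    moreover have "t1 + t3 + 6 \<le> roundT"
      unfolding r using that by (simp add: algebra_simps w'_def)
    moreover have "k * roundT = (k - 1) * roundT + roundT"
      using k1 by (cases k) auto
    ultimately show ?thesis using that(2) by linarith
  qed
  show ?thesis
    unfolding eval_prog_def
    apply (simp only: wp_Seq wp_Ins Rv)
    apply (rule conjI)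
     apply (simp add: W2)
    apply (rule wp_mono[OF wp_set_cells[where r = 1 and p = p]])
       apply (rule gregs_frame[OF _ _ R, where b = 31]; simp)
      apply (rule C)
     apply simp
    apply (elim conjE)
    apply (rule conjI)
     apply (simp add: W2)
    apply (rule wp_mono)
     apply (rule wp_While_count[where n = "k - 1" and B = ?B and I = ?I])
       apply (rule step, assumption+)
      using k1 apply (simp add: Rv)
     apply simp
     apply (rule conjI)
      apply (simp add: w0)
     apply (rule graph_ok_cong[OF G], simp)
    apply (elim conjE)
    apply (rule wp_mono[OF wp_sum_cells[where c = c]])
       apply (rule gregs_frame[OF _ _ R, where b = 30]; simp)
      apply assumption
     apply assumption
    apply (simp only: tot)
    apply (elim conjE)
    subgoal premises prems for t1 R1 M1 t2 R2 M2 t3 R3 M3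
    proof (intro conjI TrueI refl)
      show "1 + (t1 + (1 + (t2 + t3))) \<le> k * roundT"
        using time[OF prems(1,5,10)] by linarith
      show "\<forall>r<30. R3 r = R r" using prems(6,11) by simp
      show "\<exists>p. cells_ok p M2" using prems(8) by blast
    qed
    done
qed

end

section \<open>Enumerating the subsets by a binary counter\<close>

lemma bit_Suc_carry:
  assumes "\<forall>i<j. bit c i" "\<not> bit (c::nat) j"
  shows "bit (Suc c) v \<longleftrightarrow> v = j \<or> (j < v \<and> bit c v)"
  using assms
proof (induction j arbitrary: c v)
  case 0
  then have "even c" by (simp add: bit_0)
  then show ?case by (cases v) (auto simp: bit_0 bit_Suc)
next
  case (Suc j)
  have "odd c" using Suc.prems(1) by (auto simp: bit_0)
  then have d: "Suc c div 2 = Suc (c div 2)" "even (Suc c)" by simp_all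
  have "\<forall>i<j. bit (c div 2) i" "\<not> bit (c div 2) j"
    using Suc.prems by (auto simp: bit_Suc[symmetric])
  note IH = Suc.IH[OF this]
  show ?case
    using IH d by (cases v) (simp_all add: bit_0 bit_Suc)
qed

context run_machine
begin

text \<open>In the middle of an increment the low bits are cleared and the rest is still old; a
  predicate describes such signs more directly than a number does.\<close>

definition signs_ok :: "(nat \<Rightarrow> bool) \<Rightarrow> mem \<Rightarrow> bool" where
  "signs_ok P M \<longleftrightarrow>
    (\<forall>v\<le>n. M (3 + int v) = (if v < k \<and> P v then - int (off v) else int (off v))) \<and>
    (\<forall>e<m. M (int n + 4 + int e) = int (concat adj ! e))"

lemma graph_ok_signs: "graph_ok c M \<longleftrightarrow> signs_ok (bit c) M"
  by (simp add: graph_ok_def signs_ok_def)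

lemma signs_ok_cong: "signs_ok P M \<Longrightarrow> (\<And>v. v < k \<Longrightarrow> P v = P' v) \<Longrightarrow> signs_ok P' M"
  by (auto simp: signs_ok_def)

lemma signs_ok_upd:
  assumes "signs_ok P M" "j < k" "x = (if b then - int (off j) else int (off j))"
  shows "signs_ok (P(j := b)) (M(3 + int j := x))"
  using assms kn by (auto simp: signs_ok_def n_def)

lemma wp_next_subset:
  assumes R: "gregs R" and G: "graph_ok c M" and c: "c < 2 ^ k"
  shows "wp W next_subset R M (\<lambda>s R' M'. s \<le> k * 12 + 4 \<and> (\<forall>r<30. r \<noteq> 14 \<longrightarrow> R' r = R r) \<and>
    R' 14 = (if Suc c < 2 ^ k then 1 else 0) \<and> graph_ok (Suc c mod 2 ^ k) M' \<and> (\<forall>a<0. M' a = M a))"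
proof -
  \<comment> \<open>Either the carry stands at position j, with all bits of c below j set and their
    signs already cleared, or it has been absorbed and the index has jumped to k. Reaching j = k in
    the first case is the overflow.\<close>
  let ?J = "\<lambda>R' M'. (\<forall>r<30. r \<noteq> 14 \<longrightarrow> R' r = R r) \<and> (\<forall>a<0. M' a = M a) \<and>
    ((\<exists>j\<le>k. R' 30 = int j \<and> R' 14 = 0 \<and> (\<forall>i<j. bit c i) \<and> signs_ok (\<lambda>v. bit c v \<and> j \<le> v) M') \<or>
     (R' 30 = int k \<and> R' 14 = 1 \<and> Suc c < 2 ^ k \<and> signs_ok (bit (Suc c)) M'))"
  let ?v = "\<lambda>R' M'. nat (int k - R' 30)"
  note Rv = gregsD[OF R]
  let ?body = "Ins (Const 31 3) ;; Ins (Add 31 31 30) ;; Ins (Load 32 31) ;; Ins (Sub 33 0 32) ;; Ins (Store 31 33) ;;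
      IfLt 32 0 (Ins (Add 30 30 2)) (Ins (Const 14 1) ;; Ins (Add 30 5 0))"
  have step: "wp W ?body R' M' (\<lambda>s R'' M''. s \<le> 10 \<and> ?J R'' M'' \<and> ?v R'' M'' < ?v R' M')"
    if J: "?J R' M'" and lt: "R' 30 < R' 5" for R' M'
  proof -
    have fr: "\<And>r. r < 30 \<Longrightarrow> r \<noteq> 14 \<Longrightarrow> R' r = R r" and M': "\<forall>a<0. M' a = M a" using J by blast+
    have R5: "R' 5 = int k" "R' 0 = 0" "R' 2 = 1" using fr Rv by simp_all
    then have "\<exists>j\<le>k. R' 30 = int j \<and> R' 14 = 0 \<and> (\<forall>i<j. bit c i) \<and> signs_ok (\<lambda>v. bit c v \<and> j \<le> v) M'"
      using J lt by auto
    then obtain j where j: "R' 30 = int j" "R' 14 = 0" "\<forall>i<j. bit c i" "signs_ok (\<lambda>v. bit c v \<and> j \<le> v) M'"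
      by blast
    have jk: "j < k" using lt R5 j by simp
    have jn: "j \<le> n" using jk kn by (simp add: n_def)
    have Mj: "M' (3 + int j) = (if bit c j then - int (off j) else int (off j))"
      using j(4) jk jn by (simp add: signs_ok_def)
    have b: "3 \<le> W" "3 + int j \<le> W" "int j + 1 \<le> W" "int k \<le> W" "int (off j) \<le> W" "0 < int (off j)"
      using jn kn graph_abs(2)[OF G jn] off_ge[of j] by (simp_all add: W_nm n_def)
    show ?thesis
    proof (cases "bit c j")
      case True
      have s: "signs_ok (\<lambda>v. bit c v \<and> Suc j \<le> v) (M'(3 + int j := int (off j)))"
        by (rule signs_ok_cong[OF signs_ok_upd[OF j(4) jk, of _ False]]) (auto simp: not_less_eq_eq)
      have "\<forall>i<Suc j. bit c i" using j(3) True by (auto simp: less_Suc_eq)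
      then show ?thesis
        using s M' b jk fr
        by (auto simp: R5 j Mj True intro!: exI[of _ "Suc j"])
    next
      case False
      have s: "signs_ok (bit (Suc c)) (M'(3 + int j := - int (off j)))"
        by (rule signs_ok_cong[OF signs_ok_upd[OF j(4) jk, of _ True]])
          (auto simp: bit_Suc_carry[OF j(3) False])
      have "Suc c \<noteq> 2 ^ k"
      proof
        assume "Suc c = 2 ^ k"
        then have "c = mask k" by (simp add: mask_eq_exp_minus_1)
        then show False using False jk by (simp add: bit_mask_iff)
      qed
      then have "Suc c < 2 ^ k" using c by simp
      then show ?thesis
        using s M' b jk fr by (auto simp: R5 j Mj False)
    qed
  qed
  have init: "signs_ok (bit c) M" using G by (simp add: graph_ok_signs)
  have fin: "graph_ok (Suc c mod 2 ^ k) M' \<and> R' 14 = (if Suc c < 2 ^ k then 1 else 0)"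
    if J: "?J R' M'" and lt: "\<not> R' 30 < R' 5" for R' M'
  proof -
    have R5: "R' 5 = int k" using J Rv by auto
    from J consider j where "j \<le> k" "R' 30 = int j" "R' 14 = 0" "\<forall>i<j. bit c i" "signs_ok (\<lambda>v. bit c v \<and> j \<le> v) M'"
      | "R' 14 = 1" "Suc c < 2 ^ k" "signs_ok (bit (Suc c)) M'" by blast
    then show ?thesis
    proof cases
      case 1
      then have jk: "j = k" using lt R5 by simp
      have "c = mask k"
      proof (rule bit_eqI)
        fix i
        show "bit c i \<longleftrightarrow> bit (mask k :: nat) i"
          using 1(4) not_bit_large[OF c, of i] jk by (cases "i < k") (auto simp: bit_mask_iff)
      qed
      then have "Suc c = 2 ^ k" by (simp add: mask_eq_exp_minus_1)
      moreover have "signs_ok (bit 0) M'"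
        by (rule signs_ok_cong[OF 1(5)]) (auto simp: jk)
      ultimately show ?thesis using 1(3) by (simp add: graph_ok_signs)
    next
      case 2
      then show ?thesis by (simp add: graph_ok_signs)
    qed
  qed
  show ?thesis
    unfolding next_subset_def
    apply (simp only: wp_Seq wp_Ins)
    apply (rule conjI, simp add: W2)
    apply (rule conjI, simp add: W2)
    apply (rule wp_mono)
     apply (rule wp_While_variant[where J = ?J and v = ?v and B = 10 and n = k])
       apply (rule step, assumption+)
      apply (intro conjI disjI1 exI[of _ 0]; simp add: init)
     apply simp
    subgoal premises prems for s R1 M1
    proof -
      have "graph_ok (Suc c mod 2 ^ k) M1 \<and> R1 14 = (if Suc c < 2 ^ k then 1 else 0)"
        using fin prems by blast
      moreover have "1 + (1 + s) \<le> k * 12 + 4" using conjunct1[OF prems] by simp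
      ultimately show ?thesis using prems by blast
    qed
    done
qed

end

section \<open>Subsets and hash seeds\<close>

definition subset_step :: com where
  "subset_step =
    eval_prog ;; Ins (Add 80 13 0) ;; Ins (Add 81 41 0) ;; xor_op ;; Ins (Add 13 82 0) ;; next_subset"

definition subset_loop :: com where
  "subset_loop =
    Ins (Const 13 0) ;; Ins (Const 14 1) ;;
    WhileLt 0 14 subset_step"

definition one_seed :: com where
  "one_seed = subset_loop ;; IfLt 0 13 (Ins (Const 12 1)) (Ins (Const 13 0)) ;; Ins (Add 10 10 2)"

definition seed_loop :: com where
  "seed_loop =
    Ins (Const 12 0) ;; Ins (Const 10 1) ;;
    WhileLt 10 11 one_seed"

context run_machine
begin

definition seed_sum :: "nat \<Rightarrow> bit poly" where
  "seed_sum b = (\<Sum>S\<in>Pow {..<k}. walk_total adj k S (\<lambda>u. hash q b (label adj u)))"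

lemma seed_sum_bits:
  "seed_sum b = (\<Sum>c<2 ^ k. walk_total adj k (subset_of c) (\<lambda>u. hash q b (label adj u)))"
  unfolding seed_sum_def sum_Pow_bits subset_of_def ..

definition subsetT :: nat where
  "subsetT = 2 ^ k * (k * roundT + opT + 12 * k + 20) + 4"

lemma wp_subset_loop:
  assumes R: "gregs R" and C: "\<exists>p. cells_ok p M" and G: "graph_ok 0 M"
  shows "wp W subset_loop R M (\<lambda>s R' M'. s \<le> subsetT \<and> (\<forall>r<13. R' r = R r) \<and>
    R' 13 = int (E (seed_sum beta)) \<and> graph_ok 0 M' \<and> (\<exists>p. cells_ok p M'))"
proof -
  let ?T = "\<lambda>c. walk_total adj k (subset_of c) (\<lambda>u. hash q beta (label adj u))"
  define more :: "nat \<Rightarrow> int" where "more c = (if c < 2 ^ k then 1 else 0)" for c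
  define A where "A c = (\<Sum>c<c. ?T c)" for c
  have A: "A (Suc c) = A c + ?T c" "A 0 = 0" for c by (simp_all add: A_def)
  \<comment> \<open>At c = 2^k the counter has wrapped around to the empty subset, which is the
    state that the next seed needs.\<close>
  let ?I = "\<lambda>c R' M'. (\<forall>r<13. R' r = R r) \<and> R' 13 = int (E (A c)) \<and> R' 14 = more c \<and> graph_ok (c mod 2 ^ k) M' \<and> (\<exists>p. cells_ok p M')"
  have step: "R' 0 < R' 14 \<and> wp W subset_step R' M' (\<lambda>s R'' M''. s \<le> k * roundT + opT + 12 * k + 18 \<and> ?I (Suc c) R'' M'')"
    if I: "?I c R' M'" and c: "c < 2 ^ k" for c R' M'
  proof -
    have fr: "\<forall>r<13. R' r = R r" and R13: "R' 13 = int (E (A c))" and R14: "R' 14 = 1"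
      and G': "graph_ok c M'" using I c by (auto simp: more_def)
    obtain p where C': "cells_ok p M'" using I by blast
    have R': "gregs R'" using gregs_frame[OF fr _ R] by simp
    note Rv = gregsD[OF R']
    show ?thesis
      unfolding subset_step_def
      apply (rule conjI)
       apply (simp add: Rv R14)
      apply (simp only: wp_Seq)
      apply (rule wp_mono[OF wp_eval_prog[OF R' C' G']])
      apply (elim conjE exE)
      subgoal premises prems for s1 R1 M1 p1
      proof -
        have R1: "gregs R1" by (rule gregs_frame[OF prems(2) _ R']) simp
        note Rv1 = gregsD[OF R1]
        show ?thesis
          apply (simp only: wp_Ins)
          apply (simp add: Rv1 prems(2,3) R13)
          apply (rule wp_mono[OF wp_xor_op[OF _ table_ok_cells[OF prems(5)], where p = "A c" and r = "?T c"]])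
             apply (insert R1, simp add: gregs_def fregs_def)[1]
            apply simp
           apply simp
          apply (elim conjE)
          subgoal premises xp for s2 R2 M2
          proof -
            have R2: "gregs R2" using gregs_frame[OF xp(3) _] R1 by (simp add: gregs_def fregs_def)
            have R2': "gregs (R2(13 := R2 82 + R2 0))" using R2 by (simp add: gregs_def fregs_def)
            have G2: "graph_ok c M2" using prems(4) xp(2) by simp
            show ?thesis
              apply (rule conjI)
               apply (simp add: xp(4) gregsD(1)[OF R2])
              apply (rule wp_mono[OF wp_next_subset[OF R2' G2 c]])
              apply (elim conjE)
              subgoal premises np for s3 R3 M3
              proof -
                have "cells_ok p1 M3"
                  by (rule cells_ok_cong[OF prems(5)]) (use np(5) xp(2) in simp)
                moreover have "R3 13 = int (E (A (Suc c)))"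
                  using np(2) xp(4) gregsD(1)[OF R2] by (simp add: A)
                moreover have "\<forall>r<13. R3 r = R r"
                  using np(2) xp(3) prems(2) fr by simp
                moreover have "s1 + (s2 + s3) + 3 \<le> k * roundT + opT + 12 * k + 18"
                  using np(1) xp(1) prems(1) by simp
                moreover have "R3 14 = more (Suc c)" using np(3) by (simp only: more_def)
                ultimately show ?thesis using np(4) by (intro conjI exI[of _ p1]) (linarith | assumption)+
              qed
              done
          qed
          done
      qed
      done
  qed
  note Rv = gregsD[OF R]
  show ?thesis
    unfolding subset_loop_def
    apply (simp only: wp_Seq wp_Ins)
    apply (rule conjI, simp add: W2)
    apply (rule conjI, simp add: W2)
    apply (rule wp_mono)
     apply (rule wp_While_count[where n = "2 ^ k" and B = "k * roundT + opT + 12 * k + 18" and I = ?I])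
       apply (rule step, assumption+)
      apply (simp add: Rv more_def)
     using C G apply (simp add: more_def A)
    apply (elim conjE)
    subgoal premises prems for s R1 M1
      using prems by (simp add: seed_sum_bits subsetT_def A_def algebra_simps)
    done
qed

text \<open>The part of \<open>gregs\<close> without the seed in register 10, which changes during
  the seed loop.\<close>

definition bregs :: "regs \<Rightarrow> bool" where
  "bregs R \<longleftrightarrow> fregs R \<and> R 3 = int n \<and> R 4 = int m \<and> R 5 = int k"

lemma wp_one_seed:
  assumes R: "gregs R" and C: "\<exists>p. cells_ok p M" and G: "graph_ok 0 M"
  shows "wp W one_seed R M (\<lambda>s R' M'. s \<le> subsetT + 5 \<and> (\<forall>r<10. R' r = R r) \<and> R' 11 = R 11 \<and>
    R' 10 = int beta + 1 \<and> R' 12 = (if F dvd seed_sum beta then R 12 else 1) \<and> graph_ok 0 M' \<and> (\<exists>p. cells_ok p M'))"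
proof -
  have b: "int beta + 1 \<le> W" using beta_q qW by simp
  show ?thesis
    unfolding one_seed_def
    apply (simp only: wp_Seq)
    apply (rule wp_mono[OF wp_subset_loop[OF R C G]])
    apply (elim conjE)
    subgoal premises prems for s R1 M1
      using prems gregsD[OF R] b W2 rep_eq_0_iff[of "seed_sum beta"]
      by (cases "F dvd seed_sum beta") simp_all
    done
qed

text \<open>The seed is a parameter of the locale, so each turn of the seed loop is verified in an
  interpretation of its own.\<close>

lemma other_seed:
  assumes "b < 2 ^ t"
  shows "run_machine W t f h tbl adj k b tab"
  by unfold_locales (fact assms valid kn k1 W label_q8 tab_W tab_eq)+

lemma wp_seed_loop:
  assumes R: "bregs R" and L: "R 11 = int L" "1 \<le> L" "L \<le> q" and C: "\<exists>p. cells_ok p M" and G: "graph_ok 0 M"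
  shows "wp W seed_loop R M (\<lambda>s R' M'. s \<le> L * (subsetT + 7) + 4 \<and> R' 0 = 0 \<and>
    R' 12 = (if \<exists>b\<in>{1..<L}. \<not> F dvd seed_sum b then 1 else 0))"
proof -
  let ?P = "\<lambda>b. \<exists>b'\<in>{1..<b}. \<not> F dvd seed_sum b'"
  let ?I = "\<lambda>i R' M'. (\<forall>r<10. R' r = R r) \<and> R' 11 = int L \<and> R' 10 = int (i + 1) \<and>
    R' 12 = (if ?P (i + 1) then 1 else 0) \<and> graph_ok 0 M' \<and> (\<exists>p. cells_ok p M')"
  have step: "R' 10 < R' 11 \<and> wp W one_seed R' M' (\<lambda>s R'' M''. s \<le> subsetT + 5 \<and> ?I (Suc i) R'' M'')"
    if I: "?I i R' M'" and i: "i < L - 1" for i R' M'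
  proof -
    have iq: "i + 1 < 2 ^ t" using i L(3) by (simp add: q_def)
    interpret S: run_machine W t f h tbl adj k "i + 1" tab
      using iq by (rule other_seed)
    have G': "graph_ok 0 M'" and C': "\<exists>p. cells_ok p M'" and r11: "R' 11 = int L" using I by blast+
    have r10: "R' 10 = int (i + 1)" using I by blast
    have fr: "\<forall>r<10. R' r = R r" using I by blast
    have R': "S.gregs R'"
      using R fr r10 unfolding S.gregs_def bregs_def fregs_def by simp
    have P: "?P (Suc i + 1) \<longleftrightarrow> ?P (i + 1) \<or> \<not> F dvd seed_sum (i + 1)"
    proof -
      have "{1..<Suc i + 1} = insert (i + 1) {1..<i + 1}" by auto
      then show ?thesis by (simp only: bex_simps) blast
    qed
    show ?thesis
      apply (rule conjI)
       using r10 r11 i apply simp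
      apply (rule wp_mono[OF S.wp_one_seed[OF R' C' G']])
      apply (elim conjE)
      subgoal premises prems for s R1 M1
      proof (intro conjI)
        show "R1 12 = (if ?P (Suc i + 1) then 1 else 0)"
          unfolding P using prems(5) I by (simp split: if_splits)
      qed (use prems fr r11 in simp_all)
      done
  qed
  have W1: "1 \<le> W" "0 \<le> W" using W2 by simp_all
  show ?thesis
    unfolding seed_loop_def
    apply (simp only: wp_Seq wp_Ins)
    apply (rule conjI, simp add: W1)
    apply (rule conjI, simp add: W1)
    apply (rule wp_mono)
     apply (rule wp_While_count[where n = "L - 1" and B = "subsetT + 5" and I = ?I])
       apply (rule step, assumption+)
      using L apply simp
     using G C L apply simp
    apply (elim conjE)
    subgoal premises prems for s R1 M1
    proof (intro conjI)
      have "(L - 1) * (subsetT + 5 + 2) \<le> L * (subsetT + 7)"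
        by (intro mult_le_mono) auto
      then show "1 + (1 + s) \<le> L * (subsetT + 7) + 4" using prems(1) by linarith
      show "R1 0 = 0" using prems(2) R by (simp add: bregs_def fregs_def)
      show "R1 12 = (if ?P L then 1 else 0)" using prems(5) L(2) by simp
    qed
    done
qed

text \<open>Without a k-path the sum is the zero polynomial for every seed, so no seed gives a wrong
  yes. With one, some seed separates its labels modulo F: by the union bound if 4 k^2 <= q, and seed
  1 if all labels are below q.\<close>

lemma seed_sum_correct:
  assumes F: "prime_elem F" and num: "num_kpaths adj k \<le> 1"
    and L: "(4 * k * k \<le> q \<and> L = 4 * k * k) \<or> ((\<forall>u<n. label adj u < q) \<and> L = 2)"
  shows "(\<exists>b\<in>{1..<L}. \<not> F dvd seed_sum b) \<longleftrightarrow> (\<exists>ws. is_kpath adj k ws)"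
proof
  assume "\<exists>b\<in>{1..<L}. \<not> F dvd seed_sum b"
  then obtain b where b: "\<not> F dvd seed_sum b" by blast
  show "\<exists>ws. is_kpath adj k ws"
  proof (rule ccontr)
    assume "\<not> ?thesis"
    then have "seed_sum b = 0"
      unfolding seed_sum_def using sum_walk_total_no_path[OF char2_bit_poly k1] by blast
    then show False using b by simp
  qed
next
  assume "\<exists>ws. is_kpath adj k ws"
  then obtain ws where ws: "is_kpath adj k ws" by blast
  then have walk: "ws \<in> walks adj k" and dist: "distinct ws" and len: "length ws = k"
    by (auto simp: is_kpath_iff walks_def)
  let ?L = "(\<lambda>i. label adj (ws ! i)) ` {..<k}"
  have wn: "ws ! i < n" if "i < k" for i
    using walk that nth_mem[of i ws] by (auto simp: walks_def n_def subset_iff)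
  have inj: "inj_on (\<lambda>i. label adj (ws ! i)) {..<k}"
  proof (rule linorder_inj_onI')
    fix i j assume ij: "i \<in> {..<k}" "j \<in> {..<k}" "i < j"
    then have "ws ! i \<noteq> ws ! j" using dist len by (simp add: nth_eq_iff_index_eq)
    then show "label adj (ws ! i) \<noteq> label adj (ws ! j)"
      using label_walk_inj[OF walk, of i j] ij by auto
  qed
  have "\<exists>b\<in>{1..<L}. \<forall>x\<in>?L. \<forall>y\<in>?L. x \<noteq> y \<longrightarrow> \<not> F dvd hash q b x - hash q b y"
    using L
  proof
    assume L: "4 * k * k \<le> q \<and> L = 4 * k * k"
    have "?L \<subseteq> {..<(2 ^ t) ^ 8}" using wn label_q8 by (auto simp: n_def)
    then show ?thesis
      using good_seed_exists[OF F, of ?L k] L k1 by (simp add: card_image[OF inj] q_def)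
  next
    assume L: "(\<forall>u<n. label adj u < q) \<and> L = 2"
    have "\<not> F dvd hash q 1 x - hash q 1 y" if "x \<in> ?L" "y \<in> ?L" "x \<noteq> y" for x y
    proof
      assume d: "F dvd hash q 1 x - hash q 1 y"
      have x: "x < 2 ^ t" "y < 2 ^ t" using that L wn by (auto simp: q_def)
      then have "hash q 1 x = pl x" "hash q 1 y = pl y" by (simp_all add: q_def hash_small)
      then have "pl x mod F = pl y mod F" using d by (simp add: mod_eq_dvd_iff)
      then show False using x that(3) by (simp add: pl_mod)
    qed
    then show ?thesis using L by (intro bexI[of _ 1]) auto
  qed
  then obtain b where b: "b \<in> {1..<L}" "\<And>x y. x \<in> ?L \<Longrightarrow> y \<in> ?L \<Longrightarrow> x \<noteq> y \<Longrightarrow> \<not> F dvd hash q b x - hash q b y"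
    by blast
  have "\<not> F dvd ryser k (\<lambda>i. hash q b (label adj (ws ! i)))"
  proof (rule ryser_not_dvd[OF char2_bit_poly F])
    fix i j assume ij: "i < j" "j < k"
    then have "label adj (ws ! i) \<noteq> label adj (ws ! j)"
      using inj_onD[OF inj, of i j] by auto
    then show "\<not> F dvd hash q b (label adj (ws ! i)) - hash q b (label adj (ws ! j))"
      using ij by (intro b(2)) auto
  qed
  then have "\<not> F dvd seed_sum b"
    unfolding seed_sum_def using sum_walk_total_unique_path[OF char2_bit_poly k1 ws num] by simp
  then show "\<exists>b\<in>{1..<L}. \<not> F dvd seed_sum b" using b(1) by blast
qed

end

section \<open>Choosing the field\<close>

text \<open>Dividing four times avoids computing the fourth power, which need not be a word.\<close>

definition fourth_quotient :: com where
  "fourth_quotient = Ins (Div 17 15 16) ;; Ins (Div 17 17 16) ;; Ins (Div 17 17 16) ;; Ins (Div 17 17 16)"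

definition halve_q :: com where
  "halve_q = Ins (Add 16 2 2) ;; Ins (Div 7 6 16)"

text \<open>The condition 4 k^2 <= q is tested as 3 < q div k div k, since the square of k need not
  be a word. If it fails, q becomes a power of two that is at least N, and the exclusive seed limit
  2 leaves only seed 1.\<close>

definition choose_regime :: com where
  "choose_regime =
    Ins (Div 17 6 5) ;; Ins (Div 17 17 5) ;; Ins (Const 18 3) ;;
    IfLt 18 17
      (Ins (Mul 11 5 5) ;; Ins (Add 11 11 11) ;; Ins (Add 11 11 11) ;; Ins (Add 19 2 0))
      (Ins (Add 6 2 2) ;; WhileLt 6 15 (Ins (Add 6 6 6)) ;; Ins (Add 11 2 2) ;; Ins (Const 19 0)) ;;
    halve_q"

text \<open>Register 15 receives N, a number above every label. The loop finds the largest power of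
  two q with q^4 <= N; it stops when N div (2 q)^4 in register 17 is 0.\<close>

definition choose_q :: com where
  "choose_q =
    IfLt 4 3 (Ins (Add 15 4 2)) (Ins (Add 15 3 0)) ;;
    Ins (Add 6 2 0) ;; Ins (Add 16 2 2) ;; fourth_quotient ;;
    WhileLt 0 17 (Ins (Add 6 16 0) ;; Ins (Add 16 16 16) ;; fourth_quotient) ;;
    choose_regime"

lemma wp_fourth_quotient:
  assumes "R 15 = int N" "R 16 = int p" "p > 0" "int N \<le> W"
  shows "wp W fourth_quotient R M (\<lambda>s R' M'. s = 4 \<and> M' = M \<and> R' = R(17 := int (N div p ^ 4)))"
proof -
  have q: "N div p div p div p div p = N div p ^ 4"
    by (simp add: div_mult2_eq[symmetric] power4_eq_xxxx mult.assoc)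
  have le: "int (N div x) \<le> W" for x
  proof -
    have "N div x \<le> N" by simp
    then show ?thesis using assms(4) by linarith
  qed
  have i: "int N div int p = int (N div p)" "int (N div p) div int p = int (N div p div p)"
    "int (N div p div p) div int p = int (N div p div p div p)"
    "int (N div p div p div p) div int p = int (N div p ^ 4)"
    by (simp_all only: zdiv_int[symmetric] q)
  have l: "int (N div p) \<le> W" "int (N div p div p) \<le> W" "int (N div p div p div p) \<le> W" "int (N div p ^ 4) \<le> W"
    using le[of p] le[of "p * p"] le[of "p * p * p"] le[of "p ^ 4"] by (simp_all only: div_mult2_eq)
  show ?thesis
    using assms(3) l by (simp add: fourth_quotient_def assms(1,2) i)
qed

text \<open>Both upper bounds on N come from the maximality of the first q, whose double has fourth
  power above N; without a table that q was below 4 k^2. The bound 2^t <= 2 N then keeps the new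
  size a word and polynomial in k.\<close>

definition regime :: "nat \<Rightarrow> nat \<Rightarrow> nat \<Rightarrow> nat \<Rightarrow> bool \<Rightarrow> regs \<Rightarrow> bool" where
  "regime N k t h tbl R \<longleftrightarrow> 1 \<le> t \<and> 2 ^ t = 2 * h \<and> R 6 = int (2 ^ t) \<and> R 7 = int h \<and> R 19 = of_bool tbl \<and>
     (if tbl then 4 * k * k \<le> 2 ^ t \<and> R 11 = int (4 * k * k) \<and> (2 ^ t) ^ 4 \<le> N \<and> N < 16 * (2 ^ t) ^ 4
      else R 11 = 2 \<and> N \<le> 2 ^ t \<and> 2 ^ t \<le> 2 * N \<and> N < 16 * (4 * k * k) ^ 4)"

lemma wp_choose_q:
  fixes n m k :: nat
  defines "N \<equiv> if m < n then m + 1 else n"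
  assumes R: "R 0 = 0" "R 2 = 1" "R 3 = int n" "R 4 = int m" "R 5 = int k"
    and k: "1 \<le> k" "k \<le> n" and W: "W = int (n + m + 4)"
  shows "wp W choose_q R M (\<lambda>s R' M'. s \<le> 20 * n + 40 \<and> M' = M \<and> (\<forall>r\<in>{0,2,3,4,5,9}. R' r = R r) \<and>
    (\<exists>t h tbl. regime N k t h tbl R'))"
proof -
  have N: "1 \<le> N" "N \<le> n" "2 * N \<le> n + m + 1" using k by (auto simp: N_def)
  have NW: "int N \<le> W" "2 * int N \<le> W" using N by (simp_all add: W)
  have W5: "5 \<le> W" using k by (simp add: W)
  let ?J = "\<lambda>R' M'. M' = M \<and> (\<forall>r\<in>{0,2,3,4,5,9}. R' r = R r) \<and> R' 15 = int N \<and>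
    (\<exists>s. R' 6 = int (2 ^ s) \<and> R' 16 = int (2 * 2 ^ s) \<and> (2 ^ s) ^ 4 \<le> N \<and> R' 17 = int (N div (2 * 2 ^ s) ^ 4))"
  let ?b1 = "Ins (Add 6 16 0) ;; Ins (Add 16 16 16) ;; fourth_quotient"
  have step1: "wp W ?b1 R' M' (\<lambda>s R'' M''. s \<le> 6 \<and> ?J R'' M'' \<and> nat (R'' 17) < nat (R' 17))"
    if J: "?J R' M'" and lt: "R' 0 < R' 17" for R' M'
  proof -
    obtain s where s: "R' 6 = int (2 ^ s)" "R' 16 = int (2 * 2 ^ s)" "(2 ^ s) ^ 4 \<le> N" "R' 17 = int (N div (2 * 2 ^ s) ^ 4)"
      using J by blast
    have J1: "M' = M" "\<forall>r\<in>{0,2,3,4,5,9}. R' r = R r" "R' 15 = int N" using J by blast+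
    have "0 < N div (2 * 2 ^ s) ^ 4" using lt s(4) J1 R by simp
    then have le: "(2 * 2 ^ s) ^ 4 \<le> N" by (metis div_greater_zero_iff)
    define p :: nat where "p = 2 * 2 ^ s"
    have p2: "2 \<le> p" by (simp add: p_def)
    have lep: "p ^ 4 \<le> N" using le by (simp only: p_def)
    \<comment> \<open>The bound 2 p <= p^4 <= N guarantees that doubling register 16 yields a
      word.\<close>
    have pp: "2 * p \<le> N"
    proof -
      have "2 * p \<le> p * p" using p2 by (rule mult_le_mono1)
      also have "\<dots> \<le> (p * p) * (p * p)" using p2 by simp
      also have "\<dots> = p ^ 4" by (simp add: power4_eq_xxxx)
      finally show ?thesis using lep by simp
    qed
    have dec: "N div (2 * p) ^ 4 < N div p ^ 4"
    proof -
      have "(2 * p) ^ 4 = p ^ 4 * 16" by (simp add: power_mult_distrib)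
      then have "N div (2 * p) ^ 4 = N div p ^ 4 div 16" by (simp only: div_mult2_eq)
      moreover have "0 < N div p ^ 4" using lep p2 by (simp add: div_greater_zero_iff)
      ultimately show ?thesis by simp
    qed
    have s': "R' 6 = int (2 ^ s)" "R' 16 = int p" "R' 17 = int (N div p ^ 4)"
      using s by (simp_all only: p_def)
    have W1: "int p \<le> W" "2 * int p \<le> W" using pp NW by linarith+
    show ?thesis
      apply (simp only: wp_Seq wp_Ins)
      apply (rule conjI)
       using J1 R W1 apply (simp add: s')
      apply (rule conjI)
       using J1 R W1 apply (simp add: s')
      apply (rule wp_mono[OF wp_fourth_quotient[where N = N and p = "2 * p"]])
          using J1 R NW p2 apply (simp_all add: s')[4]
      apply (elim conjE)
      subgoal premises prems for x R1 M1
      proof -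
        have "R1 6 = int (2 ^ Suc s)" "R1 16 = int (2 * 2 ^ Suc s)" "R1 17 = int (N div (2 * 2 ^ Suc s) ^ 4)"
          using prems(3) J1 R by (simp_all add: s' p_def)
        moreover have "(2 ^ Suc s) ^ 4 \<le> N" using lep by (simp add: p_def)
        moreover have "nat (R1 17) < nat (R' 17)" using prems(3) s' dec by simp
        moreover have "\<forall>r\<in>{0,2,3,4,5,9}. R1 r = R r" "R1 15 = int N" using prems(3) J1 by simp_all
        ultimately show ?thesis using prems(1,2) J1(1) by (intro conjI exI[of _ "Suc s"]; simp)
      qed
      done
  qed
  let ?J2 = "\<lambda>R' M'. M' = M \<and> (\<forall>r\<in>{0,2,3,4,5,9}. R' r = R r) \<and> R' 15 = int N \<and>
    (\<exists>s\<ge>1. R' 6 = int (2 ^ s) \<and> 2 ^ s \<le> 2 * N)"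
  have step2: "wp W (Ins (Add 6 6 6)) R' M' (\<lambda>s R'' M''. s \<le> 1 \<and> ?J2 R'' M'' \<and> nat (int N - R'' 6) < nat (int N - R' 6))"
    if J: "?J2 R' M'" and lt: "R' 6 < R' 15" for R' M'
  proof -
    obtain s where s: "1 \<le> s" "R' 6 = int (2 ^ s)" "2 ^ s \<le> 2 * N" using J by blast
    have J1: "M' = M" "\<forall>r\<in>{0,2,3,4,5,9}. R' r = R r" "R' 15 = int N" using J by blast+
    define p :: nat where "p = 2 ^ s"
    have lt': "p < N" using lt J1 s(2) by (simp add: p_def)
    have p: "0 < p" by (simp add: p_def)
    have r6: "R' 6 = int p" using s(2) by (simp only: p_def)
    have "\<exists>s\<ge>1. 2 * int p = int (2 ^ s) \<and> 2 ^ s \<le> 2 * N"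
      using lt' s(1) by (intro exI[of _ "Suc s"]) (simp add: p_def)
    then show ?thesis
      using J1 NW lt' p by (simp add: r6)
  qed
  have tail1: "wp W halve_q R' M (\<lambda>x R'' M''. x = 2 \<and> M'' = M \<and>
      (\<forall>r. r \<noteq> 7 \<longrightarrow> r \<noteq> 16 \<longrightarrow> R'' r = R' r) \<and> (\<exists>h. 2 ^ s = 2 * h \<and> R'' 7 = int h))"
    if "R' 2 = 1" "R' 6 = int (2 ^ s)" "1 \<le> s" "int (2 ^ s) \<le> W" for R' s
  proof -
    define h :: nat where "h = 2 ^ (s - 1)"
    have h: "2 ^ s = 2 * h" using that(3) by (cases s) (simp_all add: h_def)
    have r6: "R' 6 = 2 * int h" using that(2) h by (simp del: of_nat_power)
    have hW: "int h \<le> W" using that(4) h by (simp del: of_nat_power)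
    show ?thesis using h hW W5 that(1) by (auto simp: r6 halve_q_def)
  qed
  have first: "wp W (IfLt 4 3 (Ins (Add 15 4 2)) (Ins (Add 15 3 0))) R M (\<lambda>x R' M'. x \<le> 3 \<and> M' = M \<and> R' = R(15 := int N))"
  proof (cases "m < n")
    case True
    then have "N = m + 1" by (simp add: N_def)
    then show ?thesis using True R NW by (simp add: add.commute)
  next
    case False
    then have "N = n" by (simp add: N_def)
    then show ?thesis using False R NW by simp
  qed
  show ?thesis
    unfolding choose_q_def
    apply (simp only: wp_Seq)
    apply (rule wp_mono[OF first])
    apply (elim conjE)
    apply (simp only: wp_Ins)
    apply (rule conjI)
     using R W5 apply simp
    apply (rule conjI)
     using R W5 apply simp
    apply (rule wp_mono[OF wp_fourth_quotient[where N = N and p = 2]])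
        using R NW apply simp_all[4]
    apply (elim conjE)
    apply (rule wp_mono)
     \<comment> \<open>The number of turns is logarithmic, but n is a sufficient bound where linear
       time is allowed.\<close>
     apply (rule wp_While_variant[where J = ?J and v = "\<lambda>R' M'. nat (R' 17)" and B = 6 and n = n])
       apply (rule step1, assumption+)
      subgoal premises prems for x R1 M1 y R2 M2
        by (intro conjI exI[of _ 0]) (use prems R N in simp_all)
     subgoal premises prems for x R1 M1 y R2 M2
       using prems div_le_dividend[of N 16] N(2) by simp
    apply (elim conjE exE)
    subgoal premises prems for x0 R0 M0 x1 R1 M1 x2 R2 M2 s
    proof -
      define q0 :: nat where "q0 = 2 ^ s"
      have r: "\<forall>r\<in>{0,2,3,4,5,9}. R2 r = R r" "R2 15 = int N" "R2 6 = int q0" "R2 17 = int (N div (2 * q0) ^ 4)"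
        "\<not> R2 0 < R2 17" "M2 = M" and q04: "q0 ^ 4 \<le> N"
        using prems by (simp_all add: q0_def)
      have time: "x2 \<le> 8 * n + 2" "x0 \<le> 3" "x1 = 4" using prems by simp_all
      have "N div (2 * q0) ^ 4 = 0" using r R by simp
      then have "N < (2 * q0) ^ 4" by (simp add: div_eq_0_iff q0_def)
      then have N16: "N < 16 * q0 ^ 4" by (simp add: power_mult_distrib)
      have q0: "1 \<le> q0" by (simp add: q0_def)
      then have "q0 \<le> q0 ^ 4" using power_increasing[of 1 4 q0] by simp
      then have q0N: "q0 \<le> N" using q04 by simp
      then have q0W: "int q0 \<le> W" "int (q0 div k) \<le> W" "int (q0 div k div k) \<le> W"
        using NW(1) div_le_dividend[of q0 k] div_le_dividend[of "q0 div k" k] by linarith+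
      have dv: "int q0 div int k = int (q0 div k)" "int (q0 div k) div int k = int (q0 div k div k)"
        by (simp_all add: zdiv_int)
      have k0: "k \<noteq> 0" using k by simp
      have dk: "q0 div k div k = q0 div (k * k)" by (simp add: div_mult2_eq)
      note Rr = r(1)[simplified] R
      show ?thesis
      proof (cases "4 \<le> q0 div k div k")
        case True
        then have "4 * (k * k) \<le> q0 div (k * k) * (k * k)" unfolding dk by (rule mult_le_mono1)
        also have "\<dots> \<le> q0" by simp
        finally have kk: "4 * k * k \<le> q0" by simp
        have kW: "int k * int k \<le> W" "2 * (int k * int k) \<le> W" "4 * (int k * int k) \<le> W"
        proof -
          have "int (4 * k * k) \<le> int q0" using kk by (simp only: of_nat_le_iff)
          then show "int k * int k \<le> W" "2 * (int k * int k) \<le> W" "4 * (int k * int k) \<le> W"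
            using q0W(1) zero_le_mult_iff[of "int k" "int k"] by simp_all
        qed
        have s1: "1 \<le> s"
        proof (rule ccontr)
          assume "\<not> 1 \<le> s"
          then have "q0 = 1" by (simp add: q0_def)
          then show False using kk mult_le_mono[OF k(1) k(1)] by simp
        qed
        have gt: "3 < int (q0 div k div k)" using True by simp
        have r0: "R2 0 = 0" "R2 2 = 1" "R2 5 = int k" using r(1) R by simp_all
        show ?thesis
          using gt W5 kW q0W k0
          apply (simp add: choose_regime_def r(2-4,6) r0 dv del: of_nat_div)
          apply (rule wp_mono[OF tail1[where s = s]])
              using s1 q0W apply (simp_all add: r0 r q0_def[symmetric] del: of_nat_power)[4]
          apply (elim conjE exE)
          subgoal premises tp for x3 R3 M3 h
          proof -
            have "regime N k s h True R3"
              unfolding regime_def using tp q0_def kk q04 N16 s1 r(3) by simp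
            moreover have "R3 r = R r" if "r \<in> {0, 2, 3, 4, 5, 9}" for r
              using tp that r(1) by auto
            ultimately show ?thesis using tp time by auto
          qed
          done
      next
        case False
        then have "q0 div (k * k) < 4" unfolding dk by simp
        then have q0k: "q0 < 4 * k * k" using k0 by (simp add: div_less_iff_less_mult mult.assoc)
        \<comment> \<open>The failed test means q0 < 4 k^2, so N is polynomially bounded in k and
          slow arithmetic is affordable.\<close>
        have N4: "N < 16 * (4 * k * k) ^ 4"
        proof -
          have "q0 ^ 4 \<le> (4 * k * k) ^ 4" using q0k by (intro power_mono) auto
          then show ?thesis using N16 by linarith
        qed
        have ngt: "\<not> 3 < int (q0 div k div k)" using False by simp
        have r0: "R2 0 = 0" "R2 2 = 1" "R2 5 = int k" using r(1) R by simp_all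
        show ?thesis
          using ngt W5 q0W k0
          apply (simp add: choose_regime_def r(2-4,6) r0 dv del: of_nat_div)
          apply (rule wp_mono)
           apply (rule wp_While_variant[where J = ?J2 and v = "\<lambda>R' M'. nat (int N - R' 6)" and B = 1 and n = n])
             apply (rule step2, assumption+)
          subgoal premises ip
            by (intro conjI exI[of _ 1]) (use r r0 N in simp_all)
          subgoal premises ip
            using N(2) by simp
          apply (elim conjE exE)
          subgoal premises lp for x3 R3 M3 s'
          proof -
            define q1 :: nat where "q1 = 2 ^ s'"
            have l: "\<forall>r\<in>{0,2,3,4,5,9}. R3 r = R r" "R3 15 = int N" "R3 6 = int q1" "1 \<le> s'" "q1 \<le> 2 * N"
              "\<not> R3 6 < R3 15" "x3 \<le> n * 3 + 2" "M3 = M"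
              using lp by (simp_all add: q1_def)
            have Nq: "N \<le> q1" using l(2,3,6) by simp
            have q1W: "int q1 \<le> W" using l(5) NW(2) by linarith
            have l0: "R3 2 = 1" "R3 0 = 0" using l(1) R by simp_all
            show ?thesis
              using W5 l0
              apply (simp add: l(8))
              apply (rule wp_mono[OF tail1[where s = s']])
                  using l(4) apply (simp_all add: l0 l(3,8) q1_def[symmetric] q1W del: of_nat_power)[4]
              apply (elim conjE exE)
              subgoal premises tp for x4 R4 M4 h
              proof -
                have "regime N k s' h False R4"
                  unfolding regime_def using tp q1_def Nq N4 l by simp
                moreover have "R4 r = R r" if "r \<in> {0, 2, 3, 4, 5, 9}" for r
                  using tp that l(1) by auto
                ultimately show ?thesis using tp time l(7) by auto
              qed
              done
          qed
          done
      qed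
    qed
    done
qed

section \<open>Finding an irreducible modulus and filling the table\<close>

definition check_entry :: com where
  "check_entry =
    Ins (Add 60 22 0) ;; Ins (Add 61 23 0) ;; mul_slow ;;
    IfLt 0 62 (Ins (Const 24 0)) (Ins (Const 21 0)) ;; Ins (Add 23 23 2)"

definition check_row :: com where
  "check_row =
    Ins (Const 23 1) ;;
    WhileLt 23 6 check_entry"

definition check_modulus :: com where
  "check_modulus =
    Ins (Const 21 1) ;; Ins (Const 22 1) ;;
    WhileLt 22 6 (check_row ;; Ins (Add 22 22 2))"

text \<open>Exhaustive search: up to q candidates, fewer than q^2 products for each, and at most 85
  q steps per product fit into a budget proportional to q^4.\<close>

definition find_modulus :: com where
  "find_modulus =
    Ins (Const 8 0) ;; Ins (Const 20 0) ;;
    WhileLt 20 2 (check_modulus ;; IfLt 0 21 (Ins (Const 20 1)) (Ins (Add 8 8 2)))"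

text \<open>The packed pair of sum and product is multiplied by q once more, which leaves remainder
  0 and room for a value of the dynamic program.\<close>

definition fill_entry :: com where
  "fill_entry =
    Ins (Div 22 20 6) ;; Ins (Mod 23 20 6) ;;
    Ins (Add 80 22 0) ;; Ins (Add 81 23 0) ;; xor_slow ;; Ins (Add 24 82 0) ;;
    Ins (Add 60 22 0) ;; Ins (Add 61 23 0) ;; mul_slow ;;
    Ins (Mul 25 62 6) ;; Ins (Add 25 25 24) ;; Ins (Mul 25 25 6) ;;
    Ins (Const 26 (-1)) ;; Ins (Sub 26 26 20) ;; Ins (Store 26 25) ;; Ins (Add 20 20 2)"

definition fill_table :: com where
  "fill_table =
    IfLt 0 19
      (Ins (Const 20 0) ;; Ins (Mul 21 6 6) ;;
       WhileLt 20 21 fill_entry ;;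
       Ins (Const 9 1))
      (Ins (Const 20 0))"

definition mulT :: "nat \<Rightarrow> nat" where
  "mulT t = t * (22 * t + 36) + 5"

context
  fixes t h q :: nat and W :: int
  assumes t: "1 \<le> t" and h: "2 ^ t = 2 * h" and tW: "2 ^ t \<le> W" and q_def: "q = 2 ^ t"
begin

definition sregs :: "nat \<Rightarrow> regs \<Rightarrow> bool" where
  "sregs f R \<longleftrightarrow> R 0 = 0 \<and> R 2 = 1 \<and> R 6 = int q \<and> R 7 = int h \<and> R 8 = int f"

lemma qW: "int q \<le> W" using tW by (simp add: q_def)

lemma q2: "2 \<le> q" using power_increasing[of 1 t "2::nat"] t by (simp add: q_def)

lemma W2: "0 \<le> W" "1 \<le> W" "2 \<le> W" using q2 qW by simp_all

lemma mul_call: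
  assumes "sregs f R" "f < q" "R 60 = int a" "R 61 = int b" "a < q" "b < q"
  shows "wp W mul_slow R M (\<lambda>s R' M'. s \<le> mulT t \<and> M' = M \<and> (\<forall>r<60. R' r = R r)
    \<and> R' 62 = int (rep (pl (q + f)) (pl a * pl b)))"
  unfolding mulT_def
  by (rule wp_mul_slow[OF t h _ _ _ _ _ _ assms(3,4) _ _ tW]) (use assms(1)[unfolded sregs_def] assms(2-) in \<open>auto simp: q_def\<close>)

lemma wp_check_row:
  assumes R: "sregs f R" and f: "f < q" and a: "R 22 = int a" "a < q" and g: "R 21 = of_bool g"
  shows "wp W check_row R M (\<lambda>s R' M'. s \<le> q * (mulT t + 10) + 3 \<and> M' = M \<and> (\<forall>r<21. R' r = R r)
    \<and> R' 22 = R 22 \<and> R' 21 = of_bool (g \<and> (\<forall>b\<in>{1..<q}. rep (pl (q + f)) (pl a * pl b) \<noteq> 0)))"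
proof -
  define P where "P b \<longleftrightarrow> rep (pl (q + f)) (pl a * pl b) \<noteq> 0" for b
  define G where "G i \<longleftrightarrow> g \<and> (\<forall>b\<in>{1..<i + 1}. P b)" for i
  have G: "G (Suc i) \<longleftrightarrow> G i \<and> P (i + 1)" for i
  proof -
    have "{1..<Suc i + 1} = insert (i + 1) {1..<i + 1}" by auto
    then show ?thesis by (auto simp: G_def)
  qed
  let ?I = "\<lambda>i R' M'. M' = M \<and> (\<forall>r<21. R' r = R r) \<and> R' 22 = int a \<and> R' 23 = int i + 1 \<and> R' 21 = of_bool (G i)"
  have step: "R' 23 < R' 6 \<and> wp W check_entry R' M' (\<lambda>s R'' M''. s \<le> mulT t + 8 \<and> ?I (Suc i) R'' M'')"
    if I: "?I i R' M'" and i: "i < q - 1" for i R' M'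
  proof -
    have b: "i + 1 < q" "int i + 1 \<le> W" "int i + 2 \<le> W" "int a \<le> W" using i qW a(2) by simp_all
    have I1: "M' = M" "\<forall>r<21. R' r = R r" "R' 22 = int a" "R' 23 = int i + 1" "R' 21 = of_bool (G i)"
      using I by blast+
    have r: "R' 0 = 0" "R' 2 = 1" "R' 6 = int q" using I1(2) R by (simp_all add: sregs_def)
    show ?thesis
      unfolding check_entry_def
      apply (rule conjI)
       using b apply (simp add: r I1)
      apply (simp only: wp_Seq wp_Ins)
      apply (rule conjI)
       using b apply (simp add: r I1)
      apply (rule conjI)
       using b apply (simp add: r I1)
      apply (rule wp_mono[OF mul_call[OF _ f, where a = a and b = "i + 1"]])
           using I1 R r b a apply (simp_all add: sregs_def)[5]
      apply (elim conjE)
      subgoal premises prems for s R1 M1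
      proof (cases "P (i + 1)")
        case True
        then have "0 < R1 62" using prems(4) by (simp add: P_def)
        then show ?thesis using prems I1 r b W2 True by (simp add: G)
      next
        case False
        then have "R1 62 = 0" using prems(4) by (simp add: P_def)
        then show ?thesis using prems I1 r b W2 False by (simp add: G)
      qed
      done
  qed
  have Gq: "G (q - 1) \<longleftrightarrow> g \<and> (\<forall>b\<in>{1..<q}. rep (pl (q + f)) (pl a * pl b) \<noteq> 0)"
    using q2 by (simp add: G_def P_def)
  show ?thesis
    unfolding check_row_def
    apply (simp only: wp_Seq wp_Ins)
    apply (rule conjI)
     using W2 apply simp
    apply (rule wp_mono)
     apply (rule wp_While_count[where n = "q - 1" and B = "mulT t + 8" and I = ?I])
       apply (rule step, assumption+)
      using R q2 apply (simp add: sregs_def)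
     using g a apply (simp add: G_def)
    apply (elim conjE)
    subgoal premises prems for s R1 M1
    proof -
      have "(q - 1) * (mulT t + 8 + 2) \<le> q * (mulT t + 10)" by (intro mult_le_mono) auto
      then show ?thesis using prems a Gq by simp
    qed
    done
qed

lemma wp_check_modulus:
  assumes R: "sregs f R" and f: "f < q"
  shows "wp W check_modulus R M (\<lambda>s R' M'. s \<le> q * (q * (mulT t + 10) + 8) + 4 \<and> M' = M \<and> (\<forall>r<21. R' r = R r)
    \<and> R' 21 = of_bool (prime_elem (pl (q + f))))"
proof -
  interpret modulus "pl (q + f)" t
    using degree_pl_pow_add[of f t] f t by unfold_locales (simp_all add: q_def)
  define P where "P a \<longleftrightarrow> (\<forall>b\<in>{1..<q}. rep (pl (q + f)) (pl a * pl b) \<noteq> 0)" for a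
  define G where "G i \<longleftrightarrow> (\<forall>a\<in>{1..<i + 1}. P a)" for i
  have G: "G (Suc i) \<longleftrightarrow> G i \<and> P (i + 1)" for i
  proof -
    have "{1..<Suc i + 1} = insert (i + 1) {1..<i + 1}" by auto
    then show ?thesis by (auto simp: G_def)
  qed
  let ?I = "\<lambda>i R' M'. M' = M \<and> (\<forall>r<21. R' r = R r) \<and> R' 22 = int i + 1 \<and> R' 21 = of_bool (G i)"
  have step: "R' 22 < R' 6 \<and> wp W (check_row ;; Ins (Add 22 22 2)) R' M'
      (\<lambda>s R'' M''. s \<le> q * (mulT t + 10) + 4 \<and> ?I (Suc i) R'' M'')"
    if I: "?I i R' M'" and i: "i < q - 1" for i R' M'
  proof -
    have b: "i + 1 < q" "int i + 2 \<le> W" using i qW by simp_all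
    have I1: "M' = M" "\<forall>r<21. R' r = R r" "R' 22 = int (i + 1)" "R' 21 = of_bool (G i)"
      using I by auto
    have R': "sregs f R'" using I1(2) R by (simp add: sregs_def)
    show ?thesis
      apply (rule conjI)
       using b R' apply (simp add: sregs_def I1)
      apply (simp only: wp_Seq)
      apply (rule wp_mono[OF wp_check_row[OF R' f I1(3) b(1) I1(4)]])
      apply (elim conjE)
      subgoal premises prems for s R1 M1
        using prems I1 b R by (simp add: G P_def sregs_def)
      done
  qed
  have Gq: "G (q - 1) \<longleftrightarrow> prime_elem (pl (q + f))"
    unfolding prime_iff using q2 by (simp add: G_def P_def q_def)
  show ?thesis
    unfolding check_modulus_def
    apply (simp only: wp_Seq wp_Ins)
    apply (rule conjI)
     using W2 apply simp
    apply (rule conjI)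
     using W2 apply simp
    apply (rule wp_mono)
     apply (rule wp_While_count[where n = "q - 1" and B = "q * (mulT t + 10) + 4" and I = ?I])
       apply (rule step, assumption+)
      using R q2 apply (simp add: sregs_def)
     apply (simp add: G_def)
    apply (elim conjE)
    subgoal premises prems for s R1 M1
    proof -
      have "(q - 1) * (q * (mulT t + 10) + 4 + 2) \<le> q * (q * (mulT t + 10) + 8)" by (intro mult_le_mono) auto
      then show ?thesis using prems Gq by simp
    qed
    done
qed

text \<open>The value 0 from q^2 on describes the cells that carry no table entry, so one function
  covers all cells.\<close>

definition table_entry :: "nat \<Rightarrow> nat \<Rightarrow> nat" where
  "table_entry f v = (if v < q * q then xor (v div q) (v mod q) + q * rep (pl (q + f)) (pl (v div q) * pl (v mod q)) else 0)"

text \<open>Both components are below q. With a residue packed underneath, a cell therefore stays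
  below q^3, which is a word when q^4 <= N.\<close>

lemma table_entry_less:
  assumes "f < q"
  shows "table_entry f v < q * q"
proof (cases "v < q * q")
  case True
  interpret modulus "pl (q + f)" t
    using degree_pl_pow_add[of f t] assms t by unfold_locales (simp_all add: q_def)
  have "v div q < q" "v mod q < q" using True q2 by (simp_all add: less_mult_imp_div_less)
  then have "xor (v div q) (v mod q) < q"
    unfolding q_def by (metis take_bit_nat_eq_self take_bit_nat_less_exp take_bit_xor)
  moreover have "rep (pl (q + f)) (pl (v div q) * pl (v mod q)) < q"
    using rep_less by (simp add: q_def)
  then have "Suc (rep (pl (q + f)) (pl (v div q) * pl (v mod q))) \<le> q" by simp
  then have "q * Suc (rep (pl (q + f)) (pl (v div q) * pl (v mod q))) \<le> q * q"
    by (rule mult_le_mono2)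
  ultimately show ?thesis using True by (simp add: table_entry_def)
next
  case False
  then show ?thesis using q2 by (simp add: table_entry_def)
qed

lemma wp_fill_table:
  assumes R: "sregs f R" and f: "f < q" and flag: "R 19 = of_bool tbl" "R 9 = 0"
    and big: "tbl \<Longrightarrow> int (q * q * q) \<le> W" and M: "\<forall>a<0. M a = 0"
  shows "wp W fill_table R M (\<lambda>s R' M'. s \<le> q * q * (11 * t + mulT t + 30) + 10 \<and> (\<forall>r<20. r \<noteq> 9 \<longrightarrow> R' r = R r) \<and>
    R' 9 = of_bool tbl \<and> (\<forall>a\<ge>0. M' a = M a) \<and>
    (\<forall>v. M' (-1 - int v) = int (q * (if tbl then table_entry f v else 0))))"
proof (cases tbl)
  case False
  then show ?thesis using flag R M W2 by (simp add: fill_table_def sregs_def)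
next
  case True
  have qqW: "int (q * q * q) \<le> W" using big True by simp
  let ?I = "\<lambda>i R' M'. (\<forall>r<20. R' r = R r) \<and> R' 21 = int (q * q) \<and> R' 20 = int i \<and> (\<forall>a\<ge>0. M' a = M a) \<and>
    (\<forall>v. M' (-1 - int v) = int (q * (if v < i then table_entry f v else 0)))"
  have r: "R 0 = 0" "R 2 = 1" "R 6 = int q" using R by (simp_all add: sregs_def)
  have q3: "q * q \<le> q * q * q" using q2 by simp
  then have qqW': "int (q * q) \<le> W" using qqW by linarith
  have step: "R' 20 < R' 21 \<and> wp W fill_entry R' M' (\<lambda>s R'' M''. s \<le> 11 * t + mulT t + 20 \<and> ?I (Suc i) R'' M'')"
    if I: "?I i R' M'" and i: "i < q * q" for i R' M'
  proof -
    define a where "a = i div q"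
    define b where "b = i mod q"
    define x where "x = xor a b"
    define y where "y = rep (pl (q + f)) (pl a * pl b)"
    have ab: "a < q" "b < q" using i q2 by (simp_all add: a_def b_def less_mult_imp_div_less)
    have abi: "int i div int q = int a" "int i mod int q = int b"
      by (simp_all add: a_def b_def zdiv_int zmod_int)
    have tv: "table_entry f i = x + q * y" using i by (simp add: table_entry_def a_def b_def x_def y_def)
    have lt: "x + q * y < q * q" using table_entry_less[OF f, of i] tv by simp
    have "q * (x + q * y) < q * (q * q)" using lt q2 by simp
    then have big: "int (q * (x + q * y)) \<le> W"
      using qqW by (simp only: mult.assoc)
    have x_le: "x + q * y \<le> q * (x + q * y)" "q * y \<le> x + q * y" "x \<le> x + q * y" using q2 by simp_all
    then have bnd: "int (x + q * y) \<le> W" "int (q * y) \<le> W" "int x \<le> W" using big by linarith+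
    have abW: "int a \<le> W" "int b \<le> W" "int i + 1 \<le> W" "\<bar>- 1 - int i\<bar> \<le> W"
      using ab qW i qqW' by (simp_all del: of_nat_mult)
    have I1: "\<forall>r<20. R' r = R r" "R' 21 = int (q * q)" "R' 20 = int i" "\<forall>a\<ge>0. M' a = M a"
      "\<forall>v. M' (-1 - int v) = int (q * (if v < i then table_entry f v else 0))" using I by blast+
    have r': "R' 0 = 0" "R' 2 = 1" "R' 6 = int q" using I1(1) r by simp_all
    have R': "sregs f R'" using R I1(1) by (simp add: sregs_def)
    show ?thesis
      unfolding fill_entry_def
      apply (rule conjI)
       using i apply (simp add: I1 del: of_nat_mult)
      apply (simp add: r' I1(3) abi abW)
      apply (rule conjI, use q2 in simp)
      apply (rule wp_mono[OF wp_xor_slow[where t = t and a = a and b = b]])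
             using ab t tW apply (simp_all add: r' q_def)[7]
      apply (elim conjE)
      subgoal premises xp for s1 R1 M1
        using xp bnd abW r' I1
        apply (simp add: x_def[symmetric])
        apply (rule wp_mono[OF mul_call[of f _ a b]])
              using R' f ab apply (simp_all add: sregs_def)[6]
        apply (elim conjE)
        subgoal premises mp for s2 R2 M2
        proof -
          have y62: "R2 62 = int y" using mp by (simp add: y_def)
          have tv': "int (table_entry f i) = int x + int q * int y" by (simp add: tv)
          show ?thesis
            using mp(1-7,9-) y62 bnd big W2 abW by (simp add: algebra_simps tv')
        qed
        done
      done
  qed
  show ?thesis
    unfolding fill_table_def
    using r flag True
    apply (simp del: of_nat_mult)
    apply (rule conjI, use W2 in simp)
    apply (rule conjI, use qqW' in simp)
    apply (rule wp_mono)
     apply (rule wp_While_count[where n = "q * q" and B = "11 * t + mulT t + 20" and I = ?I])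
       apply (rule step, assumption+)
      apply simp
     using M apply simp
    apply (elim conjE)
    subgoal premises prems for s R1 M1
    proof -
      have "\<And>v. table_entry f v = (if v < q * q then table_entry f v else 0)" by (simp add: table_entry_def)
      then show ?thesis using prems W2 by (simp add: algebra_simps)
    qed
    done
qed

lemma wp_find_modulus:
  assumes R: "R 0 = 0" "R 2 = 1" "R 6 = int q" "R 7 = int h"
  shows "wp W find_modulus R M (\<lambda>s R' M'. s \<le> q * (q * (q * (mulT t + 10) + 8) + 12) + 4 \<and> M' = M \<and>
    (\<forall>r<20. r \<noteq> 8 \<longrightarrow> R' r = R r) \<and> (\<exists>f<q. R' 8 = int f \<and> prime_elem (pl (q + f))))"
proof -
  obtain g where g: "g < q" "prime_elem (pl (q + g))"
    using exists_prime_modulus[OF t] by (auto simp: q_def)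
  \<comment> \<open>An irreducible modulus with lower terms g exists, so until the flag in register
    20 is set the search satisfies f <= g and cannot leave the range below q. The variant drops to 0
    as soon as the flag is set.\<close>
  let ?J = "\<lambda>R' M'. M' = M \<and> (\<forall>r<20. r \<noteq> 8 \<longrightarrow> R' r = R r) \<and>
    (\<exists>f<q. R' 8 = int f \<and> ((R' 20 = 0 \<and> f \<le> g) \<or> (R' 20 = 1 \<and> prime_elem (pl (q + f)))))"
  let ?v = "\<lambda>R' M'. nat ((1 - R' 20) * (int q - R' 8))"
  have step: "wp W (check_modulus ;; IfLt 0 21 (Ins (Const 20 1)) (Ins (Add 8 8 2))) R' M'
      (\<lambda>s R'' M''. s \<le> q * (q * (mulT t + 10) + 8) + 10 \<and> ?J R'' M'' \<and> ?v R'' M'' < ?v R' M')"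
    if J: "?J R' M'" and lt: "R' 20 < R' 2" for R' M'
  proof -
    have J1: "M' = M" "\<forall>r<20. r \<noteq> 8 \<longrightarrow> R' r = R r" using J by blast+
    have r2: "R' 2 = 1" "R' 0 = 0" using J1 R by simp_all
    obtain f where f: "f < q" "R' 8 = int f" "R' 20 = 0" "f \<le> g"
      using J lt r2 by auto
    have R': "sregs f R'" using J1(2) R f(2) by (simp add: sregs_def)
    have fW: "int f + 1 \<le> W" using f(1) qW by simp
    show ?thesis
      apply (simp only: wp_Seq)
      apply (rule wp_mono[OF wp_check_modulus[OF R' f(1)]])
      apply (elim conjE)
      subgoal premises prems for s R1 M1
      proof (cases "prime_elem (pl (q + f))")
        case True
        then show ?thesis using prems J1 r2 W2 f by auto
      next
        case False
        then have "f < g" using f(4) g(2) by (metis le_neq_implies_less)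
        then have "f + 1 < q" "f + 1 \<le> g" using g(1) by simp_all
        then have "\<exists>f'<q. int f + 1 = int f' \<and> f' \<le> g" by (intro exI[of _ "f + 1"]) simp
        then show ?thesis using prems J1 r2 W2 f False fW \<open>f + 1 < q\<close> by auto
      qed
      done
  qed
  show ?thesis
    unfolding find_modulus_def
    apply (simp only: wp_Seq wp_Ins)
    apply (rule conjI)
     using W2 apply simp
    apply (rule conjI)
     using W2 apply simp
    apply (rule wp_mono)
     apply (rule wp_While_variant[where J = ?J and v = ?v and B = "q * (q * (mulT t + 10) + 8) + 10" and n = q])
       apply (rule step, assumption+)
      apply (intro conjI exI[of _ 0] disjI1; use q2 in simp)
     apply simp
    apply (elim conjE exE)
    subgoal premises prems for s R1 M1 f
    proof -
      have "R1 2 = 1" using prems R by simp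
      moreover have "1 + (1 + s) \<le> q * (q * (q * (mulT t + 10) + 8) + 12) + 4"
        using prems(1) by (simp add: algebra_simps)
      ultimately show ?thesis using prems(2-) by auto
    qed
    done
qed

end

section \<open>The decision program\<close>

text \<open>Register 0 is the constant 0 up to the last instruction, which moves the answer from
  register 12 there.\<close>

definition decide_prog :: com where
  "decide_prog = choose_q ;; find_modulus ;; fill_table ;; seed_loop ;; Ins (Add 0 12 0)"

text \<open>For k = 0 the answer is 1 because of the empty sequence; the algebra needs k >=
  1.\<close>

definition main_prog :: com where
  "main_prog =
    Ins (Const 2 1) ;; Ins (Load 3 0) ;; Ins (Load 4 2) ;; Ins (Add 16 2 2) ;; Ins (Load 5 16) ;;
    IfLt 0 5 decide_prog (Ins (Const 0 1))"

section \<open>Time bounds polynomial in k\<close>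

definition poly_bounded :: "(nat \<Rightarrow> nat) \<Rightarrow> bool" where
  "poly_bounded g \<longleftrightarrow> (\<exists>c d. \<forall>k. g k \<le> c * (k + 1) ^ d)"

lemma poly_bounded_const: "poly_bounded (\<lambda>_. a)"
  unfolding poly_bounded_def by (intro exI[of _ a] exI[of _ 0]) simp

lemma poly_bounded_id: "poly_bounded (\<lambda>k. k)"
  unfolding poly_bounded_def by (intro exI[of _ 1]) simp

lemma poly_bounded_add:
  assumes "poly_bounded g" "poly_bounded g'"
  shows "poly_bounded (\<lambda>k. g k + g' k)"
proof -
  obtain c d c' d' where *: "\<And>k. g k \<le> c * (k + 1) ^ d" "\<And>k. g' k \<le> c' * (k + 1) ^ d'"
    using assms unfolding poly_bounded_def by blast
  have "g k + g' k \<le> (c + c') * (k + 1) ^ (d + d')" for k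
  proof -
    have "c * (k + 1) ^ d \<le> c * (k + 1) ^ (d + d')" "c' * (k + 1) ^ d' \<le> c' * (k + 1) ^ (d + d')"
      by (intro mult_le_mono2 power_increasing; simp)+
    then show ?thesis using *[of k] unfolding add_mult_distrib by linarith
  qed
  then show ?thesis unfolding poly_bounded_def by blast
qed

lemma poly_bounded_mult:
  assumes "poly_bounded g" "poly_bounded g'"
  shows "poly_bounded (\<lambda>k. g k * g' k)"
proof -
  obtain c d c' d' where *: "\<And>k. g k \<le> c * (k + 1) ^ d" "\<And>k. g' k \<le> c' * (k + 1) ^ d'"
    using assms unfolding poly_bounded_def by blast
  have "g k * g' k \<le> (c * c') * (k + 1) ^ (d + d')" for k
    using mult_le_mono[OF *(1)[of k] *(2)[of k]] by (simp add: power_add mult_ac)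
  then show ?thesis unfolding poly_bounded_def by blast
qed

lemma poly_bounded_power: "poly_bounded g \<Longrightarrow> poly_bounded (\<lambda>k. g k ^ e)"
  by (induction e) (simp_all add: poly_bounded_const poly_bounded_mult)

lemmas poly_bounded_intros =
  poly_bounded_const poly_bounded_id poly_bounded_add poly_bounded_mult poly_bounded_power

lemma square_le_two_power: "t * t \<le> 2 * 2 ^ (t::nat)"
proof (induction t)
  case (Suc t)
  show ?case
  proof (cases "t \<le> 2")
    case True
    then consider "t = 0" | "t = 1" | "t = 2" by linarith
    then show ?thesis by cases simp_all
  next
    case False
    then have "2 * t + 1 \<le> t * t"
      using mult_le_mono1[of 3 t t] by linarith
    then show ?thesis using Suc by simp
  qed
qed simp

lemma mulT_le: "mulT t \<le> 85 * 2 ^ t"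
proof -
  have "t \<le> 2 ^ t" by (simp add: less_imp_le)
  \<comment> \<open>The constant is 85 = 2 * 22 + 36 + 5, from t * t <= 2 * 2^t, t <= 2^t and 1 <=
    2^t.\<close>
  moreover have "mulT t = 22 * (t * t) + 36 * t + 5" by (simp add: mulT_def algebra_simps)
  moreover have "(1::nat) \<le> 2 ^ t" by simp
  ultimately show ?thesis using square_le_two_power[of t] by linarith
qed

text \<open>A lookup takes at most 10 steps. Without a table q <= 2 N < 32 (4 k^2)^4, and an
  operation takes at most 97 q steps.\<close>

definition op_bound :: "nat \<Rightarrow> nat" where
  "op_bound k = 10 + 97 * (32 * (4 * k * k) ^ 4)"

definition weight_bound :: "nat \<Rightarrow> nat" where
  "weight_bound k = 8 * (3 * op_bound k + 20) + k * (2 * op_bound k + 22) + 40"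

definition subset_bound :: "nat \<Rightarrow> nat" where
  "subset_bound k = k * (weight_bound k + 2 * op_bound k + 100) + op_bound k + 12 * k + 24"

text \<open>The summands pay for the choice of q with small overheads, for the search and the table
  with q^4 <= n + (32 (4 k^2)^4)^4, and for at most 4 k^2 + 2 seeds.\<close>

definition time_bound :: "nat \<Rightarrow> nat" where
  "time_bound k = 100 + 255 * (1 + (32 * (4 * k * k) ^ 4) ^ 4) + (4 * k * k + 2) * (subset_bound k + 7)"

lemma poly_bounded_time: "poly_bounded time_bound"
  unfolding time_bound_def subset_bound_def weight_bound_def op_bound_def
  by (intro poly_bounded_intros)

context run_machine
begin

lemma subsetT_le:
  assumes "opT \<le> op_bound k"
  shows "subsetT \<le> 2 ^ k * ((n + m + 1) * subset_bound k)"
proof -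
  have "weightT \<le> weight_bound k"
    unfolding weightT_def weight_bound_def using assms
    by (intro add_mono mult_le_mono order_refl) auto
  then have "roundT \<le> (n + m + 1) * (weight_bound k + 2 * op_bound k + 100)"
    unfolding roundT_def using assms by (intro mult_le_mono2) auto
  then have "k * roundT \<le> k * ((n + m + 1) * (weight_bound k + 2 * op_bound k + 100))"
    by (rule mult_le_mono2)
  moreover have "opT + 12 * k + 20 + 4 \<le> (n + m + 1) * (op_bound k + 12 * k + 24)"
    using assms by (simp add: algebra_simps)
  ultimately have "k * roundT + opT + 12 * k + 20 + 4 \<le> (n + m + 1) * subset_bound k"
    unfolding subset_bound_def by (simp add: algebra_simps)
  then have "2 ^ k * (k * roundT + opT + 12 * k + 20 + 4) \<le> 2 ^ k * ((n + m + 1) * subset_bound k)"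
    by (rule mult_le_mono2)
  moreover have "subsetT \<le> 2 ^ k * (k * roundT + opT + 12 * k + 20 + 4)"
    unfolding subsetT_def by (simp add: algebra_simps)
  ultimately show ?thesis by linarith
qed

end

lemma setup_time:
  assumes "1 \<le> t" "q = 2 ^ t"
  shows "q * (q * (q * (mulT t + 10) + 8) + 12) + 4 + (q * q * (11 * t + mulT t + 30) + 10) \<le> 255 * q ^ 4"
proof -
  have q: "2 \<le> q" using power_increasing[of 1 t "2::nat"] assms by simp
  have t: "t \<le> q" "mulT t \<le> 85 * q"
    using mulT_le[of t] by (simp_all add: assms(2) less_imp_le)
  have "q * (q * (q * (mulT t + 10) + 8) + 12) + 4 + (q * q * (11 * t + mulT t + 30) + 10)
      \<le> q * (q * (q * (85 * q + 10) + 8) + 12) + 4 + (q * q * (11 * q + 85 * q + 30) + 10)"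
    using t by (intro add_mono mult_le_mono order_refl) auto
  \<comment> \<open>The constant 255 is the sum of these five coefficients, each power being at most
    q^4.\<close>
  also have "\<dots> = 85 * q ^ 4 + 106 * q ^ 3 + 38 * q ^ 2 + 12 * q + 14"
    by (simp add: algebra_simps power2_eq_square power3_eq_cube power4_eq_xxxx)
  also have "\<dots> \<le> 255 * q ^ 4"
  proof -
    have "1 \<le> q" using q by simp
    then have "q ^ 3 \<le> q ^ 4" "q ^ 2 \<le> q ^ 4" "q ^ 1 \<le> q ^ 4" "1 \<le> q ^ 4"
      using power_increasing[of 3 4 q] power_increasing[of 2 4 q] power_increasing[of 1 4 q] one_le_power[of q 4]
      by linarith+
    then show ?thesis unfolding power_one_right by linarith
  qed
  finally show ?thesis .
qed


section \<open>Input layout and correctness of the whole run\<close>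

lemma encode_memory:
  fixes adj :: "nat list list" and k :: nat
  defines "n \<equiv> length adj" and "m \<equiv> num_edges adj"
    and "M \<equiv> snd (snd (init_conf (encode adj k)))"
  shows "word_bound adj k = int (n + m + 4)"
    and "M 0 = int n" "M 1 = int m" "M 2 = int k"
    and "v \<le> n \<Longrightarrow> M (3 + int v) = int (n + 4 + out_offset adj v)"
    and "e < m \<Longrightarrow> M (int n + 4 + int e) = int (concat adj ! e)"
    and "a < 0 \<Longrightarrow> M a = 0"
proof -
  have lc: "length (concat adj) = m"
    by (simp add: m_def num_edges_def length_concat)
  have len: "length (encode adj k) = n + m + 4"
    by (simp add: encode_def lc[unfolded length_concat] length_concat n_def)
  then show "word_bound adj k = int (n + m + 4)" by (simp add: word_bound_def)
  have M: "M a = (if 0 \<le> a \<and> a < int (n + m + 4) then encode adj k ! nat a else 0)" for a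
    unfolding M_def init_conf_def len by simp
  show "M 0 = int n" "M 1 = int m" "M 2 = int k"
    unfolding M by (simp_all add: encode_def n_def m_def)
  show "a < 0 \<Longrightarrow> M a = 0" unfolding M by simp
  show "M (3 + int v) = int (n + 4 + out_offset adj v)" if "v \<le> n"
  proof -
    have "nat (3 + int v) = 3 + v" by simp
    moreover have "encode adj k ! (3 + v) = int (n + 4 + out_offset adj v)"
      using that by (simp add: encode_def nth_append n_def out_offset_def nth_map del: upt_Suc)
    ultimately show ?thesis using that unfolding M by simp
  qed
  show "M (int n + 4 + int e) = int (concat adj ! e)" if "e < m"
  proof -
    have "nat (int n + 4 + int e) = n + 4 + e" by simp
    moreover have "encode adj k ! (n + 4 + e) = int (concat adj ! e)"
      using that lc by (simp add: encode_def nth_append n_def del: upt_Suc)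
    ultimately show ?thesis using that unfolding M by simp
  qed
qed

lemma wp_main_prog:
  fixes adj :: "nat list list" and k :: nat
  assumes valid: "valid_digraph adj" and kn: "k \<le> length adj" and num: "num_kpaths adj k \<le> 1"
  shows "wp (word_bound adj k) main_prog (\<lambda>_. 0) (snd (snd (init_conf (encode adj k))))
    (\<lambda>s R' M'. s \<le> 2 ^ k * (length adj + num_edges adj + 1) * time_bound k \<and>
      R' 0 = (if \<exists>ws. is_kpath adj k ws then 1 else 0))"
proof -
  define n where "n = length adj"
  define m where "m = num_edges adj"
  define W where "W = word_bound adj k"
  define M where "M = snd (snd (init_conf (encode adj k)))"
  note mem = encode_memory[where adj = adj and k = k, folded n_def m_def W_def M_def]
  have W: "W = int (n + m + 4)" using mem(1) .
  have Wb: "4 \<le> W" "int n \<le> W" "int m \<le> W" "int k \<le> W" "1 \<le> W" "2 \<le> W"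
    using kn by (simp_all add: W n_def)
  define time where "time = 2 ^ k * (n + m + 1) * time_bound k"
  have time100: "100 \<le> time"
  proof -
    have "1 * 1 * 100 \<le> 2 ^ k * (n + m + 1) * time_bound k"
      by (intro mult_le_mono) (simp_all add: time_bound_def)
    then show ?thesis by (simp add: time_def)
  qed
  define R0 :: regs where "R0 = (\<lambda>_. 0)(2 := 1, 3 := int n, 4 := int m, 16 := 2, 5 := int k)"
  define ans :: int where "ans = (if \<exists>ws. is_kpath adj k ws then 1 else 0)"
  have ans0: "ans = 1" if "k = 0"
    using that by (auto simp: ans_def is_kpath_def intro!: exI[of _ "[]"])
  have main: "wp W decide_prog R0 M (\<lambda>s R' M'. s + 10 \<le> time \<and> R' 0 = ans)" if k1: "1 \<le> k"
  proof -
    define N where "N = (if m < n then m + 1 else n)"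
    have nk: "1 \<le> k" "k \<le> n" using k1 kn by (simp_all add: n_def)
    have N: "1 \<le> N" "N \<le> n" "2 * N \<le> n + m + 1" using nk by (auto simp: N_def)
    have R0: "R0 0 = 0" "R0 2 = 1" "R0 3 = int n" "R0 4 = int m" "R0 5 = int k" "R0 9 = 0"
      by (simp_all add: R0_def)
    show ?thesis
      unfolding decide_prog_def
      apply (simp only: wp_Seq)
      apply (rule wp_mono[OF wp_choose_q[OF R0(1-5) nk W, folded N_def]])
      apply (elim conjE exE)
      subgoal premises cq for s1 R1 M1 t h tbl
      proof -
        have M1: "M1 = M" using cq by simp
        have R1: "R1 0 = 0" "R1 2 = 1" "R1 3 = int n" "R1 4 = int m" "R1 5 = int k" "R1 9 = 0"
          using cq(3) R0 by simp_all
        note reg = cq(4)[unfolded regime_def]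
        define q :: nat where "q = 2 ^ t"
        have t: "1 \<le> t" and h: "2 ^ t = 2 * h" and R1q: "R1 6 = int q" "R1 7 = int h" "R1 19 = of_bool tbl"
          using reg unfolding q_def by blast+
        have q2: "2 \<le> q" using power_increasing[of 1 t "2::nat"] t by (simp add: q_def)
        have regT: "4 * k * k \<le> q" "R1 11 = int (4 * k * k)" "q ^ 4 \<le> N" "N < 16 * q ^ 4" if tbl
          using reg[folded q_def, unfolded if_P[OF that]] by blast+
        have regF: "R1 11 = 2" "N \<le> q" "q \<le> 2 * N" "N < 16 * (4 * k * k) ^ 4" if "\<not> tbl"
          using reg[folded q_def, unfolded if_not_P[OF that]] by blast+
        have q13: "q \<le> q ^ 4" "q * q * q \<le> q ^ 4" "q * q \<le> q ^ 4"
          using power_increasing[of 1 4 q] power_increasing[of 3 4 q] power_increasing[of 2 4 q] q2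
          by (simp_all add: power3_eq_cube power2_eq_square)
        have qN: "q \<le> 2 * N" using regT(3) regF(3) q13(1) by (cases tbl) simp_all
        have qW: "int q \<le> W" using qN N(3) by (simp add: W)
        have tW: "(2::int) ^ t \<le> W" using qW by (simp add: q_def)
        show ?thesis
          unfolding M1
          apply (rule wp_mono[OF wp_find_modulus[OF t h tW q_def R1(1,2) R1q(1,2)]])
          apply (elim conjE exE)
          subgoal premises fm for s2 R2 M2 f
          proof -
            have M2: "M2 = M" using fm by simp
            have f: "f < q" "f < 2 ^ t" using fm by (simp_all add: q_def)
            have prime: "prime_elem (pl (2 ^ t + f))" using fm(6) by (simp add: q_def)
            have R2: "R2 0 = 0" "R2 2 = 1" "R2 3 = int n" "R2 4 = int m" "R2 5 = int k" "R2 9 = 0"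
              "R2 6 = int q" "R2 7 = int h" "R2 19 = of_bool tbl" "R2 8 = int f" "R2 11 = R1 11"
              using fm(3,5) R1 R1q by simp_all
            have sr: "sregs h q f R2" unfolding sregs_def[OF t h tW q_def] using R2 by simp
            have big: "int (q * q * q) \<le> W" if tbl
              using q13(2) regT(3)[OF that] N(2) by (simp add: W del: of_nat_mult)
            have neg: "\<forall>a<0. M a = 0" using mem(7) by blast
            show ?thesis
              unfolding M2
              apply (rule wp_mono[OF wp_fill_table[OF t h tW q_def sr f(1) R2(9) R2(6) big neg]], assumption)
              apply (elim conjE)
              subgoal premises ft for s3 R3 M3
              proof -
                define tab where "tab v = (if tbl then table_entry q f v else 0)" for v
                define L where "L = (if tbl then 4 * k * k else 2)"
                \<comment> \<open>As q >= 2, a table size with N < 16 q^4 has N <= q^8, so labels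
                  have at most eight digits.\<close>
                have q16: "16 \<le> q ^ 4" using power_mono[of 2 q 4] q2 by simp
                have Nq8: "N \<le> q ^ 8"
                proof (cases tbl)
                  case True
                  have "N \<le> 16 * q ^ 4" using regT(4)[OF True] by simp
                  also have "\<dots> \<le> q ^ 4 * q ^ 4" using q16 by (rule mult_le_mono1)
                  also have "\<dots> = q ^ 8" by (simp add: power_add[symmetric])
                  finally show ?thesis .
                next
                  case False
                  then show ?thesis using regF(2) power_increasing[of 1 8 q] q2 by simp
                qed
                \<comment> \<open>Seed 0 is a placeholder for entering the locale;
                  \<open>wp_seed_loop\<close> interprets the locale again for each seed that is
                  tried.\<close>
                interpret rm: run_machine W t f h tbl adj k 0 tab
                proof unfold_locales
                  show "tbl \<Longrightarrow> 2 ^ t * 2 ^ t \<le> W"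
                  proof -
                    assume tbl
                    then have "int (q * q) \<le> W" using q13(3) regT(3) N(2) by (simp add: W del: of_nat_mult)
                    then show ?thesis by (simp add: q_def)
                  qed
                  show "label adj u < (2 ^ t) ^ 8" if "u < length adj" for u
                    using label_less[OF that] Nq8 unfolding N_def n_def m_def q_def by simp
                  show "int (x + 2 ^ t * tab v) \<le> W" if "v < length adj" "x < 2 ^ t" for v x
                  proof (cases tbl)
                    case True
                    have "Suc (tab v) \<le> q * q"
                      using table_entry_less[OF t h tW q_def f(1), of v] True by (simp add: tab_def)
                    then have "q * Suc (tab v) \<le> q * (q * q)" by (rule mult_le_mono2)
                    moreover have "x < q" using that(2) by (simp add: q_def)
                    ultimately have "x + q * tab v \<le> q * q * q" by (simp add: mult.assoc)
                    then show ?thesis using big[OF True] unfolding q_def by linarith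
                  next
                    case False
                    then show ?thesis using int_le_of_less_pow[OF that(2) tW] by (simp add: tab_def)
                  qed
                  show "a * 2 ^ t + b < length adj \<and>
                      tab (a * 2 ^ t + b) = xor a b + 2 ^ t * rep (pl (2 ^ t + f)) (pl a * pl b)"
                    if tbl "a < 2 ^ t" "b < 2 ^ t" for a b
                  proof -
                    have ab: "a < q" "b < q" using that by (simp_all add: q_def)
                    have "a * q + b < Suc a * q" using ab by simp
                    also have "\<dots> \<le> q * q" using ab by (intro mult_le_mono1) simp
                    finally have lt: "a * q + b < q * q" .
                    have "(a * q + b) div q = a" "(a * q + b) mod q = b" using ab by simp_all
                    then have "tab (a * q + b) = xor a b + q * rep (pl (q + f)) (pl a * pl b)"
                      using lt that(1) by (simp add: tab_def table_entry_def[OF t h tW q_def])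
                    moreover have "a * q + b < length adj"
                      using lt q13(3) regT(3)[OF that(1)] N(2) by (simp add: n_def)
                    ultimately show ?thesis by (simp only: q_def)
                  qed
                qed (use t h f tW valid kn k1 W in \<open>simp_all add: n_def m_def\<close>)
                have nm: "rm.n = n" "rm.m = m" "rm.q = q" "rm.F = pl (2 ^ t + f)"
                  by (simp_all only: rm.n_def rm.m_def rm.q_def rm.F_def n_def m_def q_def)
                have R3: "rm.bregs R3"
                  unfolding rm.bregs_def rm.fregs_def nm using ft(2,3) R2 by simp
                have L: "R3 11 = int L" "1 \<le> L" "L \<le> rm.q"
                  using ft(2) R2(11) regT(1,2) regF(1) q2 mult_le_mono[OF k1 k1] by (auto simp: L_def nm)
                have "rm.cells_ok (\<lambda>_. 0) M3"
                  unfolding rm.cells_ok_def rm.rep_0 nm(1,3) using ft(5) by (simp add: tab_def)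
                then have C: "\<exists>p. rm.cells_ok p M3" by blast
                have G: "rm.graph_ok 0 M3"
                  unfolding rm.graph_ok_def rm.off_def nm using ft(4) mem(5,6) by simp
                have Lq: "(4 * k * k \<le> rm.q \<and> L = 4 * k * k) \<or> ((\<forall>u<rm.n. label adj u < rm.q) \<and> L = 2)"
                proof (cases tbl)
                  case True
                  then show ?thesis using regT(1) by (simp add: L_def nm)
                next
                  case False
                  have "label adj u < q" if "u < n" for u
                    using label_less[of u adj] that regF(2)[OF False] unfolding N_def n_def m_def by simp
                  then show ?thesis using False by (simp add: L_def nm)
                qed
                have correct: "(\<exists>b\<in>{1..<L}. \<not> rm.F dvd rm.seed_sum b) \<longleftrightarrow> (\<exists>ws. is_kpath adj k ws)"
                  by (rule rm.seed_sum_correct[OF _ num Lq]) (simp only: nm prime)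
                define g0 where "g0 = (32 * (4 * k * k) ^ 4) ^ 4"
                \<comment> \<open>The setup costs a multiple of q^4. With a table q^4 <= N <= n,
                  otherwise q^4 is bounded by the polynomial \<open>g0\<close> in k; the sum covers
                  both cases.\<close>
                have q4: "q ^ 4 \<le> n + g0"
                proof (cases tbl)
                  case True
                  then show ?thesis using regT(3) N(2) by simp
                next
                  case False
                  have "q \<le> 32 * (4 * k * k) ^ 4" using regF(3,4)[OF False] by simp
                  then have "q ^ 4 \<le> g0" unfolding g0_def by (rule power_mono) simp
                  then show ?thesis by simp
                qed
                have op: "rm.opT \<le> op_bound k"
                proof (cases tbl)
                  case True
                  then show ?thesis unfolding rm.opT_def op_bound_def by simp
                next
                  case False
                  \<comment> \<open>The left side is \<open>mulT t + 7\<close>, which is at most 85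
                    q + 7.\<close>
                  have "t * (22 * t + 36) + 12 \<le> 97 * q"
                    using mulT_le[of t] q2 unfolding mulT_def q_def by linarith
                  also have "\<dots> \<le> 97 * (32 * (4 * k * k) ^ 4)" using regF(3,4)[OF False] by simp
                  finally show ?thesis using False unfolding rm.opT_def op_bound_def by simp
                qed
                have fin: "s1 + (s2 + (s3 + (s4 + 1))) + 10 \<le> time" if s4: "s4 \<le> L * (rm.subsetT + 7) + 4" for s4
                proof -
                  define Z where "Z = 2 ^ k * (n + m + 1)"
                  have KZ: "n + m + 1 \<le> Z" unfolding Z_def using mult_le_mono1[of 1 "2 ^ k" "n + m + 1"] by simp
                  have "L * (rm.subsetT + 7) \<le> (4 * k * k + 2) * (Z * subset_bound k + Z * 7)"
                  proof (intro mult_le_mono add_mono)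
                    show "L \<le> 4 * k * k + 2" by (simp add: L_def)
                    show "rm.subsetT \<le> Z * subset_bound k"
                      unfolding Z_def using rm.subsetT_le[OF op] by (simp only: nm mult.assoc)
                    show "7 \<le> Z * 7" using KZ by linarith
                  qed
                  also have "\<dots> = Z * ((4 * k * k + 2) * (subset_bound k + 7))" by (simp add: algebra_simps)
                  finally have 1: "L * (rm.subsetT + 7) \<le> Z * ((4 * k * k + 2) * (subset_bound k + 7))" .
                  have "n + g0 \<le> Z * 1 + Z * g0" using KZ by (intro add_mono) auto
                  then have 2: "255 * q ^ 4 \<le> Z * (255 * (1 + g0))" using q4 by (simp add: algebra_simps)
                  have 3: "s2 + s3 \<le> 255 * q ^ 4"
                    using setup_time[OF t q_def] fm(1) ft(1) by linarith
                  have 4: "s1 + 15 \<le> Z * 100" using cq(1) KZ by linarith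
                  have "time = Z * 100 + Z * (255 * (1 + g0)) + Z * ((4 * k * k + 2) * (subset_bound k + 7))"
                    unfolding time_def time_bound_def Z_def g0_def by (simp only: distrib_left)
                  then show ?thesis using 1 2 3 4 s4 by linarith
                qed
                show ?thesis
                  apply (rule wp_mono[OF rm.wp_seed_loop[OF R3 L C G]])
                  apply (elim conjE)
                  subgoal premises sl for s4 R4 M4
                    using sl(2,3) fin[OF sl(1)] Wb(1) unfolding correct ans_def by simp
                  done
              qed
              done
          qed
          done
      qed
      done
  qed
  show ?thesis
    unfolding main_prog_def W_def[symmetric] M_def[symmetric] n_def[symmetric] m_def[symmetric] time_def[symmetric] ans_def[symmetric]
    apply (simp only: wp_Seq wp_Ins)
    apply (cases "k = 0")
    subgoal
      using time100 Wb ans0 by (simp add: mem(2-4))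
    subgoal
      apply (simp add: Wb mem(2-4))
      apply (rule wp_mono[OF main[unfolded R0_def]])
       apply simp_all
      done
    done
qed

theorem theorem6:
  shows "\<exists>(P :: instr list) (c :: nat) (d :: nat).
    \<forall>(adj :: nat list list) (k :: nat).
      valid_digraph adj \<and> k \<le> length adj \<and> num_kpaths adj k \<le> 1 \<longrightarrow>
      (\<exists>c'. exec P (word_bound adj k)
                 (c * 2 ^ k * (length adj + num_edges adj + 1) * (k + 1) ^ d)
                 (init_conf (encode adj k)) = Some c'
            \<and> halted P c'
            \<and> fst (snd c') 0 = (if \<exists>ws. is_kpath adj k ws then 1 else 0))"
proof -
  obtain c d where cd: "\<And>k. time_bound k \<le> c * (k + 1) ^ d"
    using poly_bounded_time unfolding poly_bounded_def by blast
  show ?thesis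
  proof (rule exI[of _ "compile 0 main_prog"], rule exI[of _ c], rule exI[of _ d], intro allI impI)
    fix adj :: "nat list list" and k :: nat
    assume a: "valid_digraph adj \<and> k \<le> length adj \<and> num_kpaths adj k \<le> 1"
    have init: "init_conf (encode adj k) = (0, \<lambda>_. 0, snd (snd (init_conf (encode adj k))))"
      by (simp add: init_conf_def)
    have "2 ^ k * (length adj + num_edges adj + 1) * time_bound k
        \<le> 2 ^ k * (length adj + num_edges adj + 1) * (c * (k + 1) ^ d)"
      using cd by (rule mult_le_mono2)
    also have "\<dots> = c * 2 ^ k * (length adj + num_edges adj + 1) * (k + 1) ^ d"
      by (simp only: mult_ac)
    finally have time: "2 ^ k * (length adj + num_edges adj + 1) * time_bound k
        \<le> c * 2 ^ k * (length adj + num_edges adj + 1) * (k + 1) ^ d" .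
    have "wp (word_bound adj k) main_prog (\<lambda>_. 0) (snd (snd (init_conf (encode adj k))))
        (\<lambda>s R' M'. s \<le> c * 2 ^ k * (length adj + num_edges adj + 1) * (k + 1) ^ d \<and>
          R' 0 = (if \<exists>ws. is_kpath adj k ws then 1 else 0))"
      by (rule wp_mono[OF wp_main_prog]) (use a in blast, use a in blast, use a in blast, use order_trans[OF _ time] in blast)
    from wp_exec[OF this, folded init]
    show "\<exists>c'. exec (compile 0 main_prog) (word_bound adj k)
          (c * 2 ^ k * (length adj + num_edges adj + 1) * (k + 1) ^ d)
          (init_conf (encode adj k)) = Some c' \<and>
        halted (compile 0 main_prog) c' \<and>
        fst (snd c') 0 = (if \<exists>ws. is_kpath adj k ws then 1 else 0)" .
  qed
qed

end
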